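(* Suppose $0<\alpha<\infty$, $1<s<\infty$ and $\max\{1,\frac{1}{\alpha}\}\leq p<\infty$. Let $\mu$ be a finite positive Borel measure on $[0,1)$ with moments $\mu_n=\int_{[0,1)} t^n\,d\mu(t)$, $n\ge 0$, and let $X$ be a Banach subspace of $H(\mathbb{D})$ with $\Lambda^{s}_{1/s}\subset X\subset\mathcal{B}$. Then the following statements are equivalent. (1) The operator $\mathcal{C}_{\mu,\alpha}$ is bounded from $X$ to $B_p$. (2) The operator $\mathcal{C}_{\mu,\alpha}$ is compact from $X$ to $B_p$. (3) The measure $\mu$ satisfies $$\sum_{n=0}^{\infty}(n+1)^{p\alpha-1}\mu_n^{p}\log^{p}(n+2)<\infty.$$
   Context: $\mathbb{D}=\{z\in\mathbb{C}:|z|<1\}$ is the open unit disk, $H(\mathbb{D})$ is the space of all analytic functions on $\mathbb{D}$, and $dA(z)=\frac{dx\,dy}{\pi}$ is the normalized area measure on $\mathbb{D}$. Generalized Cesàro-like operator: for a finite positive Borel measure $\mu$ on $[0,1)$, $0<\alpha<\infty$ and $f(z)=\sum_{n=0}^\infty a_nz^n\in H(\mathbb{D})$, $$\mathcal{C}_{\mu,\alpha}(f)(z)=\sum_{n=0}^\infty\left(\mu_n\sum_{k=0}^n\frac{\Gamma(n-k+\alpha)}{\Gamma(\alpha)(n-k)!}a_k\right)z^n=\int_{[0,1)}\frac{f(tz)}{(1-tz)^\alpha}\,d\mu(t),\quad z\in\mathbb{D},$$ where $\mu_n=\int_{[0,1)}t^n\,d\mu(t)$. Bloch space $\mathcal{B}$: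 those $f\in H(\mathbb{D})$ with $\|f\|_{\mathcal{B}}=|f(0)|+\sup_{z\in\mathbb{D}}(1-|z|^2)|f'(z)|<\infty$. Analytic Besov spaces: for $1<p<\infty$, $B_p$ consists of those $f\in H(\mathbb{D})$ with $\|f\|_{B_p}=|f(0)|+\left(\int_{\mathbb{D}}|f'(z)|^p(1-|z|)^{p-2}\,dA(z)\right)^{1/p}<\infty$. The space $B_1$ consists of those $f\in H(\mathbb{D})$ with $\int_{\mathbb{D}}|f''(z)|\,dA(z)<\infty$, with norm $\|f\|_{B_1}=|f(0)|+|f'(0)|+\int_{\mathbb{D}}|f''(z)|\,dA(z)$. Mean Lipschitz space: for $1<s<\infty$, $\Lambda^s_{1/s}$ consists of those $f\in H(\mathbb{D})$ with $\|f\|_{\Lambda^s_{1/s}}=|f(0)|+\sup_{0\le r<1}(1-r)^{1-1/s}M_s(r,f')<\infty$, where $M_s(r,g)=\left(\frac{1}{2\pi}\int_0^{2\pi}|g(re^{i\theta})|^s\,d\theta\right)^{1/s}$. A Banach subspace $X$ of $H(\mathbb{D})$ is a linear subspace of $H(\mathbb{D})$ equipped with a complete norm for which the inclusion into $H(\mathbb{D})$ (with the topology of uniform convergence on compact subsets of $\mathbb{D}$) is continuous. The inclusions $\Lambda^s_{1/s}\subset X\subset\mathcal{B}$ are inclusions of sets; by the closed graph theorem they are then automatically continuous. "Bounded (compact) from $X$ to $B_p$" means that $\mathcal{C}_{\mu,\alpha}$ maps $X$ into $B_p$ and is a bounded (compact) linear operator. *)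

theory Defs
  imports "HOL-Complex_Analysis.Complex_Analysis"
begin

abbreviation unit_disk :: "complex set" where
  "unit_disk \<equiv> ball 0 1"

text \<open>
  HOL functions are total, so an analytic function on the disk is represented by its extension
  by zero. This makes equality in \<open>H_disk\<close> coincide with equality on the disk.
\<close>

definition H_disk :: "(complex \<Rightarrow> complex) set" where
  "H_disk = {f. f holomorphic_on unit_disk \<and> (\<forall>z. z \<notin> unit_disk \<longrightarrow> f z = 0)}"

definition disk_area :: "complex measure" where
  "disk_area = scale_measure (ennreal (1 / pi)) (restrict_space lborel unit_disk)"

definition taylor_coeff :: "(complex \<Rightarrow> complex) \<Rightarrow> nat \<Rightarrow> complex" where
  "taylor_coeff f k = (deriv ^^ k) f 0 / fact k"

definition moment :: "real measure \<Rightarrow> nat \<Rightarrow> real" where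
  "moment \<mu> n = (LINT t|\<mu>. t ^ n)"

definition cesaro :: "real measure \<Rightarrow> real \<Rightarrow> (complex \<Rightarrow> complex) \<Rightarrow> complex \<Rightarrow> complex" where
  "cesaro \<mu> \<alpha> f z =
     (if z \<in> unit_disk
      then \<Sum>n. of_real (moment \<mu> n) *
             (\<Sum>k\<le>n. of_real (Gamma (real (n - k) + \<alpha>) / (Gamma \<alpha> * fact (n - k))) * taylor_coeff f k)
             * z ^ n
      else 0)"

definition bloch :: "(complex \<Rightarrow> complex) set" where
  "bloch = {f \<in> H_disk. bdd_above ((\<lambda>z. (1 - (norm z)\<^sup>2) * norm (deriv f z)) ` unit_disk)}"

definition integral_mean :: "real \<Rightarrow> real \<Rightarrow> (complex \<Rightarrow> complex) \<Rightarrow> real" where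
  "integral_mean s r g =
     (1 / (2 * pi) * integral {0..2 * pi} (\<lambda>\<theta>. norm (g (of_real r * cis \<theta>)) powr s)) powr (1 / s)"

text \<open>The mean Lipschitz space with integrability exponent \<open>s\<close> and smoothness \<open>1 / s\<close>.\<close>

definition mean_lipschitz :: "real \<Rightarrow> (complex \<Rightarrow> complex) set" where
  "mean_lipschitz s = {f \<in> H_disk.
     bdd_above ((\<lambda>r. (1 - r) powr (1 - 1 / s) * integral_mean s r (deriv f)) ` {0..<1})}"

definition besov_integral :: "real \<Rightarrow> (complex \<Rightarrow> complex) \<Rightarrow> ennreal" where
  "besov_integral p f =
     (if p = 1 then \<integral>\<^sup>+z. ennreal (norm (deriv (deriv f) z)) \<partial>disk_area
      else \<integral>\<^sup>+z. ennreal (norm (deriv f z) powr p * (1 - norm z) powr (p - 2)) \<partial>disk_area)"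

definition besov :: "real \<Rightarrow> (complex \<Rightarrow> complex) set" where
  "besov p = {f \<in> H_disk. besov_integral p f < \<infinity>}"

definition besov_norm :: "real \<Rightarrow> (complex \<Rightarrow> complex) \<Rightarrow> real" where
  "besov_norm p f =
     (if p = 1 then norm (f 0) + norm (deriv f 0) + enn2real (besov_integral 1 f)
      else norm (f 0) + enn2real (besov_integral p f) powr (1 / p))"

text \<open>
  The norm \<open>N\<close> is constrained on \<open>X\<close> only. Since the topology of uniform convergence on
  compact sets is metrizable, continuity of the inclusion is stated with sequences.
\<close>

locale banach_subspace =
  fixes X :: "(complex \<Rightarrow> complex) set" and N :: "(complex \<Rightarrow> complex) \<Rightarrow> real"
  assumes subset_H_disk: "X \<subseteq> H_disk"
    and zero_mem: "(\<lambda>z. 0) \<in> X"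
    and add_mem: "\<lbrakk>f \<in> X; g \<in> X\<rbrakk> \<Longrightarrow> (\<lambda>z. f z + g z) \<in> X"
    and scale_mem: "f \<in> X \<Longrightarrow> (\<lambda>z. c * f z) \<in> X"
    and norm_nonneg: "f \<in> X \<Longrightarrow> N f \<ge> 0"
    and norm_eq_0: "f \<in> X \<Longrightarrow> N f = 0 \<longleftrightarrow> f = (\<lambda>z. 0)"
    and norm_scale: "f \<in> X \<Longrightarrow> N (\<lambda>z. c * f z) = cmod c * N f"
    and norm_triangle: "\<lbrakk>f \<in> X; g \<in> X\<rbrakk> \<Longrightarrow> N (\<lambda>z. f z + g z) \<le> N f + N g"
    and complete:
      "\<lbrakk>\<And>n. F n \<in> X; \<forall>e>0. \<exists>M. \<forall>m\<ge>M. \<forall>n\<ge>M. N (\<lambda>z. F m z - F n z) < e\<rbrakk>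
       \<Longrightarrow> \<exists>f\<in>X. (\<lambda>n. N (\<lambda>z. F n z - f z)) \<longlonglongrightarrow> 0"
    and continuous_inclusion:
      "\<lbrakk>\<And>n. F n \<in> X; f \<in> X; (\<lambda>n. N (\<lambda>z. F n z - f z)) \<longlonglongrightarrow> 0; compact K; K \<subseteq> unit_disk\<rbrakk>
       \<Longrightarrow> uniform_limit K F f sequentially"

definition linear_op ::
  "(complex \<Rightarrow> complex) set \<Rightarrow> (complex \<Rightarrow> complex) set
   \<Rightarrow> ((complex \<Rightarrow> complex) \<Rightarrow> complex \<Rightarrow> complex) \<Rightarrow> bool" where
  "linear_op X Y T \<longleftrightarrow>
     (\<forall>f\<in>X. T f \<in> Y) \<and>
     (\<forall>f\<in>X. \<forall>g\<in>X. T (\<lambda>z. f z + g z) = (\<lambda>z. T f z + T g z)) \<and>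
     (\<forall>c. \<forall>f\<in>X. T (\<lambda>z. c * f z) = (\<lambda>z. c * T f z))"

definition bounded_op ::
  "(complex \<Rightarrow> complex) set \<Rightarrow> ((complex \<Rightarrow> complex) \<Rightarrow> real)
   \<Rightarrow> (complex \<Rightarrow> complex) set \<Rightarrow> ((complex \<Rightarrow> complex) \<Rightarrow> real)
   \<Rightarrow> ((complex \<Rightarrow> complex) \<Rightarrow> complex \<Rightarrow> complex) \<Rightarrow> bool" where
  "bounded_op X N Y M T \<longleftrightarrow> linear_op X Y T \<and> (\<exists>C. \<forall>f\<in>X. M (T f) \<le> C * N f)"

definition compact_op ::
  "(complex \<Rightarrow> complex) set \<Rightarrow> ((complex \<Rightarrow> complex) \<Rightarrow> real)
   \<Rightarrow> (complex \<Rightarrow> complex) set \<Rightarrow> ((complex \<Rightarrow> complex) \<Rightarrow> real)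
   \<Rightarrow> ((complex \<Rightarrow> complex) \<Rightarrow> complex \<Rightarrow> complex) \<Rightarrow> bool" where
  "compact_op X N Y M T \<longleftrightarrow> linear_op X Y T \<and>
     (\<forall>F. (\<forall>n. F n \<in> X) \<and> (\<exists>C. \<forall>n. N (F n) \<le> C) \<longrightarrow>
       (\<exists>g\<in>Y. \<exists>\<phi>. strict_mono (\<phi> :: nat \<Rightarrow> nat) \<and>
          (\<lambda>n. M (\<lambda>z. T (F (\<phi> n)) z - g z)) \<longlonglongrightarrow> 0))"

end

theory Submission
  imports Defs
begin

text \<open>
  A Bloch function grows at most like \<open>1 + log (1 / (1 - \<bar>z\<bar>))\<close>, and \<open>log (1 / (1 - z))\<close>, which lies in every
  mean Lipschitz space \<open>\<Lambda>\<^sup>s\<^bsub>1/s\<^esub>\<close>, has this growth along the radius. The question is therefore settled by the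
  growth alone: the single function \<open>log (1 / (1 - z))\<close> gives necessity, the Bloch growth gives sufficiency,
  and the space \<open>X\<close> between the two enters only through its inclusions and its completeness.

  Let \<open>m = 2\<close> if \<open>p = 1\<close> and \<open>m = 1\<close> otherwise. Then \<open>m p > 1\<close>, and both Besov integrals have the form
  \<open>\<integral> \<bar>g\<^sup>(\<^sup>m\<^sup>)\<bar>\<^sup>p (1 - \<bar>z\<bar>) powr (m p - 2) dA\<close> (lemma \<open>besov_integral_eq\<close>). Since moments decrease, the condition
  on \<open>\<mu>\<close> says that the dyadic moments \<open>(k + 1) 2 powr (\<alpha> k) \<mu>\<^sub>n\<close>, \<open>n = 2 ^ k - 1\<close>, are \<open>p\<close>-summable
  (\<open>summable_moment_iff_dyadic\<close>).

  Sufficiency. The image of \<open>f\<close> is \<open>\<integral> F (t z) d\<mu> t\<close> with \<open>F z = f z (1 - z) powr (- \<alpha>)\<close>, and for a Bloch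
  function \<open>f\<close> the derivative of order \<open>m\<close> of \<open>F\<close> at \<open>w\<close> is at most a constant times the sum of
  \<open>(1 - \<bar>w\<bar>) powr (- m) \<bar>1 - w\<bar> powr (- \<alpha>)\<close> and \<open>(1 + log (1 / (1 - \<bar>w\<bar>))) \<bar>1 - w\<bar> powr (- \<alpha> - m)\<close>
  (\<open>norm_deriv_cesaro_integrand_le\<close>). Split the interval into layers on which \<open>1 - t\<close> is about \<open>2 powr (- k)\<close>; their
  mass is at most \<open>e\<close> times the moment of order \<open>2 ^ k - 1\<close>. Split the disk into cells on which \<open>1 - \<bar>z\<bar>\<close> is
  about \<open>2 powr (- i)\<close> and \<open>\<bar>1 - z\<bar>\<close> about \<open>2 powr (- q)\<close>; their area is at most a constant times
  \<open>2 powr (- i - q)\<close>. Summing over \<open>q\<close> leaves dyadic moments multiplied by a kernel that decays geometrically in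
  \<open>\<bar>i - k\<bar>\<close>, which acts boundedly on \<open>\<ell>\<^sup>p\<close>. This produces one integrable function that dominates the Besov
  densities of the images of the whole unit ball of the Bloch space (\<open>cesaro_besov_density_dominated\<close>). As
  \<open>X\<close> embeds boundedly into the Bloch space by the Banach--Steinhaus theorem, the operator is bounded. It is
  compact, since bounded sets in the Bloch space are normal families and dominated convergence upgrades
  locally uniform convergence to convergence in \<open>B\<^sub>p\<close> (\<open>cesaro_bounded_and_compact\<close>).

  Necessity. The image of \<open>log (1 / (1 - z))\<close> has nonnegative Taylor coefficients, so its derivative of order \<open>m\<close>
  at the radius \<open>1 - 2 powr (- j)\<close> is bounded below by \<open>2 ^ (j m)\<close> times a dyadic moment. The area mean
  value inequality on disjoint discs about these radii bounds the \<open>\<ell>\<^sup>p\<close> norm of the dyadic moments by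
  the Besov integral (\<open>besov_radial_summable\<close>, \<open>dyadic_summable_of_log_test\<close>).
\<close>

section \<open>Rotation invariance of area\<close>

text \<open>
  Carries facts about orthogonal maps of \<open>real^2\<close> over to the complex plane.
\<close>

lemma lborel_complex_conv_vec2:
  "lborel = distr (lborel :: (real^2) measure) borel (\<lambda>v. Complex (vec_nth v 1) (vec_nth v 2))"
proof (rule lborel_eqI)
  have meas: "(\<lambda>v::real^2. Complex (vec_nth v 1) (vec_nth v 2)) \<in> borel_measurable borel"
    by (intro borel_measurable_continuous_onI) (auto simp: Complex_eq intro!: continuous_intros)
  show "sets (distr (lborel :: (real^2) measure) borel (\<lambda>v. Complex (vec_nth v 1) (vec_nth v 2))) = sets borel" by simp
  fix l u :: complex
  assume le: "\<And>b. b \<in> Basis \<Longrightarrow> l \<bullet> b \<le> u \<bullet> b"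
  define l' where "l' = (vector [Re l, Im l] :: real^2)"
  define u' where "u' = (vector [Re u, Im u] :: real^2)"
  have vim: "(\<lambda>v::real^2. Complex (vec_nth v 1) (vec_nth v 2)) -` box l u = box l' u'"
    by (auto simp: l'_def u'_def mem_box Basis_complex_def box_def Basis_vec_def inner_axis forall_2 vector_2)
  have le': "Re l \<le> Re u" "Im l \<le> Im u"
    using le[of 1] le[of \<i>] by (auto simp: Basis_complex_def)
  have le2: "\<And>b. b \<in> Basis \<Longrightarrow> l' \<bullet> b \<le> u' \<bullet> b"
    using le' by (auto simp: l'_def u'_def Basis_vec_def inner_axis exhaust_2) (metis (full_types) exhaust_2 vector_2)
  have "emeasure (distr (lborel :: (real^2) measure) borel (\<lambda>v. Complex (vec_nth v 1) (vec_nth v 2))) (box l u)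
     = emeasure lborel (box l' u')"
    using meas by (simp add: emeasure_distr vim)
  also have "\<dots> = ennreal (\<Prod>b\<in>Basis. (u' - l') \<bullet> b)"
    using le2 by (simp add: emeasure_lborel_box_eq inner_diff_left)
  also have "(\<Prod>b\<in>Basis. (u' - l') \<bullet> b) = (\<Prod>b\<in>Basis. (u - l) \<bullet> b)"
  proof -
    have B: "(Basis :: (real^2) set) = {axis 1 1, axis 2 1}"
      by (auto simp: Basis_vec_def) (metis (full_types) exhaust_2)
    have "axis (1::2) (1::real) \<noteq> axis 2 1" by (simp add: axis_eq_axis)
    then show ?thesis
      by (simp add: B Basis_complex_def inner_axis l'_def u'_def vector_2 inner_diff_left)
  qed
  finally show "emeasure (distr (lborel :: (real^2) measure) borel (\<lambda>v. Complex (vec_nth v 1) (vec_nth v 2))) (box l u)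
     = (\<Prod>b\<in>Basis. (u - l) \<bullet> b)" .
qed

definition vec2_rotation :: "real \<Rightarrow> real^2 \<Rightarrow> real^2" where
  "vec2_rotation \<phi> v = vector [cos \<phi> * vec_nth v 1 - sin \<phi> * vec_nth v 2, sin \<phi> * vec_nth v 1 + cos \<phi> * vec_nth v 2]"

lemma orthogonal_vec2_rotation: "orthogonal_transformation (vec2_rotation \<phi>)"
proof -
  have "linear (vec2_rotation \<phi>)"
    unfolding vec2_rotation_def by (rule linearI) (auto simp: vec_eq_iff forall_2 algebra_simps)
  moreover have "norm (vec2_rotation \<phi> v) = norm v" for v
  proof -
    have "(cos \<phi> * vec_nth v 1 - sin \<phi> * vec_nth v 2)^2 + (sin \<phi> * vec_nth v 1 + cos \<phi> * vec_nth v 2)^2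
       = ((cos \<phi>)^2 + (sin \<phi>)^2) * ((vec_nth v 1)^2 + (vec_nth v 2)^2)"
      by algebra
    then show ?thesis by (simp add: vec2_rotation_def norm_vec_def L2_set_def UNIV_2)
  qed
  ultimately show ?thesis unfolding orthogonal_transformation by blast
qed

text \<open>
  A rotation is an orthogonal map, so it preserves the area of boxes, and these determine the measure.
\<close>

lemma lborel_distr_rotation:
  "distr lborel borel ((*) (cis \<phi>)) = (lborel :: complex measure)"
proof (rule lborel_eqI[symmetric])
  show "sets (distr lborel borel ((*) (cis \<phi>))) = sets borel" by simp
  fix l u :: complex
  assume le: "\<And>b. b \<in> Basis \<Longrightarrow> l \<bullet> b \<le> u \<bullet> b"
  define E where "E = (\<lambda>v::real^2. Complex (vec_nth v 1) (vec_nth v 2))"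
  have measE: "E \<in> borel_measurable borel"
    unfolding E_def by (intro borel_measurable_continuous_onI) (auto simp: Complex_eq intro!: continuous_intros)
  have ET: "cis \<phi> * E v = E (vec2_rotation \<phi> v)" for v \<phi>
    by (simp add: E_def vec2_rotation_def complex_eq_iff)
  have TT: "vec2_rotation (-\<phi>) (vec2_rotation \<phi> v) = v" "vec2_rotation \<phi> (vec2_rotation (-\<phi>) v) = v" for v
  proof -
    have 1: "E (vec2_rotation (-\<phi>) (vec2_rotation \<phi> v)) = E v" "E (vec2_rotation \<phi> (vec2_rotation (-\<phi>) v)) = E v"
      by (simp_all flip: ET add: mult.assoc[symmetric] cis_mult)
    have "E a = E b \<Longrightarrow> a = b" for a b :: "real^2"
      by (simp add: E_def vec_eq_iff forall_2)
    with 1 show "vec2_rotation (-\<phi>) (vec2_rotation \<phi> v) = v" "vec2_rotation \<phi> (vec2_rotation (-\<phi>) v) = v" by blast+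
  qed
  have Timg: "E -` ((*) (cis \<phi>) -` A) = vec2_rotation (-\<phi>) ` (E -` A)" for A
  proof (intro equalityI subsetI)
    fix v assume "v \<in> E -` ((*) (cis \<phi>) -` A)"
    then have "vec2_rotation \<phi> v \<in> E -` A" by (simp add: ET)
    then show "v \<in> vec2_rotation (-\<phi>) ` (E -` A)" using TT(1)[of v] by (metis image_eqI)
  next
    fix v assume "v \<in> vec2_rotation (-\<phi>) ` (E -` A)"
    then show "v \<in> E -` ((*) (cis \<phi>) -` A)" using TT(2) by (auto simp: ET)
  qed
  have rot: "(*) (cis \<phi>) \<in> borel_measurable borel"
    by (intro borel_measurable_continuous_onI continuous_intros)
  have bm: "E -` box l u \<in> sets borel"
    using measurable_sets_borel[OF measE] by (simp add: borel_open)
  have em: "emeasure lborel (E -` A) = emeasure lborel A" if "A \<in> sets borel" for A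
  proof -
    have "emeasure lborel A = emeasure (distr lborel borel E) A"
      using lborel_complex_conv_vec2 by (simp add: E_def)
    then show ?thesis using measE that by (simp add: emeasure_distr)
  qed
  have fin: "emeasure lborel (E -` box l u) = emeasure lborel (box l u)"
    by (simp add: em)
  have lm: "E -` box l u \<in> lmeasurable"
    unfolding fmeasurable_def using bm fin by (simp add: emeasure_lborel_box_eq)
  have "emeasure (distr lborel borel ((*) (cis \<phi>))) (box l u) = emeasure lborel ((*) (cis \<phi>) -` box l u)"
    using rot by (simp add: emeasure_distr)
  also have "\<dots> = emeasure lborel (E -` ((*) (cis \<phi>) -` box l u))"
    using measurable_sets_borel[OF rot] by (simp add: em borel_open)
  also have "E -` ((*) (cis \<phi>) -` box l u) = vec2_rotation (-\<phi>) ` (E -` box l u)"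
    by (fact Timg)
  also have "emeasure lborel (vec2_rotation (-\<phi>) ` (E -` box l u)) = emeasure lebesgue (vec2_rotation (-\<phi>) ` (E -` box l u))"
  proof -
    have "vec2_rotation (-\<phi>) ` (E -` box l u) = E -` ((*) (cis \<phi>) -` box l u)"
      by (simp add: Timg)
    also have "\<dots> \<in> sets borel"
      using measurable_sets_borel[OF measE] measurable_sets_borel[OF rot] by (simp add: borel_open)
    finally show ?thesis by simp
  qed
  also have "\<dots> = emeasure lebesgue (E -` box l u)"
  proof -
    note orth = orthogonal_vec2_rotation[of "-\<phi>"]
    show ?thesis
      using emeasure_eq_measure2[OF lm] emeasure_eq_measure2[OF measurable_orthogonal_image[OF orth lm]]
        measure_orthogonal_image[OF orth lm] by metis
  qed
  also have "\<dots> = emeasure lborel (box l u)"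
    using bm fin by simp
  also have "\<dots> = (\<Prod>b\<in>Basis. (u - l) \<bullet> b)"
    using le by (simp add: emeasure_lborel_box_eq inner_diff_left)
  finally show "emeasure (distr lborel borel ((*) (cis \<phi>))) (box l u) = (\<Prod>b\<in>Basis. (u - l) \<bullet> b)" .
qed

lemma emeasure_lborel_rotation:
  assumes "S \<in> sets (borel :: complex measure)"
  shows "{z. cis \<phi> * z \<in> S} \<in> sets borel" "emeasure lborel {z. cis \<phi> * z \<in> S} = emeasure lborel S"
proof -
  have rot: "(*) (cis \<phi>) \<in> borel_measurable borel"
    by (intro borel_measurable_continuous_onI continuous_intros)
  have eq: "{z. cis \<phi> * z \<in> S} = (*) (cis \<phi>) -` S" by auto
  show "{z. cis \<phi> * z \<in> S} \<in> sets borel"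
    using measurable_sets_borel[OF rot assms] by (simp add: eq)
  have "emeasure lborel S = emeasure (distr lborel borel ((*) (cis \<phi>))) S"
    by (simp add: lborel_distr_rotation)
  also have "\<dots> = emeasure lborel ((*) (cis \<phi>) -` S)"
    using rot assms by (simp add: emeasure_distr)
  finally show "emeasure lborel {z. cis \<phi> * z \<in> S} = emeasure lborel S"
    by (simp add: eq)
qed

lemma sin_ge_half:
  fixes x :: real
  assumes "0 \<le> x" "x \<le> 1"
  shows "x / 2 \<le> sin x"
proof -
  have "sin 0 - 0 / 2 \<le> sin x - x / 2"
  proof (rule DERIV_nonneg_imp_nondecreasing[OF assms(1)])
    fix y :: real assume y: "0 \<le> y" "y \<le> x"
    have "cos (pi / 3) \<le> cos y"
      using y assms pi_gt3 by (intro cos_monotone_0_pi_le) auto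
    then show "\<exists>d. ((\<lambda>x. sin x - x / 2) has_real_derivative d) (at y) \<and> 0 \<le> d"
      by (intro exI[of _ "cos y - 1 / 2"]) (auto intro!: derivative_eq_intros simp: cos_60)
  qed
  then show ?thesis by simp
qed

text \<open>
  The copies of \<open>S\<close> rotated by the multiples of the angle \<open>5 \<rho>\<close> up to total angle \<open>1\<close> are disjoint, because the
  centres of two of them are more than \<open>2 \<rho>\<close> apart. There are at least \<open>1 / (10 \<rho>)\<close> copies, they have equal
  area, and all lie in an annulus of area at most \<open>2 \<pi> \<delta>\<close>. For \<open>\<rho> > 1 / 5\<close> the area of the annulus itself is
  small enough.
\<close>

lemma cell_area_le:
  assumes "0 < \<delta>" "\<delta> \<le> 1" "0 < \<rho>"
  defines "S \<equiv> {z::complex. cmod z < 1 \<and> 1 - cmod z \<le> \<delta> \<and> cmod (1 - z) \<le> \<rho>}"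
  shows "S \<in> sets borel" "emeasure lborel S \<le> ennreal (20 * pi * \<delta> * \<rho>)"
proof -
  define A where "A = {z::complex. cmod z < 1 \<and> 1 - cmod z \<le> \<delta>}"
  have Aeq: "A = ball 0 1 - ball 0 (1 - \<delta>)" by (auto simp: A_def)
  have Sm: "S \<in> sets borel" unfolding S_def by measurable
  show "S \<in> sets borel" by fact
  have Am: "A \<in> sets borel" by (simp add: Aeq)
  have ball: "emeasure lborel (ball (0::complex) r) = ennreal (pi * r\<^sup>2)" if "0 \<le> r" for r
    using that by (simp add: emeasure_ball unit_ball_vol_2)
  have "emeasure lborel A = ennreal (pi * 1\<^sup>2) - ennreal (pi * (1 - \<delta>)\<^sup>2)"
    unfolding Aeq using assms by (subst emeasure_Diff) (auto simp: ball)
  also have "\<dots> = ennreal (pi - pi * (1 - \<delta>)\<^sup>2)"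
    by (simp add: ennreal_minus)
  also have "\<dots> \<le> ennreal (2 * pi * \<delta>)"
    using assms by (intro ennreal_leI) (simp add: power2_eq_square algebra_simps)
  finally have Aarea: "emeasure lborel A \<le> ennreal (2 * pi * \<delta>)" .
  have SA: "S \<subseteq> A" by (auto simp: S_def A_def)
  show "emeasure lborel S \<le> ennreal (20 * pi * \<delta> * \<rho>)"
  proof (cases "\<rho> \<le> 1/5")
    case False
    have "emeasure lborel S \<le> emeasure lborel A"
      using SA Am by (intro emeasure_mono) auto
    also have "\<dots> \<le> ennreal (2 * pi * \<delta>)" by fact
    also have "\<dots> \<le> ennreal (20 * pi * \<delta> * \<rho>)"
      using False assms by (intro ennreal_leI) auto
    finally show ?thesis .
  next
    case True
    define n where "n = nat \<lfloor>1 / (5 * \<rho>)\<rfloor>"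
    have n1: "real n * (5 * \<rho>) \<le> 1"
    proof -
      have "real n \<le> 1 / (5 * \<rho>)" unfolding n_def using assms by simp
      then show ?thesis using assms by (simp add: field_simps)
    qed
    have n2: "1 \<le> real n * (10 * \<rho>)"
    proof -
      have "1 \<le> 1 / (5 * \<rho>)" using True assms by (simp add: field_simps)
      then have "1 \<le> \<lfloor>1 / (5 * \<rho>)\<rfloor>" by (simp add: le_floor_iff)
      then have "1 \<le> n" unfolding n_def by linarith
      moreover have "1 / (5 * \<rho>) \<le> real n + 1" unfolding n_def using assms by linarith
      ultimately have "1 / (5 * \<rho>) \<le> 2 * real n" by simp
      then show ?thesis using assms by (simp add: field_simps)
    qed
    define R where "R j = {z. cis (- (real j * (5 * \<rho>))) * z \<in> S}" for j :: nat
    have Rm: "R j \<in> sets lborel" "emeasure lborel (R j) = emeasure lborel S" for j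
      unfolding R_def using emeasure_lborel_rotation[OF Sm] by simp_all
    have far: False if z: "z \<in> R i" "z \<in> R j" and ij: "i < j" "j < n" for z i j
    proof -
      have near: "cmod (cis (real k * (5 * \<rho>)) - z) \<le> \<rho>" if "z \<in> R k" for k
      proof -
        have "cis (real k * (5 * \<rho>)) - z = cis (real k * (5 * \<rho>)) * (1 - cis (- (real k * (5 * \<rho>))) * z)"
          by (simp add: algebra_simps cis_mult flip: mult.assoc)
        then have "cmod (cis (real k * (5 * \<rho>)) - z) = cmod (1 - cis (- (real k * (5 * \<rho>))) * z)"
          by (simp add: norm_mult)
        with that show ?thesis by (simp add: R_def S_def)
      qed
      define \<phi> where "\<phi> = real (j - i) * (5 * \<rho>)"
      have "real (j - i) \<le> real n" "1 \<le> real (j - i)" using ij by auto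
      then have "\<phi> \<le> real n * (5 * \<rho>)" "5 * \<rho> \<le> \<phi>"
        unfolding \<phi>_def using assms by (auto intro: mult_right_mono)
      with n1 have \<phi>: "\<phi> \<le> 1" "5 * \<rho> \<le> \<phi>" "0 \<le> \<phi>" using assms by auto
      have "cis (real j * (5 * \<rho>)) - cis (real i * (5 * \<rho>)) = cis (real i * (5 * \<rho>)) * (cis \<phi> - 1)"
        using ij by (simp add: \<phi>_def algebra_simps cis_mult of_nat_diff)
      then have "cmod (cis \<phi> - 1) = cmod (cis (real j * (5 * \<rho>)) - cis (real i * (5 * \<rho>)))"
        by (simp add: norm_mult)
      also have "\<dots> \<le> cmod (cis (real j * (5 * \<rho>)) - z) + cmod (cis (real i * (5 * \<rho>)) - z)"
        using norm_triangle_ineq4[of "cis (real j * (5 * \<rho>)) - z" "cis (real i * (5 * \<rho>)) - z"] by simp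
      also have "\<dots> \<le> 2 * \<rho>" using near[OF z(1)] near[OF z(2)] by simp
      finally have "cmod (cis \<phi> - 1) \<le> 2 * \<rho>" .
      moreover have "sin \<phi> \<le> cmod (cis \<phi> - 1)"
        using abs_Im_le_cmod[of "cis \<phi> - 1"] by simp
      ultimately show False using sin_ge_half[of \<phi>] \<phi> assms by simp
    qed
    have disj: "disjoint_family_on R {..<n}"
      unfolding disjoint_family_on_def
      by (metis (no_types, lifting) disjoint_iff far lessThan_iff linorder_neqE_nat)
    have "of_nat n * emeasure lborel S = (\<Sum>j<n. emeasure lborel (R j))" by (simp add: Rm)
    also have "\<dots> = emeasure lborel (\<Union>j<n. R j)"
      using Rm disj by (intro sum_emeasure) auto
    also have "\<dots> \<le> emeasure lborel A"
      using Am by (intro emeasure_mono) (auto simp: R_def S_def A_def norm_mult)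
    also have "\<dots> \<le> ennreal (2 * pi * \<delta>)" by fact
    finally have le: "of_nat n * emeasure lborel S \<le> ennreal (2 * pi * \<delta>)" .
    have "emeasure lborel S \<le> ennreal (real n * (10 * \<rho>)) * emeasure lborel S"
      using n2 mult_right_mono[of 1 "ennreal (real n * (10 * \<rho>))" "emeasure lborel S"] by simp
    also have "\<dots> = ennreal (10 * \<rho>) * (of_nat n * emeasure lborel S)"
      using assms by (simp add: ennreal_mult ennreal_of_nat_eq_real_of_nat mult_ac)
    also have "\<dots> \<le> ennreal (10 * \<rho>) * ennreal (2 * pi * \<delta>)"
      by (intro mult_left_mono le) simp
    also have "\<dots> = ennreal (20 * pi * \<delta> * \<rho>)"
      using assms by (simp add: mult_ac flip: ennreal_mult)
    finally show ?thesis .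
  qed
qed

section \<open>The area mean value inequality\<close>

text \<open>
  Rotation by the angle \<open>\<pi> / k\<close> changes the sign of \<open>w ^ k\<close> and preserves the ball.
\<close>

lemma integral_monomial_ball:
  assumes "k > 0"
  shows "(\<integral>w. indicator (ball 0 \<rho>) w *\<^sub>R (w::complex) ^ k \<partial>lborel) = 0"
proof -
  define I where "I = (\<integral>w. indicator (ball 0 \<rho>) w *\<^sub>R (w::complex) ^ k \<partial>lborel)"
  define \<phi> where "\<phi> = pi / real k"
  have meas: "(\<lambda>w::complex. indicator (ball 0 \<rho>) w *\<^sub>R w ^ k) \<in> borel_measurable borel"
    by (intro borel_measurable_continuous_on_indicator) (auto intro!: continuous_intros)
  have rot: "(*) (cis \<phi>) \<in> borel_measurable borel"
    by (intro borel_measurable_continuous_onI continuous_intros)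
  have cis: "cis \<phi> ^ k = -1"
    by (subst Complex.DeMoivre) (use assms in \<open>simp add: \<phi>_def\<close>)
  have "I = (\<integral>w. indicator (ball 0 \<rho>) w *\<^sub>R w ^ k \<partial>distr lborel borel ((*) (cis \<phi>)))"
    by (simp add: I_def lborel_distr_rotation)
  also have "\<dots> = (\<integral>w. indicator (ball 0 \<rho>) (cis \<phi> * w) *\<^sub>R (cis \<phi> * w) ^ k \<partial>lborel)"
    using rot meas by (subst integral_distr) auto
  also have "\<dots> = (\<integral>w. - (indicator (ball 0 \<rho>) w *\<^sub>R w ^ k) \<partial>lborel)"
    using assms by (intro Bochner_Integration.integral_cong)
       (auto simp: indicator_def norm_mult power_mult_distrib cis)
  also have "\<dots> = - I" by (simp add: I_def)
  finally show ?thesis by (simp add: I_def)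
qed

text \<open>
  Integrating the Taylor series about \<open>a\<close> over the ball leaves only the constant term.
\<close>

lemma norm_center_le_integral_ball:
  fixes h :: "complex \<Rightarrow> complex"
  assumes h: "h holomorphic_on ball a R" and \<rho>: "0 < \<rho>" "\<rho> < R"
  shows "ennreal (cmod (h a)) * emeasure lborel (ball a \<rho>)
     \<le> (\<integral>\<^sup>+z. indicator (ball a \<rho>) z * ennreal (cmod (h z)) \<partial>lborel)"
proof -
  define c where "c k = (deriv ^^ k) h a / fact k" for k
  have ps: "(\<lambda>k. c k * w ^ k) sums h (a + w)" if "cmod w < R" for w
    using holomorphic_power_series[OF h, of "a + w"] that by (simp add: c_def dist_norm)
  define R' where "R' = (\<rho> + R) / 2"
  have "summable (\<lambda>k. c k * (of_real R') ^ k)"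
  proof -
    have "cmod (of_real R') < R" using \<rho> by (simp only: norm_of_real) (simp add: R'_def)
    then show ?thesis using ps[of "of_real R'"] by (simp add: sums_iff)
  qed
  then have sn: "summable (\<lambda>k. norm (c k * (of_real \<rho>) ^ k))"
  proof (rule powser_insidea)
    have "\<bar>\<rho>\<bar> < \<bar>R'\<bar>" using \<rho> by (simp add: R'_def)
    then show "norm (of_real \<rho> :: complex) < norm (of_real R' :: complex)" by simp
  qed
  define f where "f k w = indicator (ball 0 \<rho>) w *\<^sub>R (c k * w ^ k)" for k w
  have meas: "f k \<in> borel_measurable lborel" for k
  proof -
    have "f k \<in> borel_measurable borel"
      unfolding f_def by (intro borel_measurable_continuous_on_indicator) (auto intro!: continuous_intros)
    then show ?thesis by simp
  qed
  have fb: "norm (f k w) \<le> indicator (ball 0 \<rho>) w * norm (c k * of_real \<rho> ^ k)" for k w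
    using \<rho> by (auto simp: f_def indicator_def norm_mult norm_power intro!: mult_left_mono power_mono)
  have fin: "emeasure lborel (ball (0::complex) \<rho>) < \<infinity>" by (rule emeasure_lborel_ball_finite)
  have ib: "integrable lborel (\<lambda>w. indicator (ball (0::complex) \<rho>) w * norm (c k * of_real \<rho> ^ k))" for k
    using fin by (intro integrable_mult_left) (auto simp: integrable_indicator_iff)
  have int: "integrable lborel (f k)" for k
    by (rule Bochner_Integration.integrable_bound[OF ib[of k] meas])
       (use fb[of k] in \<open>auto intro!: order_trans[OF fb[of k]]\<close>)
  have sumf: "summable (\<lambda>k. norm (f k w))" for w
  proof (rule summable_comparison_test'[OF sn, of 0])
    fix k
    have "indicator (ball 0 \<rho>) w * norm (c k * of_real \<rho> ^ k) \<le> 1 * norm (c k * of_real \<rho> ^ k)"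
      by (intro mult_right_mono) (auto simp: indicator_def)
    then show "norm (norm (f k w)) \<le> norm (c k * of_real \<rho> ^ k)"
      using fb[of k w] by simp
  qed
  have sumi: "summable (\<lambda>k. \<integral>w. norm (f k w) \<partial>lborel)"
  proof (rule summable_comparison_test'[OF summable_mult2[OF sn, of "measure lborel (ball (0::complex) \<rho>)"], of 0])
    fix k
    have "(\<integral>w. norm (f k w) \<partial>lborel) \<le> (\<integral>w. indicator (ball (0::complex) \<rho>) w * norm (c k * of_real \<rho> ^ k) \<partial>lborel)"
    proof (rule integral_mono_AE)
      show "integrable lborel (\<lambda>w. norm (f k w))" using int by (rule integrable_norm)
    qed (use fb ib in auto)
    also have "\<dots> = norm (c k * of_real \<rho> ^ k) * measure lborel (ball (0::complex) \<rho>)"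
      by simp
    finally show "norm (\<integral>w. norm (f k w) \<partial>lborel) \<le> norm (c k * of_real \<rho> ^ k) * measure lborel (ball (0::complex) \<rho>)"
      by (simp add: integral_nonneg_AE)
  qed
  have lim: "(\<Sum>k. f k w) = indicator (ball 0 \<rho>) w *\<^sub>R h (a + w)" for w
  proof (cases "w \<in> ball 0 \<rho>")
    case True
    then show ?thesis using ps[of w] \<rho> by (simp add: f_def sums_iff)
  qed (simp add: f_def)
  have s1: "(\<lambda>k. integral\<^sup>L lborel (f k)) sums (\<integral>w. indicator (ball 0 \<rho>) w *\<^sub>R h (a + w) \<partial>lborel)"
    using sums_integral[OF int _ sumi] sumf by (simp add: lim)
  have z: "integral\<^sup>L lborel (f k) = (if k = 0 then c 0 * measure lborel (ball (0::complex) \<rho>) else 0)" for k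
  proof (cases "k = 0")
    case False
    have "integral\<^sup>L lborel (f k) = (\<integral>w. c k * (indicator (ball 0 \<rho>) w *\<^sub>R w ^ k) \<partial>lborel)"
      unfolding f_def by (intro Bochner_Integration.integral_cong) auto
    also have "\<dots> = 0" using integral_monomial_ball[of k \<rho>] False
      by (simp only: integral_mult_right_zero) simp
    finally show ?thesis using False by simp
  next
    case True
    have "f 0 = (\<lambda>w. indicator (ball (0::complex) \<rho>) w *\<^sub>R c 0)"
      by (simp add: f_def fun_eq_iff)
    then have "integral\<^sup>L lborel (f 0) = (\<integral>w. indicator (ball (0::complex) \<rho>) w *\<^sub>R c 0 \<partial>lborel)"
      by (rule arg_cong)
    also have "\<dots> = measure lborel (ball (0::complex) \<rho>) *\<^sub>R c 0"
      using fin by (subst integral_scaleR_left) (auto simp: integrable_indicator_iff)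
    finally show ?thesis using True by (simp add: scaleR_conv_of_real)
  qed
  have "(\<lambda>k. integral\<^sup>L lborel (f k)) sums (c 0 * measure lborel (ball (0::complex) \<rho>))"
    unfolding z using sums_single[of 0 "\<lambda>_. c 0 * measure lborel (ball (0::complex) \<rho>)"] by (simp add: if_distrib cong: if_cong)
  with s1 have eq: "(\<integral>w. indicator (ball 0 \<rho>) w *\<^sub>R h (a + w) \<partial>lborel) = h a * measure lborel (ball (0::complex) \<rho>)"
    by (auto dest: sums_unique2 simp: c_def)
  have intH: "integrable lborel (\<lambda>w. indicator (ball 0 \<rho>) w *\<^sub>R h (a + w))"
    using integrable_suminf[OF int _ sumi] sumf by (simp add: lim)
  have mH: "(\<lambda>z. indicator (ball a \<rho>) z *\<^sub>R h z) \<in> borel_measurable borel"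
    using \<rho> by (intro borel_measurable_continuous_on_indicator)
       (auto intro!: holomorphic_on_imp_continuous_on holomorphic_on_subset[OF h])
  then have mH': "(\<lambda>z. ennreal (norm (indicator (ball a \<rho>) z *\<^sub>R h z))) \<in> borel_measurable borel" by measurable
  have ie: "indicator (ball 0 \<rho>) w = (indicator (ball a \<rho>) (a + w) :: real)" for w
    by (auto simp: indicator_def dist_norm)
  have "ennreal (cmod (h a)) * emeasure lborel (ball a \<rho>)
      = ennreal (norm (\<integral>w. indicator (ball 0 \<rho>) w *\<^sub>R h (a + w) \<partial>lborel))"
  proof -
    have "emeasure lborel (ball a \<rho>) = emeasure lborel (ball (0::complex) \<rho>)"
      using \<rho> by (simp add: emeasure_ball)
    also have "\<dots> = ennreal (measure lborel (ball (0::complex) \<rho>))"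
      using fin by (intro emeasure_eq_ennreal_measure) auto
    finally show ?thesis by (simp add: eq norm_mult ennreal_mult)
  qed
  also have "\<dots> \<le> (\<integral>\<^sup>+w. ennreal (norm (indicator (ball 0 \<rho>) w *\<^sub>R h (a + w))) \<partial>lborel)"
    by (rule integral_norm_bound_ennreal[OF intH])
  also have "\<dots> = (\<integral>\<^sup>+z. ennreal (norm (indicator (ball a \<rho>) z *\<^sub>R h z)) \<partial>distr lborel borel ((+) a))"
    using mH' by (subst nn_integral_distr) (auto simp: ie)
  also have "\<dots> = (\<integral>\<^sup>+z. indicator (ball a \<rho>) z * ennreal (cmod (h z)) \<partial>lborel)"
    by (auto simp: lborel_distr_plus indicator_def intro!: nn_integral_cong)
  finally show ?thesis .
qed

lemma borel_measurable_holomorphic_powr: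
  fixes h :: "complex \<Rightarrow> complex"
  assumes h: "h holomorphic_on ball a R" and "\<rho> < R"
  shows "(\<lambda>z. indicator (ball a \<rho>) z * ennreal (cmod (h z) powr p)) \<in> borel_measurable lborel"
proof -
  have [measurable]: "ball a \<rho> \<in> sets borel" by simp
  have [measurable]: "(\<lambda>z. indicator (ball a \<rho>) z *\<^sub>R h z) \<in> borel_measurable borel"
    using assms by (intro borel_measurable_continuous_on_indicator)
       (auto intro!: holomorphic_on_imp_continuous_on holomorphic_on_subset[OF h])
  have "(\<lambda>z. indicator (ball a \<rho>) z * ennreal (norm (indicator (ball a \<rho>) z *\<^sub>R h z) powr p)) \<in> borel_measurable borel"
    by measurable
  also have "(\<lambda>z. indicator (ball a \<rho>) z * ennreal (norm (indicator (ball a \<rho>) z *\<^sub>R h z) powr p))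
     = (\<lambda>z. indicator (ball a \<rho>) z * ennreal (cmod (h z) powr p))"
    by (auto simp: indicator_def)
  finally show ?thesis by simp
qed

text \<open>
  With \<open>H\<close> half of the value at the centre, \<open>x \<le> H + H powr (1 - p) * x powr p\<close> for all \<open>x \<ge> 0\<close>: the last term
  alone suffices when \<open>x > H\<close>. Integrating this at \<open>x = \<bar>h\<bar>\<close> turns the mean value inequality for \<open>\<bar>h\<bar>\<close> into one for
  \<open>\<bar>h\<bar> powr p\<close>.
\<close>

lemma powr_norm_center_le_integral_ball:
  fixes h :: "complex \<Rightarrow> complex"
  assumes h: "h holomorphic_on ball a R" and \<rho>: "0 < \<rho>" "\<rho> < R" and p: "1 \<le> p"
  shows "ennreal ((cmod (h a) / 2) powr p) * emeasure lborel (ball a \<rho>)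
     \<le> (\<integral>\<^sup>+z. indicator (ball a \<rho>) z * ennreal (cmod (h z) powr p) \<partial>lborel)"
proof (cases "h a = 0")
  case False
  let ?J = "\<lambda>z. indicator (ball a \<rho>) z * ennreal (cmod (h z) powr p)"
  define H where "H = cmod (h a) / 2"
  define A where "A = emeasure lborel (ball a \<rho>)"
  define J where "J = (\<integral>\<^sup>+z. ?J z \<partial>lborel)"
  have H: "H > 0" using False by (simp add: H_def)
  have Afin: "A < \<infinity>" unfolding A_def by (rule emeasure_lborel_ball_finite)
  have pt: "x \<le> H + H powr (1 - p) * x powr p" if "0 \<le> x" for x
  proof (cases "x \<le> H")
    case True
    then show ?thesis using H that by (smt (verit) mult_nonneg_nonneg powr_ge_zero)
  next
    case False
    then have "x powr (1 - p) \<le> H powr (1 - p)" using H p by (intro powr_mono2') auto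
    then have "x powr (1 - p) * x powr p \<le> H powr (1 - p) * x powr p" by (intro mult_right_mono) auto
    moreover have "x powr (1 - p) * x powr p = x" using False H by (simp flip: powr_add)
    ultimately show ?thesis using H by linarith
  qed
  have [measurable]: "ball a \<rho> \<in> sets borel" by simp
  note mJ = borel_measurable_holomorphic_powr[OF h \<rho>(2), of p]
  have "ennreal H * A + ennreal H * A = ennreal (cmod (h a)) * A"
    using H by (simp add: H_def flip: distrib_right ennreal_plus)
  also have "\<dots> \<le> (\<integral>\<^sup>+z. indicator (ball a \<rho>) z * ennreal (cmod (h z)) \<partial>lborel)"
    unfolding A_def by (rule norm_center_le_integral_ball[OF h \<rho>])
  also have "\<dots> \<le> (\<integral>\<^sup>+z. ennreal H * indicator (ball a \<rho>) z + ennreal (H powr (1 - p)) * ?J z \<partial>lborel)"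
  proof (rule nn_integral_mono)
    fix z
    have "ennreal (cmod (h z)) \<le> ennreal H + ennreal (H powr (1 - p)) * ennreal (cmod (h z) powr p)"
      using pt[of "cmod (h z)"] H by (simp flip: ennreal_mult ennreal_plus)
    then show "indicator (ball a \<rho>) z * ennreal (cmod (h z)) \<le> ennreal H * indicator (ball a \<rho>) z + ennreal (H powr (1 - p)) * ?J z"
      by (auto simp: indicator_def)
  qed
  also have "\<dots> = ennreal H * A + ennreal (H powr (1 - p)) * J"
    using mJ by (subst nn_integral_add) (auto simp: nn_integral_cmult A_def J_def)
  finally have "ennreal H * A \<le> ennreal (H powr (1 - p)) * J"
    using Afin by (subst (asm) ennreal_add_left_cancel_le) (auto simp: ennreal_mult_eq_top_iff)
  then have "ennreal (H powr (p - 1)) * (ennreal H * A) \<le> ennreal (H powr (p - 1)) * (ennreal (H powr (1 - p)) * J)"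
    by (intro mult_left_mono) auto
  also have "\<dots> = ennreal (H powr (p - 1) * H powr (1 - p)) * J" by (simp add: ennreal_mult mult.assoc)
  also have "H powr (p - 1) * H powr (1 - p) = 1" using H by (simp flip: powr_add)
  also have "ennreal (H powr (p - 1)) * (ennreal H * A) = ennreal (H powr (p - 1) * H powr 1) * A"
    using H by (simp add: ennreal_mult mult.assoc)
  also have "H powr (p - 1) * H powr 1 = H powr p" by (subst powr_add[symmetric]) simp
  finally show ?thesis by (simp add: H_def A_def J_def)
qed simp

section \<open>The operator as an integral over dilations\<close>

lemma powser_deriv_sums:
  fixes c :: "nat \<Rightarrow> complex"
  assumes G: "\<And>z. cmod z < 1 \<Longrightarrow> (\<lambda>n. c n * z ^ n) sums G z" and z: "cmod z < 1"
  shows "(G has_field_derivative (\<Sum>n. diffs c n * z ^ n)) (at z)"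
    and "(\<lambda>n. diffs c n * z ^ n) sums deriv G z"
proof -
  have sm: "summable (\<lambda>n. c n * w ^ n)" if "cmod w < 1" for w
    using G[OF that] by (simp add: sums_iff)
  have "((\<lambda>z. \<Sum>n. c n * z ^ n) has_field_derivative (\<Sum>n. diffs c n * z ^ n)) (at z)"
    using sm z by (rule termdiffs_strong')
  then show der: "(G has_field_derivative (\<Sum>n. diffs c n * z ^ n)) (at z)"
  proof (rule has_field_derivative_transform_within_open[of _ _ _ unit_disk])
    show "(\<Sum>n. c n * x ^ n) = G x" if "x \<in> unit_disk" for x
      using G[of x] that by (simp add: sums_iff)
  qed (use z in auto)
  have "summable (\<lambda>n. diffs c n * z ^ n)"
    using z sm by (rule termdiff_converges)
  then show "(\<lambda>n. diffs c n * z ^ n) sums deriv G z"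
    using DERIV_imp_deriv[OF der] by (simp add: summable_sums)
qed

lemma powser_holomorphic:
  fixes c :: "nat \<Rightarrow> complex"
  assumes "\<And>z. cmod z < 1 \<Longrightarrow> (\<lambda>n. c n * z ^ n) sums G z"
  shows "G holomorphic_on unit_disk"
proof (subst holomorphic_on_open)
  show "\<forall>x\<in>unit_disk. \<exists>f'. (G has_field_derivative f') (at x)"
  proof
    fix x :: complex assume "x \<in> unit_disk"
    then show "\<exists>f'. (G has_field_derivative f') (at x)"
      using powser_deriv_sums(1)[OF assms, of x] by auto
  qed
qed simp

lemma powser_higher_deriv_sums:
  fixes c :: "nat \<Rightarrow> complex"
  assumes "\<And>z. cmod z < 1 \<Longrightarrow> (\<lambda>n. c n * z ^ n) sums G z" and "cmod z < 1"
  shows "(\<lambda>n. (diffs ^^ m) c n * z ^ n) sums (deriv ^^ m) G z"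
  using assms(2)
proof (induction m arbitrary: z)
  case (Suc m)
  then show ?case
    using powser_deriv_sums(2)[of "(diffs ^^ m) c" "(deriv ^^ m) G" z] by simp
qed (use assms in auto)

text \<open>
  On the level of power series, \<open>m\<close> derivatives replace the moment of order \<open>n\<close> by the one of order
  \<open>n + m\<close>, that is, they produce the factor \<open>t ^ m\<close> under the integral sign.
\<close>

lemma diffs_funpow_shift:
  fixes d :: "nat \<Rightarrow> complex"
  shows "(diffs ^^ m) (\<lambda>n. M n * d n) n = M (n + m) * (diffs ^^ m) d n"
  by (induction m arbitrary: n) (auto simp: diffs_def mult_ac)

locale unit_interval_measure = finite_measure \<mu> for \<mu> :: "real measure" +
  assumes sets_eq: "sets \<mu> = sets (restrict_space borel {0..<1})"
begin

lemma space_eq: "space \<mu> = {0..<1}"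
  using sets_eq_imp_space_eq[OF sets_eq] by (simp add: space_restrict_space)

lemma scaled_in_disk:
  assumes "t \<in> space \<mu>" "cmod z < 1"
  shows "cmod (of_real t * z) < 1"
proof -
  have "\<bar>t\<bar> * cmod z \<le> 1 * cmod z"
    using assms by (intro mult_right_mono) (auto simp: space_eq)
  with assms(2) show ?thesis by (simp add: norm_mult)
qed

lemma borel_measurable_of_borel:
  fixes f :: "real \<Rightarrow> 'b::topological_space"
  assumes "f \<in> borel_measurable borel"
  shows "f \<in> borel_measurable \<mu>"
  using measurable_restrict_space1[OF assms, of "{0..<1}"] sets_eq measurable_cong_sets by blast

lemma moment_integrable: "integrable \<mu> (\<lambda>t. t ^ n)"
  by (rule integrable_const_bound[where B = 1])
     (auto simp: space_eq power_le_one abs_mult power_abs intro!: borel_measurable_of_borel)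

lemma moment_nonneg: "0 \<le> moment \<mu> n"
  unfolding moment_def by (rule integral_nonneg_AE) (auto simp: space_eq)

lemma moment_antimono: "m \<le> n \<Longrightarrow> moment \<mu> n \<le> moment \<mu> m"
  unfolding moment_def
  by (rule integral_mono[OF moment_integrable moment_integrable]) (auto simp: space_eq power_decreasing)

text \<open>
  Termwise integration is allowed because the series converges absolutely at \<open>z\<close> and \<open>t < 1\<close>.
\<close>

lemma powser_moment_integral:
  fixes e :: "nat \<Rightarrow> complex"
  assumes E: "\<And>w. cmod w < 1 \<Longrightarrow> (\<lambda>n. e n * w ^ n) sums E w" and z: "cmod z < 1"
  shows "(\<lambda>n. of_real (moment \<mu> (n + m)) * e n * z ^ n) sums (\<integral>t. of_real (t ^ m) * E (of_real t * z) \<partial>\<mu>)"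
    and "integrable \<mu> (\<lambda>t. of_real (t ^ m) * E (of_real t * z))"
proof -
  define f where "f n t = of_real (t ^ (n + m)) * (e n * z ^ n)" for n and t :: real
  have meas: "f n \<in> borel_measurable \<mu>" for n
    unfolding f_def
    by (intro borel_measurable_of_borel borel_measurable_continuous_onI continuous_intros)
  have fb: "norm (f n t) \<le> norm (e n * z ^ n)" if "t \<in> space \<mu>" for n t
  proof -
    have "\<bar>t ^ (n + m)\<bar> \<le> 1" using that by (auto simp: space_eq power_le_one abs_mult power_abs)
    then have "norm (f n t) \<le> 1 * norm (e n * z ^ n)"
      unfolding f_def norm_mult norm_of_real by (intro mult_right_mono) auto
    then show ?thesis by simp
  qed
  have int: "integrable \<mu> (f n)" for n
    by (rule integrable_const_bound[OF _ meas]) (use fb in auto)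
  obtain r where r: "cmod z < r" "r < 1" using z dense by blast
  then have r0: "0 \<le> r" using norm_ge_zero[of z] by linarith
  have "summable (\<lambda>n. e n * of_real r ^ n)"
    using E[of "of_real r"] r r0 by (auto simp: sums_iff)
  then have sn: "summable (\<lambda>n. norm (e n * z ^ n))"
    by (rule powser_insidea) (use r r0 in auto)
  have sumf: "summable (\<lambda>n. norm (f n t))" if "t \<in> space \<mu>" for t
    by (rule summable_comparison_test'[OF sn, of 0]) (use fb[OF that] in auto)
  have sumi: "summable (\<lambda>n. \<integral>t. norm (f n t) \<partial>\<mu>)"
  proof (rule summable_comparison_test'[OF summable_mult2[OF sn, of "measure \<mu> (space \<mu>)"], of 0])
    fix n
    have "(\<integral>t. norm (f n t) \<partial>\<mu>) \<le> (\<integral>t. norm (e n * z ^ n) \<partial>\<mu>)"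
      by (rule integral_mono) (use int fb in auto)
    then show "norm (\<integral>t. norm (f n t) \<partial>\<mu>) \<le> norm (e n * z ^ n) * measure \<mu> (space \<mu>)"
      by (simp add: integral_nonneg_AE mult.commute)
  qed
  have lim: "(\<Sum>n. f n t) = of_real (t ^ m) * E (of_real t * z)" if t: "t \<in> space \<mu>" for t
  proof -
    have "cmod (of_real t * z) < 1"
      using t z by (rule scaled_in_disk)
    from sums_mult[OF E[OF this], of "of_real (t ^ m)"]
    have "(\<lambda>n. of_real (t ^ m) * (e n * (of_real t * z) ^ n)) sums (of_real (t ^ m) * E (of_real t * z))" .
    also have "(\<lambda>n. of_real (t ^ m) * (e n * (of_real t * z) ^ n)) = (\<lambda>n. f n t)"
      by (simp add: f_def power_add power_mult_distrib mult_ac)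
    finally show ?thesis by (simp add: sums_iff)
  qed
  have "integral\<^sup>L \<mu> (f n) = of_real (moment \<mu> (n + m)) * e n * z ^ n" for n
    unfolding f_def moment_def by (simp add: mult.assoc flip: of_real_power)
  moreover have "(\<integral>t. (\<Sum>n. f n t) \<partial>\<mu>) = (\<integral>t. of_real (t ^ m) * E (of_real t * z) \<partial>\<mu>)"
    by (rule Bochner_Integration.integral_cong) (auto simp: lim)
  ultimately show "(\<lambda>n. of_real (moment \<mu> (n + m)) * e n * z ^ n) sums (\<integral>t. of_real (t ^ m) * E (of_real t * z) \<partial>\<mu>)"
    using sums_integral[of \<mu> f] int sumf sumi by simp
  have "integrable \<mu> (\<lambda>t. \<Sum>n. f n t)"
    using integrable_suminf[of \<mu> f] int sumf sumi by simp
  also have "integrable \<mu> (\<lambda>t. \<Sum>n. f n t) = integrable \<mu> (\<lambda>t. of_real (t ^ m) * E (of_real t * z))"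
    by (rule Bochner_Integration.integrable_cong) (auto simp: lim)
  finally show "integrable \<mu> (\<lambda>t. of_real (t ^ m) * E (of_real t * z))" .
qed

end

definition cesaro_coeff :: "real \<Rightarrow> nat \<Rightarrow> real" where
  "cesaro_coeff \<alpha> j = Gamma (real j + \<alpha>) / (Gamma \<alpha> * fact j)"

lemma cesaro_coeff_pochhammer:
  assumes "0 < \<alpha>"
  shows "cesaro_coeff \<alpha> j = pochhammer \<alpha> j / fact j"
proof -
  have "\<alpha> \<notin> \<int>\<^sub>\<le>\<^sub>0" using assms by (auto elim!: nonpos_Ints_cases)
  then show ?thesis by (simp add: cesaro_coeff_def pochhammer_Gamma add.commute)
qed

text \<open>
  The binomial series with exponent \<open>- \<alpha>\<close>.
\<close>

lemma cesaro_coeff_sums: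
  assumes "0 < \<alpha>" "cmod z < 1"
  shows "(\<lambda>n. of_real (cesaro_coeff \<alpha> n) * z ^ n) sums (1 - z) powr (- of_real \<alpha>)"
proof -
  have "((- of_real \<alpha> :: complex) gchoose n) * (- z) ^ n = of_real (cesaro_coeff \<alpha> n) * z ^ n" for n
  proof -
    have "((- of_real \<alpha> :: complex) gchoose n) * (- z) ^ n
        = ((-1) ^ n * (-1) ^ n) * (pochhammer (of_real \<alpha>) n / fact n) * z ^ n"
      by (simp add: gbinomial_pochhammer power_minus[of z] mult_ac)
    also have "(-1) ^ n * (-1) ^ n = (1 :: complex)" by (simp flip: power_mult_distrib)
    finally show ?thesis
      by (simp add: cesaro_coeff_pochhammer[OF assms(1)] pochhammer_of_real)
  qed
  with gen_binomial_complex[of "- z" "- of_real \<alpha>"] assms show ?thesis by simp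
qed

definition cesaro_integrand :: "real \<Rightarrow> (complex \<Rightarrow> complex) \<Rightarrow> complex \<Rightarrow> complex" where
  "cesaro_integrand \<alpha> f z = f z * (1 - z) powr (- of_real \<alpha>)"

definition integrand_coeff :: "real \<Rightarrow> (complex \<Rightarrow> complex) \<Rightarrow> nat \<Rightarrow> complex" where
  "integrand_coeff \<alpha> f n = (\<Sum>k\<le>n. of_real (cesaro_coeff \<alpha> (n - k)) * taylor_coeff f k)"

text \<open>
  The coefficients in the definition of the operator are those of a Cauchy product.
\<close>

lemma integrand_coeff_sums:
  assumes f: "f holomorphic_on unit_disk" and \<alpha>: "0 < \<alpha>" and z: "cmod z < 1"
  shows "(\<lambda>n. integrand_coeff \<alpha> f n * z ^ n) sums cesaro_integrand \<alpha> f z"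
proof -
  have T: "(\<lambda>n. taylor_coeff f n * w ^ n) sums f w" if "cmod w < 1" for w
    using holomorphic_power_series[OF f, of w] that by (simp add: taylor_coeff_def)
  obtain r where r: "cmod z < r" "r < 1" using z dense by blast
  then have r0: "0 \<le> r" using norm_ge_zero[of z] by linarith
  have r': "cmod (of_real r) < 1" "cmod z < cmod (of_real r)"
    using r r0 by auto
  have 1: "summable (\<lambda>n. norm (taylor_coeff f n * z ^ n))"
    using powser_insidea[OF sums_summable[OF T[OF r'(1)]] r'(2)] .
  have 2: "summable (\<lambda>n. norm (of_real (cesaro_coeff \<alpha> n) * z ^ n))"
    using powser_insidea[OF sums_summable[OF cesaro_coeff_sums[OF \<alpha> r'(1)]] r'(2)] .
  have "(\<Sum>i\<le>n. (taylor_coeff f i * z ^ i) * (of_real (cesaro_coeff \<alpha> (n - i)) * z ^ (n - i)))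
      = integrand_coeff \<alpha> f n * z ^ n" for n
    unfolding integrand_coeff_def sum_distrib_right
    by (intro sum.cong) (auto simp: mult_ac simp flip: power_add)
  with Cauchy_product_sums[OF 1 2] sums_unique[OF T[OF z]] sums_unique[OF cesaro_coeff_sums[OF \<alpha> z]]
  show ?thesis by (simp add: cesaro_integrand_def)
qed

context unit_interval_measure
begin

lemma cesaro_eq_suminf:
  assumes "cmod z < 1"
  shows "cesaro \<mu> \<alpha> f z = (\<Sum>n. of_real (moment \<mu> n) * integrand_coeff \<alpha> f n * z ^ n)"
  using assms by (simp add: cesaro_def integrand_coeff_def cesaro_coeff_def)

lemma cesaro_sums:
  assumes f: "f holomorphic_on unit_disk" and \<alpha>: "0 < \<alpha>" and z: "cmod z < 1"
  shows "(\<lambda>n. of_real (moment \<mu> n) * integrand_coeff \<alpha> f n * z ^ n) sums cesaro \<mu> \<alpha> f z"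
  using powser_moment_integral(1)[OF integrand_coeff_sums[OF f \<alpha>] z, of 0]
  by (simp add: cesaro_eq_suminf[OF z] sums_iff)

lemma cesaro_mem_H_disk:
  assumes f: "f holomorphic_on unit_disk" and \<alpha>: "0 < \<alpha>"
  shows "cesaro \<mu> \<alpha> f \<in> H_disk"
proof -
  have "cesaro \<mu> \<alpha> f holomorphic_on unit_disk"
    by (rule powser_holomorphic) (rule cesaro_sums[OF f \<alpha>])
  then show ?thesis by (simp add: H_disk_def) (simp add: cesaro_def)
qed

lemma higher_deriv_cesaro:
  assumes f: "f holomorphic_on unit_disk" and \<alpha>: "0 < \<alpha>" and z: "cmod z < 1"
  shows "(deriv ^^ m) (cesaro \<mu> \<alpha> f) z
      = (\<integral>t. of_real (t ^ m) * (deriv ^^ m) (cesaro_integrand \<alpha> f) (of_real t * z) \<partial>\<mu>)"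
    and "integrable \<mu> (\<lambda>t. of_real (t ^ m) * (deriv ^^ m) (cesaro_integrand \<alpha> f) (of_real t * z))"
proof -
  note F = powser_higher_deriv_sums[OF integrand_coeff_sums[OF f \<alpha>], of _ m]
  from powser_moment_integral[OF F z, of m] powser_higher_deriv_sums[OF cesaro_sums[OF f \<alpha>] z, of m]
  show "(deriv ^^ m) (cesaro \<mu> \<alpha> f) z
      = (\<integral>t. of_real (t ^ m) * (deriv ^^ m) (cesaro_integrand \<alpha> f) (of_real t * z) \<partial>\<mu>)"
    and "integrable \<mu> (\<lambda>t. of_real (t ^ m) * (deriv ^^ m) (cesaro_integrand \<alpha> f) (of_real t * z))"
    by (auto simp: diffs_funpow_shift dest: sums_unique2)
qed

end

section \<open>Pointwise estimates for Bloch functions\<close>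

text \<open>
  The weight \<open>1 - \<bar>z\<bar>\<close> differs from the Bloch weight \<open>1 - \<bar>z\<bar>\<^sup>2\<close> by a factor between \<open>1\<close> and \<open>2\<close>.
\<close>

definition bloch_bounded :: "real \<Rightarrow> (complex \<Rightarrow> complex) \<Rightarrow> bool" where
  "bloch_bounded L f \<longleftrightarrow> f holomorphic_on unit_disk \<and> cmod (f 0) \<le> L \<and>
     (\<forall>z. cmod z < 1 \<longrightarrow> (1 - cmod z) * cmod (deriv f z) \<le> L)"

lemma bloch_bounded_nonneg: "bloch_bounded L f \<Longrightarrow> 0 \<le> L"
  unfolding bloch_bounded_def using norm_ge_zero[of "f 0"] by linarith

text \<open>
  The derivative of \<open>f (t z)\<close> in \<open>t\<close> is dominated by that of \<open>- L ln (1 - t \<bar>z\<bar>)\<close>.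
\<close>

lemma bloch_growth:
  assumes f: "bloch_bounded L f" and z: "cmod z < 1"
  shows "cmod (f z) \<le> L * (1 - ln (1 - cmod z))"
proof -
  have L: "0 \<le> L" using f by (rule bloch_bounded_nonneg)
  have pos: "t * cmod z < 1" if "0 \<le> t" "t \<le> 1" for t
    using mult_right_mono[of t 1 "cmod z"] that z by simp
  have der: "((\<lambda>t. f (of_real t * z)) has_vector_derivative z * deriv f (of_real t * z)) (at t)"
    if t: "0 \<le> t" "t \<le> 1" for t
  proof -
    have "f field_differentiable at (of_real t * z)"
      using f pos[OF t] t by (intro holomorphic_on_imp_differentiable_at[of f unit_disk])
        (auto simp: bloch_bounded_def norm_mult)
    then have "(f has_field_derivative deriv f (of_real t * z)) (at (of_real t * z))"
      by (rule field_differentiable_derivI)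
    moreover have "((\<lambda>t. of_real t * z) has_vector_derivative z) (at t)"
      by (auto intro!: derivative_eq_intros simp: has_vector_derivative_def scaleR_conv_of_real)
    ultimately show ?thesis
      using field_vector_diff_chain_at[of "\<lambda>t. of_real t * z" z t f] by (simp add: o_def)
  qed
  have "norm (f (of_real 1 * z) - f (of_real 0 * z)) \<le> (- L * ln (1 - 1 * cmod z)) - (- L * ln (1 - 0 * cmod z))"
  proof (rule differentiable_bound_general[where f = "\<lambda>t. f (of_real t * z)" and \<phi> = "\<lambda>t. - L * ln (1 - t * cmod z)"])
    show "continuous_on {0..1} (\<lambda>t. f (of_real t * z))"
      using has_vector_derivative_continuous[OF der] by (intro continuous_at_imp_continuous_on) simp
    show "continuous_on {0..1} (\<lambda>t. - L * ln (1 - t * cmod z))"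
      using pos by (intro continuous_intros) force
    fix t :: real assume t: "0 < t" "t < 1"
    show "((\<lambda>t. f (of_real t * z)) has_vector_derivative z * deriv f (of_real t * z)) (at t)"
      using der t by simp
    have "((\<lambda>t. - L * ln (1 - t * cmod z)) has_real_derivative cmod z * (L / (1 - t * cmod z))) (at t)"
      using pos[of t] t by (auto intro!: derivative_eq_intros)
    then show "((\<lambda>t. - L * ln (1 - t * cmod z)) has_vector_derivative cmod z * (L / (1 - t * cmod z))) (at t)"
      by (simp add: has_real_derivative_iff_has_vector_derivative)
    have "(1 - cmod (of_real t * z)) * cmod (deriv f (of_real t * z)) \<le> L"
    proof -
      have "cmod (of_real t * z) < 1" using pos[of t] t by (simp add: norm_mult)
      with f show ?thesis unfolding bloch_bounded_def by blast
    qed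
    then have "cmod (deriv f (of_real t * z)) \<le> L / (1 - t * cmod z)"
      using pos[of t] t by (simp add: norm_mult field_simps)
    then show "norm (z * deriv f (of_real t * z)) \<le> cmod z * (L / (1 - t * cmod z))"
      unfolding norm_mult by (intro mult_left_mono) auto
  qed simp
  then have "cmod (f z - f 0) \<le> - L * ln (1 - cmod z)" by simp
  moreover have "cmod (f z) \<le> cmod (f 0) + cmod (f z - f 0)"
    using norm_triangle_ineq[of "f 0" "f z - f 0"] by simp
  moreover have "cmod (f 0) \<le> L" using f by (simp add: bloch_bounded_def)
  ultimately show ?thesis by (simp add: algebra_simps)
qed

lemma bloch_deriv_le:
  assumes "bloch_bounded L f" and "cmod z < 1"
  shows "cmod (deriv f z) \<le> L / (1 - cmod z)"
  using assms by (simp add: bloch_bounded_def field_simps)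

text \<open>
  Cauchy's estimate for \<open>f'\<close> on the circle about \<open>z\<close> whose radius is half the distance to the unit circle.
\<close>

lemma bloch_second_deriv_le:
  assumes f: "bloch_bounded L f" and z: "cmod z < 1"
  shows "cmod (deriv (deriv f) z) \<le> 4 * L / (1 - cmod z)\<^sup>2"
proof -
  define r where "r = (1 - cmod z) / 2"
  have r: "0 < r" using z by (simp add: r_def)
  have sub: "cball z r \<subseteq> unit_disk"
  proof
    fix x assume "x \<in> cball z r"
    then have "cmod x \<le> cmod z + r" using norm_triangle_ineq[of z "x - z"] by (simp add: dist_norm norm_minus_commute)
    also have "\<dots> < 1" using z by (simp add: r_def field_simps)
    finally show "x \<in> unit_disk" by simp
  qed
  have hol: "deriv f holomorphic_on unit_disk"
    using f by (intro holomorphic_deriv) (auto simp: bloch_bounded_def)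
  have L: "0 \<le> L" using f by (rule bloch_bounded_nonneg)
  have "cmod ((deriv ^^ 1) (deriv f) z) \<le> fact 1 * (L / r) / r ^ 1"
  proof (rule Cauchy_inequality)
    show "deriv f holomorphic_on ball z r"
      using hol sub by (meson ball_subset_cball holomorphic_on_subset order_trans)
    show "continuous_on (cball z r) (deriv f)"
      using hol sub by (meson holomorphic_on_imp_continuous_on holomorphic_on_subset)
    fix x assume x: "cmod (z - x) = r"
    then have "x \<in> unit_disk" using sub by (auto simp: dist_norm)
    moreover have "r \<le> 1 - cmod x"
      using norm_triangle_ineq[of z "x - z"] x by (simp add: r_def norm_minus_commute)
    ultimately have "cmod (deriv f x) \<le> L / (1 - cmod x)" "L / (1 - cmod x) \<le> L / r"
      using bloch_deriv_le[OF f] L r by (auto intro!: divide_left_mono)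
    then show "cmod (deriv f x) \<le> L / r" by simp
  qed (use r in auto)
  also have "\<dots> = 4 * L / (1 - cmod z)\<^sup>2" by (simp add: r_def power2_eq_square field_simps)
  finally show ?thesis by simp
qed

lemma has_field_derivative_one_minus_powr:
  assumes "cmod z < 1"
  shows "((\<lambda>z. (1 - z) powr (- of_real \<beta>)) has_field_derivative
     of_real \<beta> * (1 - z) powr (- of_real (\<beta> + 1))) (at z)"
proof -
  have "0 < Re (1 - z)" using assms complex_Re_le_cmod[of z] by simp
  then have "1 - z \<notin> \<real>\<^sub>\<le>\<^sub>0" by (auto simp: complex_nonpos_Reals_iff)
  then have "((\<lambda>z. (1 - z) powr s) has_field_derivative - (s * (1 - z) powr (s - 1))) (at z)" for s
    by (auto intro!: derivative_eq_intros)
  from this[of "- of_real \<beta>"] show ?thesis by simp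
qed

lemma deriv_cesaro_integrand:
  assumes f: "f holomorphic_on unit_disk" and z: "cmod z < 1"
  shows "deriv (cesaro_integrand \<alpha> f) z =
     cesaro_integrand \<alpha> (deriv f) z + of_real \<alpha> * cesaro_integrand (\<alpha> + 1) f z"
proof -
  have "(f has_field_derivative deriv f z) (at z)"
    using f z by (intro field_differentiable_derivI holomorphic_on_imp_differentiable_at[of f unit_disk]) auto
  from DERIV_mult[OF this has_field_derivative_one_minus_powr[OF z, of \<alpha>]]
  have "(cesaro_integrand \<alpha> f has_field_derivative
     cesaro_integrand \<alpha> (deriv f) z + of_real \<alpha> * cesaro_integrand (\<alpha> + 1) f z) (at z)"
    unfolding cesaro_integrand_def[abs_def] by (simp add: mult_ac add_ac)
  then show ?thesis by (rule DERIV_imp_deriv)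
qed

lemma holomorphic_cesaro_integrand:
  assumes f: "f holomorphic_on unit_disk"
  shows "cesaro_integrand \<alpha> f holomorphic_on unit_disk"
proof -
  have "(\<lambda>z. (1 - z) powr (- of_real \<alpha>)) holomorphic_on unit_disk"
  proof (subst holomorphic_on_open)
    show "\<forall>z\<in>unit_disk. \<exists>f'. ((\<lambda>z. (1 - z) powr (- of_real \<alpha>)) has_field_derivative f') (at z)"
    proof
      fix z :: complex assume "z \<in> unit_disk"
      then show "\<exists>f'. ((\<lambda>z. (1 - z) powr (- of_real \<alpha>)) has_field_derivative f') (at z)"
        using has_field_derivative_one_minus_powr[of z \<alpha>] by auto
    qed
  qed simp
  then show ?thesis
    unfolding cesaro_integrand_def[abs_def] using f by (intro holomorphic_on_mult)
qed

lemma second_deriv_cesaro_integrand: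
  assumes f: "f holomorphic_on unit_disk" and z: "cmod z < 1"
  shows "deriv (deriv (cesaro_integrand \<alpha> f)) z =
     cesaro_integrand \<alpha> (deriv (deriv f)) z + 2 * of_real \<alpha> * cesaro_integrand (\<alpha> + 1) (deriv f) z
     + of_real (\<alpha> * (\<alpha> + 1)) * cesaro_integrand (\<alpha> + 2) f z"
proof -
  have f': "deriv f holomorphic_on unit_disk" using f by (intro holomorphic_deriv) auto
  have "deriv (deriv (cesaro_integrand \<alpha> f)) z
      = deriv (\<lambda>z. cesaro_integrand \<alpha> (deriv f) z + of_real \<alpha> * cesaro_integrand (\<alpha> + 1) f z) z"
    by (rule complex_derivative_transform_within_open[of _ unit_disk])
       (use z deriv_cesaro_integrand[OF f] in
         \<open>auto intro!: holomorphic_intros holomorphic_cesaro_integrand f f' holomorphic_deriv\<close>)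
  also have "\<dots> = deriv (cesaro_integrand \<alpha> (deriv f)) z + of_real \<alpha> * deriv (cesaro_integrand (\<alpha> + 1) f) z"
  proof -
    have "cesaro_integrand \<alpha> (deriv f) field_differentiable at z" "cesaro_integrand (\<alpha> + 1) f field_differentiable at z"
      using z holomorphic_cesaro_integrand[OF f'] holomorphic_cesaro_integrand[OF f]
      by (auto intro!: holomorphic_on_imp_differentiable_at[of _ unit_disk])
    then show ?thesis
      by (subst deriv_add) (auto intro!: derivative_intros deriv_cmult)
  qed
  also have "\<dots> = cesaro_integrand \<alpha> (deriv (deriv f)) z + 2 * of_real \<alpha> * cesaro_integrand (\<alpha> + 1) (deriv f) z
     + of_real (\<alpha> * (\<alpha> + 1)) * cesaro_integrand (\<alpha> + 2) f z"
    by (simp add: deriv_cesaro_integrand[OF f z] deriv_cesaro_integrand[OF f' z] algebra_simps)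
  finally show ?thesis .
qed

lemma norm_cesaro_integrand:
  "cmod z < 1 \<Longrightarrow> cmod (cesaro_integrand \<alpha> f z) = cmod (f z) * cmod (1 - z) powr (- \<alpha>)"
  by (simp add: cesaro_integrand_def norm_mult norm_powr_real_powr' flip: of_real_minus)

text \<open>
  The logarithm is kept apart from the first summand: in the critical case \<open>\<alpha> p = 1\<close> the first summand
  produces a power of the logarithm of its own when it is integrated over circles, and a further factor
  would be too much.
\<close>

definition bloch_kernel :: "real \<Rightarrow> nat \<Rightarrow> complex \<Rightarrow> real" where
  "bloch_kernel \<alpha> m w = cmod (1 - w) powr (- \<alpha>) / (1 - cmod w) ^ m
     + (1 - ln (1 - cmod w)) * cmod (1 - w) powr (- (\<alpha> + m))"

text \<open>
  In the Leibniz formula only the term with \<open>f\<close> itself carries a logarithm, and there all \<open>m\<close> derivatives fall on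
  the power of \<open>1 - z\<close>. In the other terms each derivative of \<open>f\<close> costs one power of \<open>1 - \<bar>z\<bar>\<close>, and the remaining
  powers of \<open>\<bar>1 - z\<bar>\<close> may be replaced by powers of the smaller quantity \<open>1 - \<bar>z\<bar>\<close>.
\<close>

lemma norm_deriv_cesaro_integrand_le:
  assumes f: "bloch_bounded L f" and z: "cmod z < 1" and \<alpha>: "0 < \<alpha>" and m: "m \<in> {1, 2}"
  shows "cmod ((deriv ^^ m) (cesaro_integrand \<alpha> f) z) \<le> (2 + \<alpha>)\<^sup>2 * L * bloch_kernel \<alpha> m z"
proof -
  define \<rho> where "\<rho> = 1 - cmod z"
  define d where "d = cmod (1 - z)"
  have \<rho>: "0 < \<rho>" "\<rho> \<le> 1" using z by (auto simp: \<rho>_def)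
  have d: "\<rho> \<le> d" using norm_triangle_ineq2[of 1 z] by (simp add: \<rho>_def d_def)
  have L: "0 \<le> L" using f by (rule bloch_bounded_nonneg)
  have ln: "0 \<le> 1 - ln \<rho>" using \<rho> ln_le_zero_iff[of \<rho>] by linarith
  have hol: "f holomorphic_on unit_disk" using f by (simp add: bloch_bounded_def)
  note G = bloch_growth[OF f z, folded \<rho>_def] bloch_deriv_le[OF f z, folded \<rho>_def]
    bloch_second_deriv_le[OF f z, folded \<rho>_def]
  note N = norm_cesaro_integrand[OF z, folded d_def]
  define E where "E = d powr (- \<alpha>) / \<rho> ^ m"
  define H where "H = (1 - ln \<rho>) * d powr (- (\<alpha> + m))"
  have EH: "0 \<le> E" "0 \<le> H" using \<rho> ln by (auto simp: E_def H_def)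
  have K: "bloch_kernel \<alpha> m z = E + H" by (simp add: bloch_kernel_def E_def H_def \<rho>_def d_def)
  consider "m = 1" | "m = 2" using m by auto
  then show ?thesis
  proof cases
    case 1
    have "cmod (cesaro_integrand \<alpha> (deriv f) z) \<le> L / \<rho> * d powr (- \<alpha>)"
      unfolding N by (intro mult_right_mono G) auto
    also have "\<dots> = L * E" by (simp add: E_def 1)
    finally have a: "cmod (cesaro_integrand \<alpha> (deriv f) z) \<le> L * E" .
    have "cmod (cesaro_integrand (\<alpha> + 1) f z) \<le> L * (1 - ln \<rho>) * d powr (- (\<alpha> + 1))"
      unfolding N by (intro mult_right_mono G) auto
    also have "\<dots> = L * H" by (simp add: H_def 1)
    finally have b: "cmod (cesaro_integrand (\<alpha> + 1) f z) \<le> L * H" .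
    have "cmod (deriv (cesaro_integrand \<alpha> f) z)
       \<le> cmod (cesaro_integrand \<alpha> (deriv f) z) + \<alpha> * cmod (cesaro_integrand (\<alpha> + 1) f z)"
      using norm_triangle_ineq[of "cesaro_integrand \<alpha> (deriv f) z" "of_real \<alpha> * cesaro_integrand (\<alpha> + 1) f z"] \<alpha>
      by (simp add: deriv_cesaro_integrand[OF hol z] norm_mult)
    also have "\<dots> \<le> L * E + \<alpha> * (L * H)"
      using a b \<alpha> by (intro add_mono mult_left_mono) auto
    also have "\<dots> \<le> (2 + \<alpha>)\<^sup>2 * (L * E) + (2 + \<alpha>)\<^sup>2 * (L * H)"
    proof (intro add_mono mult_right_mono)
      have "1 * (L * E) \<le> (2 + \<alpha>)\<^sup>2 * (L * E)"
        using \<alpha> L EH by (intro mult_right_mono) (auto intro!: one_le_power)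
      then show "L * E \<le> (2 + \<alpha>)\<^sup>2 * (L * E)" by simp
      show "\<alpha> \<le> (2 + \<alpha>)\<^sup>2" using \<alpha> by (simp add: power2_eq_square algebra_simps)
    qed (use L EH in auto)
    also have "\<dots> = (2 + \<alpha>)\<^sup>2 * L * bloch_kernel \<alpha> m z" unfolding K by (simp add: algebra_simps)
    finally show ?thesis by (simp add: 1)
  next
    case 2
    have "cmod (cesaro_integrand \<alpha> (deriv (deriv f)) z) \<le> 4 * L / \<rho>\<^sup>2 * d powr (- \<alpha>)"
      unfolding N by (intro mult_right_mono G) auto
    also have "\<dots> = 4 * (L * E)" by (simp add: E_def 2)
    finally have a: "cmod (cesaro_integrand \<alpha> (deriv (deriv f)) z) \<le> 4 * (L * E)" .
    have "cmod (cesaro_integrand (\<alpha> + 1) (deriv f) z) \<le> L / \<rho> * d powr (- (\<alpha> + 1))"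
      unfolding N by (intro mult_right_mono G) auto
    also have "\<dots> = L / \<rho> * (d powr (- \<alpha>) / d)"
    proof -
      have "d powr (- (\<alpha> + 1)) = d powr (- \<alpha>) / d"
        using d \<rho> powr_diff[of d "- \<alpha>" 1] by simp
      then show ?thesis by simp
    qed
    also have "\<dots> \<le> L / \<rho> * (d powr (- \<alpha>) / \<rho>)"
      using d \<rho> L by (intro mult_left_mono divide_left_mono) auto
    also have "\<dots> = L * E" by (simp add: E_def 2 power2_eq_square)
    finally have b: "cmod (cesaro_integrand (\<alpha> + 1) (deriv f) z) \<le> L * E" .
    have "cmod (cesaro_integrand (\<alpha> + 2) f z) \<le> L * (1 - ln \<rho>) * d powr (- (\<alpha> + 2))"
      unfolding N by (intro mult_right_mono G) auto
    also have "\<dots> = L * H" by (simp add: H_def 2)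
    finally have c: "cmod (cesaro_integrand (\<alpha> + 2) f z) \<le> L * H" .
    have "cmod (deriv (deriv (cesaro_integrand \<alpha> f)) z)
       \<le> cmod (cesaro_integrand \<alpha> (deriv (deriv f)) z) + 2 * \<alpha> * cmod (cesaro_integrand (\<alpha> + 1) (deriv f) z)
         + \<alpha> * (\<alpha> + 1) * cmod (cesaro_integrand (\<alpha> + 2) f z)"
    proof -
      have "cmod (x + 2 * of_real \<alpha> * y + of_real (\<alpha> * (\<alpha> + 1)) * w)
         \<le> cmod x + 2 * \<alpha> * cmod y + \<alpha> * (\<alpha> + 1) * cmod w" for x y w
      proof -
        have "cmod (2 * of_real \<alpha> * y) = 2 * \<alpha> * cmod y"
          "cmod (of_real (\<alpha> * (\<alpha> + 1)) * w) = \<alpha> * (\<alpha> + 1) * cmod w"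
          using \<alpha> by (auto simp: norm_mult simp del: of_real_mult)
        then show ?thesis
          using norm_triangle_ineq[of "x + 2 * of_real \<alpha> * y" "of_real (\<alpha> * (\<alpha> + 1)) * w"]
            norm_triangle_ineq[of x "2 * of_real \<alpha> * y"] by linarith
      qed
      then show ?thesis unfolding second_deriv_cesaro_integrand[OF hol z] .
    qed
    also have "\<dots> \<le> 4 * (L * E) + 2 * \<alpha> * (L * E) + \<alpha> * (\<alpha> + 1) * (L * H)"
      using a b c \<alpha> by (intro add_mono mult_left_mono) auto
    also have "\<dots> = (4 + 2 * \<alpha>) * (L * E) + \<alpha> * (\<alpha> + 1) * (L * H)" by (simp add: algebra_simps)
    also have "\<dots> \<le> (2 + \<alpha>)\<^sup>2 * (L * E) + (2 + \<alpha>)\<^sup>2 * (L * H)"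
      using \<alpha> L EH by (intro add_mono mult_right_mono) (auto simp: power2_eq_square algebra_simps)
    also have "\<dots> = (2 + \<alpha>)\<^sup>2 * L * bloch_kernel \<alpha> m z" unfolding K by (simp add: algebra_simps)
    finally show ?thesis by (simp add: 2 numeral_2_eq_2)
  qed
qed

section \<open>Dyadic sums\<close>

definition nat_dist :: "nat \<Rightarrow> nat \<Rightarrow> nat" where
  "nat_dist i k = (i - k) + (k - i)"

lemma nat_dist_commute: "nat_dist i k = nat_dist k i"
  by (simp add: nat_dist_def)

lemma geometric_nat_dist:
  fixes x :: real
  assumes x: "0 < x" "x < 1"
  shows "summable (\<lambda>k. x ^ nat_dist i k)" and "(\<Sum>k. x ^ nat_dist i k) \<le> 2 / (1 - x)"
proof -
  have geo: "summable (\<lambda>k. x ^ k)" "(\<Sum>k. x ^ k) = 1 / (1 - x)"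
    using x by (auto simp: suminf_geometric)
  have shift: "(\<lambda>k. x ^ nat_dist i (k + i)) = (\<lambda>k. x ^ k)"
    by (simp add: nat_dist_def)
  show sm: "summable (\<lambda>k. x ^ nat_dist i k)"
    using geo(1) summable_iff_shift[of "\<lambda>k. x ^ nat_dist i k" i] by (simp add: shift)
  have "(\<Sum>k<i. x ^ nat_dist i k) \<le> (\<Sum>k<i. x ^ (i - Suc k))"
    using x by (intro sum_mono power_decreasing) (auto simp: nat_dist_def)
  also have "\<dots> = (\<Sum>k<i. x ^ k)" by (rule sum.nat_diff_reindex)
  also have "\<dots> \<le> (\<Sum>k. x ^ k)" using x geo by (intro sum_le_suminf) auto
  finally have "(\<Sum>k<i. x ^ nat_dist i k) \<le> 1 / (1 - x)" by (simp add: geo)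
  moreover have "(\<Sum>k. x ^ nat_dist i k) = (\<Sum>k. x ^ nat_dist i (k + i)) + (\<Sum>k<i. x ^ nat_dist i k)"
    using sm by (rule suminf_split_initial_segment)
  ultimately show "(\<Sum>k. x ^ nat_dist i k) \<le> 2 / (1 - x)"
    by (simp add: shift geo)
qed

lemma sum_geometric_nat_dist_le:
  fixes x :: real
  assumes x: "0 < x" "x < 1" and "finite A"
  shows "(\<Sum>k\<in>A. x ^ nat_dist i k) \<le> 2 / (1 - x)"
proof -
  have "(\<Sum>k\<in>A. x ^ nat_dist i k) \<le> (\<Sum>k. x ^ nat_dist i k)"
    using assms geometric_nat_dist(1)[OF x] by (intro sum_le_suminf) auto
  also note geometric_nat_dist(2)[OF x]
  finally show ?thesis .
qed

text \<open>
  If \<open>s\<close> is the sum of the \<open>(a k / w k) powr p\<close>, then \<open>a k \<le> w k * s powr (1 / p)\<close> for each \<open>k\<close>; summing over \<open>k\<close> gives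
  the claim. It plays the role of Young's inequality for convolutions, with \<open>w\<close> a geometric kernel.
\<close>

lemma powr_le_weighted_suminf:
  fixes a w :: "nat \<Rightarrow> real"
  assumes a: "\<And>k. 0 \<le> a k" and w: "\<And>k. 0 < w k" "summable w" "suminf w \<le> W"
    and x: "0 \<le> x" "ennreal x \<le> (\<Sum>k. ennreal (a k))" and p: "0 < p"
  shows "ennreal (x powr p) \<le> ennreal (W powr p) * (\<Sum>k. ennreal ((a k / w k) powr p))"
proof (cases "(\<Sum>k. ennreal ((a k / w k) powr p))")
  case top
  have "0 < suminf w" using w by (intro suminf_pos) auto
  then show ?thesis using w by (simp add: top ennreal_mult_top)
next
  case (real s)
  have W: "0 \<le> W" using w by (meson less_imp_le order_trans suminf_nonneg)
  have "a k \<le> w k * s powr (1 / p)" for k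
  proof -
    have "sum (\<lambda>k. ennreal ((a k / w k) powr p)) {k} \<le> (\<Sum>k. ennreal ((a k / w k) powr p))"
      by (rule sum_le_suminf) simp_all
    then have "ennreal ((a k / w k) powr p) \<le> ennreal s" by (simp only: real(2)) simp
    then have "(a k / w k) powr p \<le> s" using real(1) by simp
    then have "((a k / w k) powr p) powr (1 / p) \<le> s powr (1 / p)"
      using p by (intro powr_mono2) auto
    then have "a k / w k \<le> s powr (1 / p)"
      using a[of k] w(1)[of k] p by (simp add: powr_powr)
    then show ?thesis using w(1)[of k] by (simp add: field_simps)
  qed
  then have "(\<Sum>k. ennreal (a k)) \<le> (\<Sum>k. ennreal (w k * s powr (1 / p)))"
    by (intro suminf_le) (auto intro: ennreal_leI)
  also have "\<dots> = ennreal (\<Sum>k. w k * s powr (1 / p))"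
    using w by (intro suminf_ennreal2) (auto intro!: summable_mult2 mult_nonneg_nonneg less_imp_le[OF w(1)])
  also have "(\<Sum>k. w k * s powr (1 / p)) = suminf w * s powr (1 / p)"
    using w by (intro suminf_mult2[symmetric])
  also have "ennreal \<dots> \<le> ennreal (W * s powr (1 / p))"
    using w by (intro ennreal_leI mult_right_mono) auto
  finally have "x \<le> W * s powr (1 / p)"
    using x(2) W by (metis ennreal_le_iff mult_nonneg_nonneg order_trans powr_ge_zero)
  then have "x powr p \<le> (W * s powr (1 / p)) powr p"
    using x p by (intro powr_mono2) auto
  also have "\<dots> = W powr p * s" using W p real(1) by (simp add: powr_mult powr_powr)
  finally show ?thesis using real W by (simp flip: ennreal_mult add: ennreal_leI)
qed

lemma dyadic_index_exists:
  fixes x :: real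
  assumes "0 < x" "x \<le> 1"
  obtains k :: nat where "(1/2) ^ Suc k < x" "x \<le> (1/2) ^ k"
proof -
  have "\<exists>n. (1/2 :: real) ^ n < x" using assms by (intro real_arch_pow_inv) auto
  define n where "n = (LEAST n. (1/2 :: real) ^ n < x)"
  have n: "(1/2 :: real) ^ n < x" unfolding n_def by (rule LeastI_ex) fact
  have "n \<noteq> 0" using n assms by (intro notI) simp
  then obtain k where k: "n = Suc k" by (cases n) auto
  have "\<not> (1/2 :: real) ^ k < x"
    by (rule not_less_Least) (use k in \<open>simp add: n_def[symmetric]\<close>)
  then show ?thesis using n k that[of k] by auto
qed

text \<open>
  Up to a constant, this is the value of the kernel \<open>bloch_kernel\<close> at \<open>t z\<close> when \<open>1 - t\<close> is about \<open>2 powr (- k)\<close>, \<open>1 - \<bar>z\<bar>\<close>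
  about \<open>2 powr (- i)\<close> and \<open>\<bar>1 - z\<bar>\<close> about \<open>2 powr (- q)\<close>: the larger of two distances always wins.
\<close>

definition dyadic_bound :: "real \<Rightarrow> nat \<Rightarrow> nat \<Rightarrow> nat \<Rightarrow> nat \<Rightarrow> real" where
  "dyadic_bound \<alpha> m i q k = 2 powr (m * real (min k i) + \<alpha> * real (min k q))
     + (real (min k i) + 1) * 2 powr ((\<alpha> + m) * real (min k q))"

lemma dyadic_bound_pos: "0 < dyadic_bound \<alpha> m i q k"
  unfolding dyadic_bound_def by (intro add_pos_nonneg) auto

text \<open>
  The left-hand side stands for the integral of \<open>bloch_kernel\<close> to the power \<open>p\<close> over the points at distance about \<open>2 powr (- i)\<close> from the
  circle. Let \<open>l = min k i\<close>. The second summand of \<open>dyadic_bound\<close> contributes terms that decay geometrically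
  away from \<open>q = l + 1\<close>. The terms with \<open>q \<le> l\<close> of the first summand may all have the same size, namely
  if \<open>\<alpha> p = 1\<close>; their number \<open>l + 1\<close> is at most \<open>(l + 1) powr p\<close>.
\<close>

lemma sum_dyadic_bound_le:
  fixes \<alpha> p :: real and m i k :: nat
  assumes "0 < \<alpha>" "1 \<le> p" "1 \<le> \<alpha> * p" "1 \<le> m"
  shows "(\<Sum>q\<le>Suc i. (1/2) ^ q * dyadic_bound \<alpha> m i q k powr p)
    \<le> 2 powr p * (9 * 2 powr (\<alpha> * p - 1) + 4 * 2 powr ((\<alpha> + m) * p - 1))
       * ((real (min k i) + 1) powr p * 2 powr (real (min k i) * ((\<alpha> + m) * p - 1)))"
proof -
  define l where "l = min k i"
  define a where "a = \<alpha> * p"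
  define \<gamma> where "\<gamma> = (\<alpha> + m) * p - 1"
  have "1 * 1 \<le> real m * p" using assms by (intro mult_mono) auto
  then have \<gamma>: "1 \<le> \<gamma>" "\<gamma> = a + m * p - 1" using assms by (auto simp: \<gamma>_def a_def algebra_simps)
  have summand: "(1/2) ^ q * dyadic_bound \<alpha> m i q k powr p
     \<le> 2 powr p * (2 powr (l * \<gamma>)) *
        (2 powr (a - 1) * ((if q \<le> l then 1 else 0) + 2 * (1/2) ^ nat_dist l q)
         + (real l + 1) powr p * 2 powr \<gamma> * (1/2) ^ nat_dist (Suc l) q)" if q: "q \<le> Suc i" for q
  proof -
    define q' where "q' = min k q"
    have q'l: "q' \<le> Suc l" "q' \<le> q" using q by (auto simp: q'_def l_def)
    define x where "x = 2 powr (m * real l + \<alpha> * real q')"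
    define y where "y = (real l + 1) * 2 powr ((\<alpha> + m) * real q')"
    have xy: "0 \<le> x" "0 \<le> y" by (auto simp: x_def y_def)
    have half: "(1/2::real) ^ n = 2 powr (- real n)" for n
      by (simp add: powr_minus powr_realpow power_one_over inverse_eq_divide)
    have "dyadic_bound \<alpha> m i q k powr p = (x + y) powr p"
      by (simp add: dyadic_bound_def x_def y_def l_def q'_def)
    also have "\<dots> \<le> (2 * max x y) powr p" using xy assms by (intro powr_mono2) auto
    also have "\<dots> = 2 powr p * max x y powr p" using xy by (simp add: powr_mult)
    also have "\<dots> \<le> 2 powr p * (x powr p + y powr p)"
      by (intro mult_left_mono) (auto simp: max_def)
    finally have 1: "dyadic_bound \<alpha> m i q k powr p \<le> 2 powr p * (x powr p + y powr p)" .
    \<comment> \<open>the first summand: \<open>a \<ge> 1\<close> lets \<open>q\'\<close> be replaced by its upper bound \<open>l + 1\<close>\<close>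
    have x: "(1/2) ^ q * x powr p \<le> 2 powr (l * \<gamma>) * (2 powr (a - 1) * ((if q \<le> l then 1 else 0) + 2 * (1/2) ^ nat_dist l q))"
    proof -
      have "(1/2) ^ q * x powr p = 2 powr (p * (m * real l + \<alpha> * real q') - q)"
        by (simp add: half x_def powr_powr mult.commute flip: powr_add)
      also have "p * (m * real l + \<alpha> * real q') - q = real l * (m * p) + (a - 1) * q' - (real q - real q')"
        by (simp add: a_def algebra_simps)
      also have "2 powr \<dots> \<le> 2 powr (real l * (m * p) + (a - 1) * (real l + 1) - (real q - real q'))"
      proof -
        have "(a - 1) * real q' \<le> (a - 1) * (real l + 1)"
          using assms q'l by (intro mult_left_mono) (auto simp: a_def)
        then show ?thesis by (intro powr_mono) auto
      qed
      also have "real l * (m * p) + (a - 1) * (real l + 1) - (real q - real q') = l * \<gamma> + (a - 1) + (- real (q - q'))"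
        using q'l by (simp add: \<gamma> algebra_simps of_nat_diff)
      also have "2 powr \<dots> = 2 powr (l * \<gamma>) * (2 powr (a - 1) * (1/2) ^ (q - q'))"
        by (simp only: powr_add half mult.assoc)
      also have "\<dots> \<le> 2 powr (l * \<gamma>) * (2 powr (a - 1) * ((if q \<le> l then 1 else 0) + 2 * (1/2) ^ nat_dist l q))"
      proof (intro mult_left_mono)
        show "(1/2::real) ^ (q - q') \<le> (if q \<le> l then 1 else 0) + 2 * (1/2) ^ nat_dist l q"
        proof (cases "q \<le> l")
          case True
          have "(1/2::real) ^ (q - q') \<le> 1" by (simp add: power_le_one)
          moreover have "0 \<le> (1/2::real) ^ nat_dist l q" by simp
          ultimately show ?thesis using True by (simp only: if_True)
        next
          case False
          have "nat_dist l q \<le> Suc (q - q')"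
            using False q by (auto simp: nat_dist_def q'_def l_def min_def split: if_splits)
          then have "(1/2::real) ^ Suc (q - q') \<le> (1/2) ^ nat_dist l q" by (intro power_decreasing) auto
          then show ?thesis using False by simp
        qed
      qed auto
      finally show ?thesis .
    qed
    \<comment> \<open>the second summand: \<open>\<gamma> \<ge> 1\<close> gives geometric decay in \<open>l + 1 - q\'\<close>\<close>
    have y: "(1/2) ^ q * y powr p \<le> 2 powr (l * \<gamma>) * ((real l + 1) powr p * 2 powr \<gamma> * (1/2) ^ nat_dist (Suc l) q)"
    proof -
      have "(1/2) ^ q * y powr p = (real l + 1) powr p * 2 powr (p * ((\<alpha> + m) * real q') - q)"
      proof -
        have "y powr p = (real l + 1) powr p * 2 powr (p * ((\<alpha> + m) * real q'))"
          unfolding y_def by (subst powr_mult) (auto simp: powr_powr mult.commute)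
        moreover have "2 powr (p * ((\<alpha> + m) * real q') - q) = 2 powr (p * ((\<alpha> + m) * real q')) * (1/2) ^ q"
          unfolding half by (simp flip: powr_add)
        ultimately show ?thesis by simp
      qed
      also have "p * ((\<alpha> + m) * real q') - q = \<gamma> * (real l + 1) - \<gamma> * (real (Suc l) - real q') - (real q - real q')"
        by (simp add: \<gamma>_def algebra_simps)
      also have "(real l + 1) powr p * 2 powr \<dots> \<le> (real l + 1) powr p * 2 powr (l * \<gamma> + \<gamma> + (- real (nat_dist (Suc l) q)))"
      proof (intro mult_left_mono powr_mono)
        have "1 * (real (Suc l) - real q') \<le> \<gamma> * (real (Suc l) - real q')"
          using \<gamma>(1) q'l by (intro mult_right_mono) auto
        moreover have "real (nat_dist (Suc l) q) \<le> (real (Suc l) - real q') + (real q - real q')"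
          using q by (auto simp: nat_dist_def q'_def l_def min_def split: if_splits)
        ultimately show "\<gamma> * (real l + 1) - \<gamma> * (real (Suc l) - real q') - (real q - real q')
          \<le> l * \<gamma> + \<gamma> + (- real (nat_dist (Suc l) q))"
          by (simp add: algebra_simps)
      qed auto
      also have "2 powr (l * \<gamma> + \<gamma> + (- real (nat_dist (Suc l) q))) = 2 powr (l * \<gamma>) * 2 powr \<gamma> * (1/2) ^ nat_dist (Suc l) q"
        by (simp only: powr_add half)
      finally show ?thesis by (simp add: mult_ac)
    qed
    have "(1/2) ^ q * dyadic_bound \<alpha> m i q k powr p \<le> (1/2) ^ q * (2 powr p * (x powr p + y powr p))"
      by (intro mult_left_mono 1) auto
    also have "\<dots> = 2 powr p * ((1/2) ^ q * x powr p + (1/2) ^ q * y powr p)" by (simp add: algebra_simps)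
    also have "\<dots> \<le> 2 powr p * (2 powr (l * \<gamma>) * (2 powr (a - 1) * ((if q \<le> l then 1 else 0) + 2 * (1/2) ^ nat_dist l q))
        + 2 powr (l * \<gamma>) * ((real l + 1) powr p * 2 powr \<gamma> * (1/2) ^ nat_dist (Suc l) q))"
      by (intro mult_left_mono add_mono x y) auto
    finally show ?thesis by (simp only: distrib_left mult.assoc)
  qed
  have "(\<Sum>q\<le>Suc i. (1/2) ^ q * dyadic_bound \<alpha> m i q k powr p)
    \<le> (\<Sum>q\<le>Suc i. 2 powr p * (2 powr (l * \<gamma>)) *
        (2 powr (a - 1) * ((if q \<le> l then 1 else 0) + 2 * (1/2) ^ nat_dist l q)
         + (real l + 1) powr p * 2 powr \<gamma> * (1/2) ^ nat_dist (Suc l) q))"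
    by (intro sum_mono summand) simp
  also have "\<dots> = 2 powr p * (2 powr (l * \<gamma>)) *
        (2 powr (a - 1) * ((\<Sum>q\<le>Suc i. if q \<le> l then 1 else 0) + 2 * (\<Sum>q\<le>Suc i. (1/2) ^ nat_dist l q))
         + (real l + 1) powr p * 2 powr \<gamma> * (\<Sum>q\<le>Suc i. (1/2) ^ nat_dist (Suc l) q))"
    by (simp only: sum.distrib flip: sum_distrib_left)
  also have "\<dots> \<le> 2 powr p * (2 powr (l * \<gamma>)) *
        (2 powr (a - 1) * ((real l + 1) + 2 * 4) + (real l + 1) powr p * 2 powr \<gamma> * 4)"
  proof (intro mult_left_mono add_mono)
    have "(\<Sum>q\<le>Suc i. if q \<le> l then 1 else 0 :: real) = (\<Sum>q\<in>{q\<in>{..Suc i}. q \<le> l}. 1)"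
      by (rule sum.inter_filter[symmetric]) simp
    also have "\<dots> \<le> real (card {..l})"
      by (simp only: sum_constant mult_1_right of_nat_le_iff) (intro card_mono, auto)
    finally show "(\<Sum>q\<le>Suc i. if q \<le> l then 1 else 0 :: real) \<le> real l + 1" by simp
    have "(\<Sum>q\<le>Suc i. (1/2::real) ^ nat_dist l' q) \<le> 2 / (1 - 1/2)" for l'
      by (rule sum_geometric_nat_dist_le) auto
    then show "(\<Sum>q\<le>Suc i. (1/2::real) ^ nat_dist l q) \<le> 4"
      "(\<Sum>q\<le>Suc i. (1/2::real) ^ nat_dist (Suc l) q) \<le> 4" by simp_all
  qed auto
  also have "\<dots> \<le> 2 powr p * (2 powr (l * \<gamma>)) *
        (2 powr (a - 1) * (9 * (real l + 1) powr p) + (real l + 1) powr p * 2 powr \<gamma> * 4)"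
  proof (intro mult_left_mono add_mono order_refl)
    have "(real l + 1) powr 1 \<le> (real l + 1) powr p" using assms by (intro powr_mono) auto
    moreover have "real l + 1 + 2 * 4 \<le> 9 * (real l + 1)" by simp
    ultimately show "real l + 1 + 2 * 4 \<le> 9 * (real l + 1) powr p" by simp
  qed auto
  also have "\<dots> = 2 powr p * (9 * 2 powr (a - 1) + 4 * 2 powr \<gamma>) * ((real l + 1) powr p * 2 powr (l * \<gamma>))"
    by (simp add: algebra_simps)
  finally show ?thesis unfolding l_def a_def \<gamma>_def .
qed

section \<open>Dyadic cells of the disk and layers of the interval\<close>

text \<open>
  The cells are not disjoint: for the upper estimates it only matters that they cover the disk and have
  small area. The factor \<open>2\<close> makes \<open>q = 0\<close> reach all of the disk.
\<close>

definition disk_cell :: "nat \<Rightarrow> nat \<Rightarrow> complex set" where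
  "disk_cell i q = {z. cmod z < 1 \<and> 1 - cmod z \<le> (1/2) ^ i \<and> cmod (1 - z) \<le> 2 * (1/2) ^ q}"

lemma sets_disk_area: "sets disk_area = sets (restrict_space borel unit_disk)"
  by (simp add: disk_area_def cong: sets_restrict_space_cong)

lemma space_disk_area: "space disk_area = unit_disk"
  using sets_eq_imp_space_eq[OF sets_disk_area] by (simp add: space_restrict_space)

lemma borel_measurable_disk_area:
  "f \<in> borel_measurable borel \<Longrightarrow> f \<in> borel_measurable disk_area"
  using measurable_restrict_space1[of f borel borel unit_disk] measurable_cong_sets[OF sets_disk_area refl] by blast

lemma emeasure_disk_area:
  assumes "A \<in> sets borel" "A \<subseteq> unit_disk"
  shows "A \<in> sets disk_area" "emeasure disk_area A = ennreal (1 / pi) * emeasure lborel A"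
proof -
  show "A \<in> sets disk_area"
    using assms by (auto simp: sets_disk_area sets_restrict_space)
  show "emeasure disk_area A = ennreal (1 / pi) * emeasure lborel A"
    using assms by (simp add: disk_area_def emeasure_restrict_space)
qed

lemma disk_cell_area_le:
  "disk_cell i q \<in> sets disk_area"
  "emeasure disk_area (disk_cell i q) \<le> ennreal (40 * (1/2) ^ i * (1/2) ^ q)"
proof -
  have pos: "0 < (1/2::real) ^ i" "(1/2::real) ^ i \<le> 1" "0 < 2 * (1/2::real) ^ q"
    by (auto simp: power_le_one)
  note area = cell_area_le[OF pos, folded disk_cell_def]
  have sub: "disk_cell i q \<subseteq> unit_disk" by (auto simp: disk_cell_def)
  show "disk_cell i q \<in> sets disk_area" by (rule emeasure_disk_area[OF area(1) sub])
  have "emeasure disk_area (disk_cell i q) = ennreal (1 / pi) * emeasure lborel (disk_cell i q)"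
    by (rule emeasure_disk_area[OF area(1) sub])
  also have "\<dots> \<le> ennreal (1 / pi) * ennreal (20 * pi * (1/2) ^ i * (2 * (1/2) ^ q))"
    by (intro mult_left_mono area) auto
  also have "\<dots> = ennreal (40 * (1/2) ^ i * (1/2) ^ q)"
    by (simp flip: ennreal_mult)
  finally show "emeasure disk_area (disk_cell i q) \<le> ennreal (40 * (1/2) ^ i * (1/2) ^ q)" .
qed

text \<open>
  The bound \<open>q \<le> Suc i\<close> reflects \<open>1 - \<bar>z\<bar> \<le> \<bar>1 - z\<bar>\<close>.
\<close>

lemma disk_cell_exists:
  assumes z: "cmod z < 1"
  obtains i q where "(1/2) ^ Suc i < 1 - cmod z" "(1/2) ^ q < cmod (1 - z)" "z \<in> disk_cell i q" "q \<le> Suc i"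
proof -
  have d: "1 - cmod z \<le> cmod (1 - z)" using norm_triangle_ineq2[of 1 z] by simp
  have d2: "cmod (1 - z) \<le> 2" using norm_triangle_ineq4[of 1 z] z by simp
  obtain i where i: "(1/2) ^ Suc i < 1 - cmod z" "1 - cmod z \<le> (1/2) ^ i"
    using dyadic_index_exists[of "1 - cmod z"] z by auto
  have "0 < cmod (1 - z) / 2" "cmod (1 - z) / 2 \<le> 1" using d d2 z by linarith+
  then obtain q where q: "(1/2) ^ Suc q < cmod (1 - z) / 2" "cmod (1 - z) / 2 \<le> (1/2) ^ q"
    using dyadic_index_exists[of "cmod (1 - z) / 2"] by blast
  have "q \<le> Suc i"
  proof (rule ccontr)
    assume "\<not> q \<le> Suc i"
    then have "(1/2::real) ^ q \<le> (1/2) ^ Suc (Suc i)" by (intro power_decreasing) auto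
    then show False using i q d by simp
  qed
  then show ?thesis using that[of i q] i q z by (auto simp: disk_cell_def)
qed

lemma half_power_powr: "(1/2::real) ^ n = 2 powr (- real n)"
  by (simp add: powr_minus powr_realpow power_one_over inverse_eq_divide)

lemma bloch_kernel_dyadic_le:
  assumes \<alpha>: "0 < \<alpha>" and w: "cmod w < 1"
    and l: "(1/2) ^ Suc l \<le> 1 - cmod w" and r: "(1/2) ^ Suc r \<le> cmod (1 - w)"
  shows "bloch_kernel \<alpha> m w \<le> 2 powr (\<alpha> + m + 1) *
     (2 powr (m * real l + \<alpha> * real r) + (real l + 1) * 2 powr ((\<alpha> + m) * real r))"
proof -
  have dpow: "cmod (1 - w) powr (- \<beta>) \<le> 2 powr (\<beta> * (real r + 1))" if "0 < \<beta>" for \<beta>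
  proof -
    have "cmod (1 - w) powr (- \<beta>) \<le> ((1/2) ^ Suc r) powr (- \<beta>)"
      using r that by (intro powr_mono2') auto
    also have "\<dots> = 2 powr (\<beta> * (real r + 1))"
      unfolding half_power_powr powr_powr by (simp add: algebra_simps)
    finally show ?thesis .
  qed
  have "1 / (1 - cmod w) ^ m \<le> 1 / ((1/2) ^ Suc l) ^ m"
    using l w by (intro divide_left_mono power_mono mult_pos_pos zero_less_power) auto
  also have "\<dots> = 2 powr (m * (real l + 1))"
  proof -
    have "((1/2::real) ^ Suc l) ^ m = (1/2) ^ (Suc l * m)" by (rule power_mult[symmetric])
    also have "\<dots> = 2 powr (- (m * (real l + 1)))"
      unfolding half_power_powr by (simp add: algebra_simps)
    finally show ?thesis by (simp add: powr_minus_divide)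
  qed
  finally have rpow: "1 / (1 - cmod w) ^ m \<le> 2 powr (m * (real l + 1))" .
  have "(real l + 1) * ln 2 \<le> (real l + 1) * 1"
    using ln_2_less_1 by (intro mult_left_mono) auto
  then have "- (real l + 1) \<le> - ((real l + 1) * ln 2)"
    by (simp only: mult_1_right neg_le_iff_le)
  also have "\<dots> = ln ((1/2) ^ Suc l)"
    by (subst ln_realpow) (auto simp: ln_div algebra_simps)
  also have "\<dots> \<le> ln (1 - cmod w)"
    using l w by (subst ln_le_cancel_iff) auto
  finally have "- (real l + 1) \<le> ln (1 - cmod w)" .
  then have lnb: "1 - ln (1 - cmod w) \<le> 2 * (real l + 1)" by simp
  have "bloch_kernel \<alpha> m w \<le> 2 powr (m * (real l + 1)) * 2 powr (\<alpha> * (real r + 1))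
      + 2 * (real l + 1) * 2 powr ((\<alpha> + m) * (real r + 1))"
  proof -
    have "cmod (1 - w) powr (- \<alpha>) / (1 - cmod w) ^ m = 1 / (1 - cmod w) ^ m * cmod (1 - w) powr (- \<alpha>)" by simp
    also have "\<dots> \<le> 2 powr (m * (real l + 1)) * 2 powr (\<alpha> * (real r + 1))"
      using w by (intro mult_mono rpow dpow \<alpha>) auto
    finally have 1: "cmod (1 - w) powr (- \<alpha>) / (1 - cmod w) ^ m \<le> 2 powr (m * (real l + 1)) * 2 powr (\<alpha> * (real r + 1))" .
    have "(1 - ln (1 - cmod w)) * cmod (1 - w) powr (- (\<alpha> + m)) \<le> 2 * (real l + 1) * 2 powr ((\<alpha> + m) * (real r + 1))"
      using \<alpha> by (intro mult_mono lnb dpow) auto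
    with 1 show ?thesis unfolding bloch_kernel_def by linarith
  qed
  also have "2 powr (m * (real l + 1)) * 2 powr (\<alpha> * (real r + 1)) = 2 powr (\<alpha> + m) * 2 powr (m * real l + \<alpha> * real r)"
    by (simp add: algebra_simps flip: powr_add)
  also have "2 * (real l + 1) * 2 powr ((\<alpha> + m) * (real r + 1)) = 2 powr (\<alpha> + m + 1) * ((real l + 1) * 2 powr ((\<alpha> + m) * real r))"
  proof -
    have "2 powr ((\<alpha> + m) * (real r + 1)) = 2 powr (\<alpha> + m) * 2 powr ((\<alpha> + m) * real r)"
      by (simp add: algebra_simps flip: powr_add)
    moreover have "2 powr (\<alpha> + m + 1) = 2 * 2 powr (\<alpha> + m)" by (simp add: powr_add)
    ultimately show ?thesis by simp
  qed
  also have "2 powr (\<alpha> + m) * 2 powr (m * real l + \<alpha> * real r) \<le> 2 powr (\<alpha> + m + 1) * 2 powr (m * real l + \<alpha> * real r)"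
    by (intro mult_right_mono powr_mono) auto
  finally show ?thesis by (simp add: distrib_left)
qed

context unit_interval_measure
begin

definition layer :: "nat \<Rightarrow> real set" where
  "layer k = {t \<in> space \<mu>. (1/2) ^ Suc k < 1 - t \<and> 1 - t \<le> (1/2) ^ k}"

lemma layer_measurable: "layer k \<in> sets \<mu>"
proof -
  have "layer k = {1 - (1/2) ^ k..<1 - (1/2) ^ Suc k} \<inter> {0..<1}"
    by (auto simp: layer_def space_eq)
  then show ?thesis by (auto simp: sets_eq sets_restrict_space)
qed

lemma power_layer_ge:
  assumes "t \<in> layer k"
  shows "exp (-1) \<le> t ^ (2 ^ k - 1)"
proof (cases "k = 0")
  case False
  define n :: nat where "n = 2 ^ k - 1"
  have n: "0 < n" "real n = 2 ^ k - 1"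
    using False one_less_power[of "2::nat" k] by (auto simp: n_def of_nat_diff)
  have "1 + 1 / real n \<le> exp (1 / real n)" by (rule exp_ge_add_one_self)
  then have "inverse (exp (1 / real n)) \<le> inverse (1 + 1 / real n)"
    using n by (intro le_imp_inverse_le) (auto intro: add_pos_nonneg)
  also have "inverse (1 + 1 / real n) = 1 - (1/2) ^ k"
    using n by (simp add: field_simps power_one_over)
  also have "\<dots> \<le> t" using assms by (simp add: layer_def)
  finally have "exp (- (1 / real n)) \<le> t" by (simp add: exp_minus)
  then have "exp (- (1 / real n)) ^ n \<le> t ^ n" by (intro power_mono) auto
  also have "exp (- (1 / real n)) ^ n = exp (-1)" using n by (simp flip: exp_of_nat_mult)
  finally show ?thesis by (simp add: n_def)
qed simp

text \<open>
  On the layer the integrand \<open>t ^ (2 ^ k - 1)\<close> of the moment is at least \<open>1 / e\<close>. The exponent \<open>2 ^ k - 1\<close> rather than \<open>2 ^ k\<close>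
  makes the estimate hold for \<open>k = 0\<close>, where \<open>t\<close> may vanish.
\<close>

lemma layer_measure_le: "measure \<mu> (layer k) \<le> exp 1 * moment \<mu> (2 ^ k - 1)"
proof -
  have "(\<integral>t. exp (-1) * indicator (layer k) t \<partial>\<mu>) \<le> moment \<mu> (2 ^ k - 1)"
    unfolding moment_def
  proof (rule integral_mono[OF _ moment_integrable])
    have "integrable \<mu> (indicator (layer k) :: real \<Rightarrow> real)"
      using layer_measurable by (intro integrable_real_indicator) (simp_all add: less_top[symmetric])
    then show "integrable \<mu> (\<lambda>t. exp (-1 :: real) * indicator (layer k) t)" by simp
    show "exp (-1) * indicator (layer k) t \<le> t ^ (2 ^ k - 1)" if "t \<in> space \<mu>" for t
      using power_layer_ge[of t k] that by (cases "t \<in> layer k") (auto simp: space_eq)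
  qed
  then have "exp (-1) * measure \<mu> (layer k) \<le> moment \<mu> (2 ^ k - 1)"
    using layer_measurable sets.sets_into_space[OF layer_measurable] by (simp add: Int_absorb2)
  then have "exp 1 * (exp (-1) * measure \<mu> (layer k)) \<le> exp 1 * moment \<mu> (2 ^ k - 1)"
    by (intro mult_left_mono) auto
  moreover have "exp 1 * (exp (-1) * measure \<mu> (layer k)) = measure \<mu> (layer k)"
    by (simp add: exp_minus)
  ultimately show ?thesis by simp
qed

text \<open>
  For \<open>t\<close> in the layer \<open>k\<close> both \<open>1 - t\<close> and \<open>1 - \<bar>z\<bar>\<close> are at most \<open>1 - t \<bar>z\<bar>\<close>, and \<open>\<bar>1 - z\<bar> \<le> \<bar>1 - t z\<bar> + (1 - t) \<le> 2 \<bar>1 - t z\<bar>\<close>.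
  So the kernel is controlled by \<open>dyadic_bound\<close> on each layer, and it remains to sum over the layers.
\<close>

lemma norm_deriv_cesaro_le_dyadic:
  assumes f: "bloch_bounded L f" and \<alpha>: "0 < \<alpha>" and m: "m \<in> {1, 2}" and z: "cmod z < 1"
    and i: "(1/2) ^ Suc i < 1 - cmod z" and q: "(1/2) ^ q < cmod (1 - z)"
  shows "ennreal (cmod ((deriv ^^ m) (cesaro \<mu> \<alpha> f) z))
    \<le> (\<Sum>k. ennreal ((2 + \<alpha>)\<^sup>2 * 2 powr (\<alpha> + m + 1) * exp 1 * L * (dyadic_bound \<alpha> m i q k * moment \<mu> (2 ^ k - 1))))"
proof -
  have L: "0 \<le> L" using f by (rule bloch_bounded_nonneg)
  have hol: "f holomorphic_on unit_disk" using f by (simp add: bloch_bounded_def)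
  define C where "C = (2 + \<alpha>)\<^sup>2 * L * 2 powr (\<alpha> + m + 1)"
  have C: "0 \<le> C" using L by (simp add: C_def)
  define F where "F t = of_real (t ^ m) * (deriv ^^ m) (cesaro_integrand \<alpha> f) (of_real t * z)" for t
  have pt: "ennreal (norm (F t)) \<le> (\<Sum>k. ennreal (C * dyadic_bound \<alpha> m i q k) * indicator (layer k) t)"
    if t: "t \<in> space \<mu>" for t
  proof -
    have t': "0 \<le> t" "t < 1" using t by (auto simp: space_eq)
    obtain k where k: "(1/2) ^ Suc k < 1 - t" "1 - t \<le> (1/2) ^ k"
      using dyadic_index_exists[of "1 - t"] t' by auto
    define w where "w = of_real t * z"
    have w: "cmod w < 1" unfolding w_def using t z by (rule scaled_in_disk)
    have cw: "cmod w = t * cmod z" using t' by (simp add: w_def norm_mult)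
    have "cmod w \<le> 1 * cmod z" "cmod w \<le> t * 1"
      unfolding cw using t' z mult_right_mono[of t 1 "cmod z"] mult_left_mono[of "cmod z" 1 t] by auto
    then have l: "(1/2) ^ Suc (min k i) \<le> 1 - cmod w"
      using k i by (auto simp: min_def)
    have "1 - t \<le> cmod (1 - w)"
      using norm_triangle_ineq2[of 1 w] \<open>cmod w \<le> t * 1\<close> by simp
    moreover have "cmod (1 - z) \<le> cmod (1 - w) + (1 - t)"
    proof -
      have "cmod (w - z) = (1 - t) * cmod z"
      proof -
        have "w - z = of_real (t - 1) * z" by (simp add: w_def algebra_simps)
        then show ?thesis using t' by (simp only: norm_mult norm_of_real) simp
      qed
      also have "\<dots> \<le> (1 - t) * 1" using t' z by (intro mult_left_mono) auto
      finally show ?thesis using norm_triangle_ineq[of "1 - w" "w - z"] by simp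
    qed
    ultimately have r: "(1/2) ^ Suc (min k q) \<le> cmod (1 - w)"
      using k q by (auto simp: min_def)
    have "norm (F t) \<le> 1 * cmod ((deriv ^^ m) (cesaro_integrand \<alpha> f) w)"
      unfolding F_def norm_mult w_def using t' by (intro mult_right_mono) (auto simp: power_le_one norm_power)
    also have "\<dots> \<le> (2 + \<alpha>)\<^sup>2 * L * bloch_kernel \<alpha> m w"
      using norm_deriv_cesaro_integrand_le[OF f w \<alpha> m] by simp
    also have "\<dots> \<le> (2 + \<alpha>)\<^sup>2 * L * (2 powr (\<alpha> + m + 1) *
     (2 powr (m * real (min k i) + \<alpha> * real (min k q)) + (real (min k i) + 1) * 2 powr ((\<alpha> + m) * real (min k q))))"
      using L by (intro mult_left_mono bloch_kernel_dyadic_le \<alpha> w l r) auto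
    also have "\<dots> = C * dyadic_bound \<alpha> m i q k"
      by (simp add: C_def dyadic_bound_def)
    finally have "ennreal (norm (F t)) \<le> ennreal (C * dyadic_bound \<alpha> m i q k) * indicator (layer k) t"
      using t k by (simp add: layer_def ennreal_leI)
    moreover have "g k \<le> (\<Sum>k. g k)" for g :: "nat \<Rightarrow> ennreal"
      using sum_le_suminf[of g "{k}"] by simp
    ultimately show ?thesis by (rule order_trans)
  qed
  have "ennreal (cmod ((deriv ^^ m) (cesaro \<mu> \<alpha> f) z)) = ennreal (norm (\<integral>t. F t \<partial>\<mu>))"
    unfolding F_def higher_deriv_cesaro(1)[OF hol \<alpha> z] ..
  also have "\<dots> \<le> (\<integral>\<^sup>+t. ennreal (norm (F t)) \<partial>\<mu>)"
    using higher_deriv_cesaro(2)[OF hol \<alpha> z, of m] by (intro integral_norm_bound_ennreal) (simp add: F_def)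
  also have "\<dots> \<le> (\<integral>\<^sup>+t. (\<Sum>k. ennreal (C * dyadic_bound \<alpha> m i q k) * indicator (layer k) t) \<partial>\<mu>)"
    by (intro nn_integral_mono pt)
  also have "\<dots> = (\<Sum>k. \<integral>\<^sup>+t. ennreal (C * dyadic_bound \<alpha> m i q k) * indicator (layer k) t \<partial>\<mu>)"
    using layer_measurable by (intro nn_integral_suminf) auto
  also have "\<dots> = (\<Sum>k. ennreal (C * dyadic_bound \<alpha> m i q k * measure \<mu> (layer k)))"
  proof -
    have "0 \<le> C * dyadic_bound \<alpha> m i q k" for k
      using C dyadic_bound_pos[of \<alpha> m i q k] by simp
    then show ?thesis
      using layer_measurable by (simp add: nn_integral_cmult emeasure_eq_measure ennreal_mult)
  qed
  also have "\<dots> \<le> (\<Sum>k. ennreal ((2 + \<alpha>)\<^sup>2 * 2 powr (\<alpha> + m + 1) * exp 1 * L * (dyadic_bound \<alpha> m i q k * moment \<mu> (2 ^ k - 1))))"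
  proof (intro suminf_le ennreal_leI)
    fix k
    have "C * dyadic_bound \<alpha> m i q k * measure \<mu> (layer k) \<le> C * dyadic_bound \<alpha> m i q k * (exp 1 * moment \<mu> (2 ^ k - 1))"
      using C dyadic_bound_pos[of \<alpha> m i q k] by (intro mult_left_mono layer_measure_le) auto
    then show "C * dyadic_bound \<alpha> m i q k * measure \<mu> (layer k) \<le> (2 + \<alpha>)\<^sup>2 * 2 powr (\<alpha> + m + 1) * exp 1 * L * (dyadic_bound \<alpha> m i q k * moment \<mu> (2 ^ k - 1))"
      by (simp add: C_def mult_ac)
  qed auto
  finally show ?thesis .
qed

end

section \<open>A common majorant of the Besov densities\<close>

text \<open>
  Both Besov integrals are instances of one formula: with \<open>besov_order p\<close> derivatives the weight
  is \<open>(1 - \<bar>z\<bar>) powr (m * p - 2)\<close>, and \<open>m * p > 1\<close> always holds.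
\<close>

definition besov_order :: "real \<Rightarrow> nat" where
  "besov_order p = (if p = 1 then 2 else 1)"

definition besov_density :: "real \<Rightarrow> (complex \<Rightarrow> complex) \<Rightarrow> complex \<Rightarrow> real" where
  "besov_density p f z =
     cmod ((deriv ^^ besov_order p) f z) powr p * (1 - cmod z) powr (real (besov_order p) * p - 2)"

lemma besov_integral_eq:
  "besov_integral p f = (\<integral>\<^sup>+z. ennreal (besov_density p f z) \<partial>disk_area)"
  unfolding besov_integral_def
  by (auto simp: besov_density_def besov_order_def space_disk_area numeral_2_eq_2 intro!: nn_integral_cong)

context unit_interval_measure
begin

definition dyadic_moment :: "real \<Rightarrow> nat \<Rightarrow> real" where
  "dyadic_moment \<alpha> k = (real k + 1) * 2 powr (\<alpha> * k) * moment \<mu> (2 ^ k - 1)"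

lemma dyadic_moment_nonneg: "0 \<le> dyadic_moment \<alpha> k"
  by (simp add: dyadic_moment_def moment_nonneg)

text \<open>
  On a cell, the sum over the layers is raised to the power \<open>p\<close> with the weights \<open>x ^ \<bar>i - k\<bar>\<close>. After summation over \<open>q\<close>, the
  contribution of the layer \<open>k\<close> at distance \<open>2 powr (- i)\<close> from the circle is the dyadic moment to the power \<open>p\<close> times
  \<open>2 powr (- (i - k) (m p - 1))\<close> if \<open>k \<le> i\<close>, and times \<open>2 powr (- (k - i) \<alpha> p)\<close> if \<open>k > i\<close>. Both factors
  are at most \<open>2 powr (- c \<bar>i - k\<bar>)\<close>; half of this decay pays for the weights, and the other half makes the sum over
  \<open>i\<close> converge.
\<close>

theorem cesaro_besov_density_dominated:
  assumes \<alpha>: "0 < \<alpha>" and p: "1 \<le> p" "1 \<le> \<alpha> * p"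
    and sum: "summable (\<lambda>k. dyadic_moment \<alpha> k powr p)"
  obtains D :: "complex \<Rightarrow> ennreal" where "D \<in> borel_measurable disk_area"
    and "(\<integral>\<^sup>+z. D z \<partial>disk_area) < \<infinity>"
    and "\<And>f L z. \<lbrakk>bloch_bounded L f; cmod z < 1\<rbrakk> \<Longrightarrow>
      ennreal (besov_density p (cesaro \<mu> \<alpha> f) z) \<le> ennreal (L powr p) * D z"
proof -
  define m where "m = besov_order p"
  have m: "m \<in> {1, 2}" "1 \<le> m" "1 < m * p" using p by (auto simp: m_def besov_order_def)
  let ?v = "\<lambda>i. 2 powr (- real i * (m * p - 2))"
  let ?b = "dyadic_bound \<alpha> m"
  define c where "c = min (m * p - 1) (\<alpha> * p)"
  have c: "0 < c" "c \<le> m * p - 1" "c \<le> \<alpha> * p" using m p \<alpha> by (auto simp: c_def)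
  define x where "x = 2 powr (- c / (2 * p))"
  have x: "0 < x" "x < 1" "x powr p = 2 powr (- c / 2)"
    using c p by (auto simp: x_def powr_powr powr_less_one)
  define y where "y = 2 powr (- c / 2)"
  have y: "0 < y" "y < 1" using c by (auto simp: y_def powr_less_one)
  define W where "W = 2 / (1 - x)"
  define C where "C = (2 + \<alpha>)\<^sup>2 * 2 powr (\<alpha> + m + 1) * exp 1"
  have C: "0 \<le> C" by (simp add: C_def)
  define M where "M k = moment \<mu> (2 ^ k - 1)" for k
  have M: "0 \<le> M k" for k by (simp add: M_def moment_nonneg)
  let ?B = "\<lambda>i q k. ?b i q k * M k / x ^ nat_dist i k"
  define cf where "cf i q k = 4 * (W powr p * C powr p) * ?v i *
      (?B i q k) powr p" for i q k
  have cf: "0 \<le> cf i q k" for i q k by (simp add: cf_def)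
  let ?c = "\<lambda>i q k z. ennreal (cf i q k) * indicator (disk_cell i q) z"
  define D where "D z = (\<Sum>k. \<Sum>i. \<Sum>q\<le>Suc i. ?c i q k z)" for z
  have cell_meas [measurable]: "disk_cell i q \<in> sets disk_area" for i q
    by (rule disk_cell_area_le)
  show ?thesis
  proof (rule that[of D])
    show D_meas: "D \<in> borel_measurable disk_area"
      unfolding D_def by measurable
    fix f L z assume f: "bloch_bounded L f" and z: "cmod z < 1"
    have L: "0 \<le> L" using f by (rule bloch_bounded_nonneg)
    obtain i q where iq: "(1/2) ^ Suc i < 1 - cmod z" "(1/2) ^ q < cmod (1 - z)" "z \<in> disk_cell i q" "q \<le> Suc i"
      using disk_cell_exists[OF z] .
      let ?a = "\<lambda>k. (C * L * (?b i q k * M k) / x ^ nat_dist i k) powr p"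
    define g where "g = cmod ((deriv ^^ m) (cesaro \<mu> \<alpha> f) z)"
    have le: "ennreal g \<le> (\<Sum>k. ennreal (C * L * (?b i q k * M k)))"
      using norm_deriv_cesaro_le_dyadic[OF f \<alpha> m(1) z iq(1,2)] by (simp add: g_def C_def M_def)
    have "ennreal (g powr p) \<le> ennreal (W powr p) * (\<Sum>k. ennreal (?a k))"
      using geometric_nat_dist[OF x(1,2), of i] C L M less_imp_le[OF dyadic_bound_pos[of \<alpha> m i q]] x le p
      by (intro powr_le_weighted_suminf) (auto simp: W_def g_def)
    moreover have weight: "(1 - cmod z) powr (m * p - 2) \<le> 4 * ?v i"
    proof (cases "0 \<le> m * p - 2")
      case True
      have "(1 - cmod z) powr (m * p - 2) \<le> ((1/2) ^ i) powr (m * p - 2)"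
        using True z iq(3) by (intro powr_mono2) (auto simp: disk_cell_def)
      also have "\<dots> = ?v i" unfolding half_power_powr by (simp add: powr_powr)
      finally show ?thesis by (smt (verit) powr_ge_zero)
    next
      case False
      have "(1 - cmod z) powr (m * p - 2) \<le> ((1/2) ^ Suc i) powr (m * p - 2)"
        using False z iq(1) by (intro powr_mono2') auto
      also have "\<dots> = ?v i * 2 powr (- (m * p - 2))"
        unfolding half_power_powr powr_powr by (simp add: algebra_simps flip: powr_add)
      also have "\<dots> \<le> ?v i * 2 powr 2"
        using m by (intro mult_left_mono powr_mono) auto
      finally show ?thesis by simp
    qed
    ultimately have "ennreal (g powr p * (1 - cmod z) powr (m * p - 2))
       \<le> ennreal (W powr p) * (\<Sum>k. ennreal (?a k))
         * ennreal (4 * ?v i)"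
      by (subst ennreal_mult) (auto intro!: mult_mono ennreal_leI)
    also have "\<dots> = (\<Sum>k. ennreal (W powr p) * ennreal (?a k)
         * ennreal (4 * ?v i))"
      by (simp only: ennreal_suminf_cmult ennreal_suminf_multc)
    also have "\<dots> = (\<Sum>k. ennreal (L powr p) * ennreal (cf i q k))"
    proof (rule suminf_cong)
      fix k
      have "(?a k)
         = C powr p * L powr p * (?B i q k) powr p"
        using C L M[of k] dyadic_bound_pos[of \<alpha> m i q k] x(1)
        by (simp add: powr_mult powr_divide)
      then show "ennreal (W powr p) * ennreal (?a k)
         * ennreal (4 * ?v i) = ennreal (L powr p) * ennreal (cf i q k)"
        by (simp add: cf_def mult_ac flip: ennreal_mult)
    qed
    also have "\<dots> = ennreal (L powr p) * (\<Sum>k. ennreal (cf i q k))" by simp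
    also have "\<dots> \<le> ennreal (L powr p) * D z"
      unfolding D_def
    proof (intro mult_left_mono suminf_le)
      fix k
      have "ennreal (cf i q k) = ?c i q k z" using iq by simp
      also have "\<dots> \<le> (\<Sum>q\<le>Suc i. ?c i q k z)"
        using iq by (intro member_le_sum) auto
      also have "\<dots> \<le> (\<Sum>i. \<Sum>q\<le>Suc i. ?c i q k z)"
      proof -
        have "g i \<le> (\<Sum>i. g i)" for g :: "nat \<Rightarrow> ennreal"
          using sum_le_suminf[of g "{i}"] by simp
        then show ?thesis .
      qed
      finally show "ennreal (cf i q k) \<le> (\<Sum>i. \<Sum>q\<le>Suc i. ?c i q k z)" .
    qed auto
    finally show "ennreal (besov_density p (cesaro \<mu> \<alpha> f) z) \<le> ennreal (L powr p) * D z"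
      by (simp add: besov_density_def g_def m_def)
  next
    define K where "K = 4 * (W powr p * C powr p) * 40 * (2 powr p * (9 * 2 powr (\<alpha> * p - 1) + 4 * 2 powr ((\<alpha> + m) * p - 1)))"
    have K: "0 \<le> K" by (simp add: K_def)
    let ?k = "\<lambda>k. K * dyadic_moment \<alpha> k powr p"
    have inner: "(\<Sum>q\<le>Suc i. cf i q k * (40 * (1/2) ^ i * (1/2) ^ q)) \<le> ?k k * y ^ nat_dist i k" for i k
    proof -
      define l where "l = min k i"
      have cfe: "cf i q k = 4 * (W powr p * C powr p) * ?v i *
         (?b i q k powr p * M k powr p / y ^ nat_dist i k)" for q
      proof -
        have "(x ^ nat_dist i k) powr p = y ^ nat_dist i k"
        proof -
          have "(x ^ nat_dist i k) powr p = (x powr p) powr real (nat_dist i k)"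
            using x(1) by (simp add: powr_powr mult.commute flip: powr_realpow)
          also have "x powr p = y" by (simp add: x(3) y_def)
          finally show ?thesis using y by (simp add: powr_realpow)
        qed
        then show ?thesis
          using M[of k] dyadic_bound_pos[of \<alpha> m i q k] x by (simp add: cf_def powr_mult powr_divide)
      qed
      have "(\<Sum>q\<le>Suc i. cf i q k * (40 * (1/2) ^ i * (1/2) ^ q))
         = 4 * (W powr p * C powr p) * 40 * (?v i * (1/2) ^ i) * M k powr p / y ^ nat_dist i k
            * (\<Sum>q\<le>Suc i. (1/2) ^ q * ?b i q k powr p)"
        unfolding sum_distrib_left cfe by (intro sum.cong) (auto simp: mult_ac)
      also have "\<dots> \<le> 4 * (W powr p * C powr p) * 40 * (?v i * (1/2) ^ i) * M k powr p / y ^ nat_dist i k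
            * (2 powr p * (9 * 2 powr (\<alpha> * p - 1) + 4 * 2 powr ((\<alpha> + m) * p - 1))
       * ((real (min k i) + 1) powr p * 2 powr (real (min k i) * ((\<alpha> + m) * p - 1))))"
        using y by (intro mult_left_mono sum_dyadic_bound_le \<alpha> p m) auto
      also have "\<dots> = K * ((real l + 1) powr p * M k powr p *
           (?v i * (1/2) ^ i * 2 powr (real l * ((\<alpha> + m) * p - 1)) / y ^ nat_dist i k))"
        by (simp add: K_def l_def mult_ac)
      also have "\<dots> \<le> K * (((real k + 1) powr p * M k powr p) * (2 powr (\<alpha> * k * p) * y ^ nat_dist i k))"
      proof (intro mult_left_mono mult_mono K)
        show "(real l + 1) powr p \<le> (real k + 1) powr p" using p by (intro powr_mono2) (auto simp: l_def)
        have ypow: "y ^ nat_dist i k = 2 powr (- (c / 2) * nat_dist i k)"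
          by (simp add: y_def powr_powr flip: powr_realpow)
        have "?v i * (1/2) ^ i * 2 powr (real l * ((\<alpha> + m) * p - 1)) / y ^ nat_dist i k
           = 2 powr (- real i * (m * p - 2) + (- real i) + real l * ((\<alpha> + m) * p - 1) - (- (c / 2) * nat_dist i k))"
          unfolding ypow half_power_powr by (simp only: powr_add powr_diff)
        also have "\<dots> \<le> 2 powr (\<alpha> * k * p + (- (c / 2) * nat_dist i k))"
        proof (intro powr_mono)
          have "c * nat_dist i k \<le> \<alpha> * k * p + real i * (m * p - 1) - real l * ((\<alpha> + m) * p - 1)"
          proof (cases "k \<le> i")
            case True
            have "c * (real i - real k) \<le> (m * p - 1) * (real i - real k)"
              using True c by (intro mult_right_mono) auto
            with True show ?thesis by (simp add: l_def nat_dist_def of_nat_diff algebra_simps)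
          next
            case False
            have "c * (real k - real i) \<le> (\<alpha> * p) * (real k - real i)"
              using False c by (intro mult_right_mono) auto
            with False show ?thesis by (simp add: l_def nat_dist_def of_nat_diff algebra_simps)
          qed
          then show "- real i * (m * p - 2) + (- real i) + real l * ((\<alpha> + m) * p - 1) - (- (c / 2) * nat_dist i k)
             \<le> \<alpha> * k * p + (- (c / 2) * nat_dist i k)"
            by (simp add: algebra_simps)
        qed simp
        also have "\<dots> = 2 powr (\<alpha> * k * p) * y ^ nat_dist i k" unfolding ypow by (simp only: powr_add)
        finally show "?v i * (1/2) ^ i * 2 powr (real l * ((\<alpha> + m) * p - 1)) / y ^ nat_dist i k
           \<le> 2 powr (\<alpha> * k * p) * y ^ nat_dist i k" .
      qed (use y in auto)
      also have "\<dots> = ?k k * y ^ nat_dist i k"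
        using M[of k] by (simp add: dyadic_moment_def M_def powr_mult powr_powr mult_ac)
      finally show ?thesis .
    qed
    have "(\<integral>\<^sup>+z. D z \<partial>disk_area) = (\<Sum>k. \<integral>\<^sup>+z. (\<Sum>i. \<Sum>q\<le>Suc i. ?c i q k z) \<partial>disk_area)"
      unfolding D_def by (intro nn_integral_suminf) measurable
    also have "\<dots> = (\<Sum>k. \<Sum>i. \<integral>\<^sup>+z. (\<Sum>q\<le>Suc i. ?c i q k z) \<partial>disk_area)"
      by (intro suminf_cong nn_integral_suminf) measurable
    also have "\<dots> = (\<Sum>k. \<Sum>i. \<Sum>q\<le>Suc i. ennreal (cf i q k) * emeasure disk_area (disk_cell i q))"
      by (intro suminf_cong) (subst nn_integral_sum, auto simp: nn_integral_cmult)
    also have "\<dots> \<le> (\<Sum>k. \<Sum>i. \<Sum>q\<le>Suc i. ennreal (cf i q k * (40 * (1/2) ^ i * (1/2) ^ q)))"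
    proof (intro suminf_le sum_mono)
      fix k i q
      have "ennreal (cf i q k) * emeasure disk_area (disk_cell i q) \<le> ennreal (cf i q k) * ennreal (40 * (1/2) ^ i * (1/2) ^ q)"
        by (intro mult_left_mono disk_cell_area_le) auto
      also have "\<dots> = ennreal (cf i q k * (40 * (1/2) ^ i * (1/2) ^ q))"
        using cf by (intro ennreal_mult[symmetric]) auto
      finally show "ennreal (cf i q k) * emeasure disk_area (disk_cell i q) \<le> ennreal (cf i q k * (40 * (1/2) ^ i * (1/2) ^ q))" .
    qed auto
    also have "\<dots> \<le> (\<Sum>k. \<Sum>i. ennreal (?k k * y ^ nat_dist i k))"
      using cf by (intro suminf_le) (auto simp: sum_ennreal simp del: sum.atMost_Suc intro!: ennreal_leI inner)
    also have "\<dots> \<le> (\<Sum>k. ennreal (?k k * (2 / (1 - y))))"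
    proof (intro suminf_le)
      fix k
      have "(\<Sum>i. ennreal (?k k * y ^ nat_dist i k)) = ennreal (\<Sum>i. ?k k * y ^ nat_dist k i)"
        using K y geometric_nat_dist[OF y, of k] by (subst nat_dist_commute) (auto intro!: suminf_ennreal2 summable_mult)
      also have "(\<Sum>i. ?k k * y ^ nat_dist k i) = ?k k * (\<Sum>i. y ^ nat_dist k i)"
        using geometric_nat_dist(1)[OF y] by (rule suminf_mult)
      also have "ennreal \<dots> \<le> ennreal (?k k * (2 / (1 - y)))"
        using K geometric_nat_dist(2)[OF y, of k] by (intro ennreal_leI mult_left_mono) auto
      finally show "(\<Sum>i. ennreal (?k k * y ^ nat_dist i k)) \<le> ennreal (?k k * (2 / (1 - y)))" .
    qed auto
    also have "\<dots> = ennreal (\<Sum>k. ?k k * (2 / (1 - y)))"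
      using K y sum by (intro suminf_ennreal2) (auto intro!: summable_mult summable_mult2)
    also have "\<dots> < \<infinity>" by simp
    finally show "(\<integral>\<^sup>+z. D z \<partial>disk_area) < \<infinity>" .
  qed
qed

end

section \<open>Banach--Steinhaus and the inclusion into the Bloch space\<close>

context banach_subspace
begin

lemma diff_mem:
  assumes "f \<in> X" "g \<in> X"
  shows "(\<lambda>z. f z - g z) \<in> X"
  using add_mem[OF assms(1) scale_mem[OF assms(2), of "-1"]] by simp

lemma norm_diff_commute:
  assumes "f \<in> X" "g \<in> X"
  shows "N (\<lambda>z. f z - g z) = N (\<lambda>z. g z - f z)"
  using norm_scale[OF diff_mem[OF assms], of "-1"] by (simp add: algebra_simps)

lemma norm_triangle_diff:
  assumes "f \<in> X" "g \<in> X" "h \<in> X"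
  shows "N (\<lambda>z. f z - h z) \<le> N (\<lambda>z. f z - g z) + N (\<lambda>z. g z - h z)"
  using norm_triangle[OF diff_mem[OF assms(1,2)] diff_mem[OF assms(2,3)]] by simp

text \<open>
  The Banach--Steinhaus theorem, by Sokal's gliding hump. If the norms \<open>c\<close> of the functionals were unbounded,
  choose functionals with \<open>c > 4 ^ n\<close> and almost extremal vectors \<open>y n\<close> of norm at most \<open>1\<close>, and add \<open>\<plusminus> 3 powr (- n) y n\<close> successively, the sign
  being chosen so that the functional number \<open>n\<close> becomes at least \<open>2 / 3 c 3 powr (- n)\<close>. All later corrections
  change its value by at most \<open>1 / 2 c 3 powr (- n)\<close>, so at the limit it exceeds \<open>(4 / 3) ^ n / 6\<close>.
\<close>

theorem uniform_boundedness:
  fixes \<Lambda> :: "'i \<Rightarrow> (complex \<Rightarrow> complex) \<Rightarrow> complex"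
  assumes add: "\<And>i f g. \<lbrakk>f \<in> X; g \<in> X\<rbrakk> \<Longrightarrow> \<Lambda> i (\<lambda>z. f z + g z) = \<Lambda> i f + \<Lambda> i g"
    and scale: "\<And>i c f. f \<in> X \<Longrightarrow> \<Lambda> i (\<lambda>z. c * f z) = c * \<Lambda> i f"
    and cont: "\<And>i F. \<lbrakk>\<And>n. F n \<in> X; (\<lambda>n. N (F n)) \<longlonglongrightarrow> 0\<rbrakk> \<Longrightarrow> (\<lambda>n. \<Lambda> i (F n)) \<longlonglongrightarrow> 0"
    and bdd: "\<And>f. f \<in> X \<Longrightarrow> \<exists>B. \<forall>i. cmod (\<Lambda> i f) \<le> B"
  shows "\<exists>C. \<forall>i. \<forall>f\<in>X. cmod (\<Lambda> i f) \<le> C * N f"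
proof -
  have diff: "\<Lambda> i (\<lambda>z. f z - g z) = \<Lambda> i f - \<Lambda> i g" if "f \<in> X" "g \<in> X" for i f g
    using add[OF that(1) scale_mem[OF that(2), of "-1"], of i] scale[OF that(2), of i "-1"] by simp
  have single: "\<exists>B. \<forall>f\<in>X. cmod (\<Lambda> i f) \<le> B * N f" for i
  proof (rule ccontr)
    assume neg: "\<nexists>B. \<forall>f\<in>X. cmod (\<Lambda> i f) \<le> B * N f"
    have "\<exists>f\<in>X. real n * N f < cmod (\<Lambda> i f)" for n :: nat
    proof -
      have "\<not> (\<forall>f\<in>X. cmod (\<Lambda> i f) \<le> real n * N f)" using neg by blast
      then show ?thesis by (auto simp: not_le)
    qed
    then obtain f where f: "\<And>n. f n \<in> X" "\<And>n. real n * N (f n) < cmod (\<Lambda> i (f n))" by metis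
    have pos: "0 < cmod (\<Lambda> i (f n))" for n
      using f(2)[of n] mult_nonneg_nonneg[OF of_nat_0_le_iff norm_nonneg[OF f(1)], of n n] by linarith
    define g where "g n = (\<lambda>z. of_real (1 / cmod (\<Lambda> i (f n))) * f n z)" for n
    have g: "g n \<in> X" for n unfolding g_def by (rule scale_mem[OF f(1)])
    have one: "cmod (\<Lambda> i (g n)) = 1" for n
      using pos[of n] unfolding g_def scale[OF f(1)] norm_mult norm_of_real by simp
    have Ng: "N (g n) \<le> inverse (real n)" if "0 < n" for n
    proof -
      have "N (g n) = N (f n) / cmod (\<Lambda> i (f n))"
        unfolding g_def norm_scale[OF f(1)] norm_of_real using pos[of n] by simp
      moreover have "N (f n) / cmod (\<Lambda> i (f n)) \<le> inverse (real n)"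
        using f(2)[of n] pos[of n] that by (simp add: field_simps)
      ultimately show ?thesis by simp
    qed
    have "(\<lambda>n. N (g n)) \<longlonglongrightarrow> 0"
      by (rule tendsto_sandwich[OF _ _ tendsto_const lim_inverse_n])
         (use norm_nonneg[OF g] Ng in \<open>auto simp: eventually_sequentially intro!: exI[of _ 1]\<close>)
    then have "(\<lambda>n. \<Lambda> i (g n)) \<longlonglongrightarrow> 0" using g by (intro cont) auto
    then have "(\<lambda>n. cmod (\<Lambda> i (g n))) \<longlonglongrightarrow> 0" by (rule tendsto_norm_zero)
    then show False by (simp add: one LIMSEQ_const_iff)
  qed
  define U where "U = {f \<in> X. N f \<le> 1}"
  have U0: "(\<lambda>z. 0) \<in> U" using zero_mem norm_eq_0[OF zero_mem] by (simp add: U_def)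
  define c where "c i = (SUP f\<in>U. cmod (\<Lambda> i f))" for i
  have bddU: "bdd_above ((\<lambda>f. cmod (\<Lambda> i f)) ` U)" for i
  proof -
    obtain B where B: "\<And>f. f \<in> X \<Longrightarrow> cmod (\<Lambda> i f) \<le> B * N f" using single by blast
    have "cmod (\<Lambda> i f) \<le> \<bar>B\<bar>" if "f \<in> U" for f
    proof -
      have "cmod (\<Lambda> i f) \<le> B * N f" using B that by (simp add: U_def)
      also have "\<dots> \<le> \<bar>B\<bar> * 1"
        using that norm_nonneg[of f] by (intro mult_mono) (auto simp: U_def)
      finally show ?thesis by simp
    qed
    then show ?thesis by (auto simp: bdd_above_def)
  qed
  have cub: "cmod (\<Lambda> i f) \<le> c i * N f" if f: "f \<in> X" for i f
  proof (cases "N f = 0")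
    case True
    then have "f = (\<lambda>z. 0 * f z)" using norm_eq_0[OF f] by auto
    then have "\<Lambda> i f = 0 * \<Lambda> i f" using scale[OF f, of i 0] by simp
    then show ?thesis using True by simp
  next
    case False
    then have N: "0 < N f" using norm_nonneg[OF f] by simp
    have "(\<lambda>z. of_real (1 / N f) * f z) \<in> U"
      using N scale_mem[OF f] by (simp add: U_def norm_scale[OF f] del: of_real_divide)
    then have "cmod (\<Lambda> i (\<lambda>z. of_real (1 / N f) * f z)) \<le> c i"
      unfolding c_def by (intro cSUP_upper bddU)
    then have "(1 / N f) * cmod (\<Lambda> i f) \<le> c i"
      unfolding scale[OF f] norm_mult norm_of_real using N by simp
    then show ?thesis using N by (simp add: field_simps)
  qed
  show ?thesis
  proof (rule ccontr)
    assume neg: "\<nexists>C. \<forall>i. \<forall>f\<in>X. cmod (\<Lambda> i f) \<le> C * N f"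
    have "\<exists>i. 4 ^ n < c i" for n :: nat
    proof (rule ccontr)
      assume "\<nexists>i. 4 ^ n < c i"
      then have "c i * N f \<le> 4 ^ n * N f" if "f \<in> X" for i f
        using norm_nonneg[OF that] by (intro mult_right_mono) (auto simp: not_less)
      then have "\<forall>i. \<forall>f\<in>X. cmod (\<Lambda> i f) \<le> 4 ^ n * N f" using cub order_trans by blast
      with neg show False by blast
    qed
    then obtain \<iota> where \<iota>: "\<And>n :: nat. 4 ^ n < c (\<iota> n)" by metis
    have cpos: "0 < c (\<iota> n)" for n using \<iota>[of n] zero_less_power[of "4::real" n] by linarith
    have "\<exists>y\<in>U. 2 / 3 * c (\<iota> n) < cmod (\<Lambda> (\<iota> n) y)" for n
    proof -
      have "2 / 3 * c (\<iota> n) < (SUP f\<in>U. cmod (\<Lambda> (\<iota> n) f))" using cpos[of n] unfolding c_def by simp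
      then show ?thesis using U0 bddU by (subst (asm) less_cSUP_iff) auto
    qed
    then obtain y where y: "\<And>n. y n \<in> U" "\<And>n. 2 / 3 * c (\<iota> n) < cmod (\<Lambda> (\<iota> n) (y n))" by metis
    have yX: "y n \<in> X" "N (y n) \<le> 1" for n using y(1)[of n] by (auto simp: U_def)
    \<comment> \<open>of \<open>x + d\<close> and \<open>x - d\<close>, at least one is mapped to a value no smaller than the image of \<open>d\<close>\<close>
    have pick: "\<exists>x'\<in>X. N (\<lambda>z. x' z - x z) \<le> (1/3) ^ n \<and> (1/3) ^ n * cmod (\<Lambda> (\<iota> n) (y n)) \<le> cmod (\<Lambda> (\<iota> n) x')"
      if x: "x \<in> X" for x n
    proof -
      define d where "d = (\<lambda>z. of_real ((1/3) ^ n) * y n z)"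
      have d: "d \<in> X" unfolding d_def by (rule scale_mem[OF yX(1)])
      have Nd: "N d \<le> (1/3) ^ n"
        unfolding d_def norm_scale[OF yX(1)] norm_of_real using yX(2)[of n] norm_nonneg[OF yX(1), of n]
        by (simp add: mult_left_le)
      have \<Lambda>d: "cmod (\<Lambda> (\<iota> n) d) = (1/3) ^ n * cmod (\<Lambda> (\<iota> n) (y n))"
        unfolding d_def scale[OF yX(1)] norm_mult norm_of_real by simp
      have "2 * cmod (\<Lambda> (\<iota> n) d) \<le> cmod (\<Lambda> (\<iota> n) (\<lambda>z. x z + d z)) + cmod (\<Lambda> (\<iota> n) (\<lambda>z. x z - d z))"
        using norm_triangle_ineq4[of "\<Lambda> (\<iota> n) x + \<Lambda> (\<iota> n) d" "\<Lambda> (\<iota> n) x - \<Lambda> (\<iota> n) d"]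
        by (simp add: add[OF x d] diff[OF x d] norm_mult flip: mult_2)
      then consider "cmod (\<Lambda> (\<iota> n) d) \<le> cmod (\<Lambda> (\<iota> n) (\<lambda>z. x z + d z))"
        | "cmod (\<Lambda> (\<iota> n) d) \<le> cmod (\<Lambda> (\<iota> n) (\<lambda>z. x z - d z))" by linarith
      then show ?thesis
      proof cases
        case 1
        then show ?thesis using Nd \<Lambda>d add_mem[OF x d] by (intro bexI[of _ "\<lambda>z. x z + d z"]) auto
      next
        case 2
        have "N (\<lambda>z. - d z) = N d" using norm_scale[OF d, of "-1"] by simp
        with 2 show ?thesis using Nd \<Lambda>d diff_mem[OF x d] by (intro bexI[of _ "\<lambda>z. x z - d z"]) auto
      qed
    qed
    have "\<exists>x. \<forall>n. x n \<in> X \<and> N (\<lambda>z. x (Suc n) z - x n z) \<le> (1/3) ^ n \<and>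
        (1/3) ^ n * cmod (\<Lambda> (\<iota> n) (y n)) \<le> cmod (\<Lambda> (\<iota> n) (x (Suc n)))"
    proof -
      have "\<exists>x. \<forall>n. x n \<in> X \<and> (N (\<lambda>z. x (Suc n) z - x n z) \<le> (1/3) ^ n \<and>
        (1/3) ^ n * cmod (\<Lambda> (\<iota> n) (y n)) \<le> cmod (\<Lambda> (\<iota> n) (x (Suc n))))"
        using zero_mem pick by (intro dependent_nat_choice) auto
      then show ?thesis by blast
    qed
    then obtain x where x: "\<And>n. x n \<in> X" "\<And>n. N (\<lambda>z. x (Suc n) z - x n z) \<le> (1/3) ^ n"
      "\<And>n. (1/3) ^ n * cmod (\<Lambda> (\<iota> n) (y n)) \<le> cmod (\<Lambda> (\<iota> n) (x (Suc n)))" by metis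
    have tail: "N (\<lambda>z. x (n + k) z - x n z) \<le> 3/2 * (1/3) ^ n * (1 - (1/3) ^ k)" for n k
    proof (induction k)
      case 0
      then show ?case using norm_eq_0[OF zero_mem] by simp
    next
      case (Suc k)
      have "N (\<lambda>z. x (n + Suc k) z - x n z) \<le> N (\<lambda>z. x (Suc (n + k)) z - x (n + k) z) + N (\<lambda>z. x (n + k) z - x n z)"
        using norm_triangle_diff[OF x(1)[of "Suc (n + k)"] x(1)[of "n + k"] x(1)[of n]] by simp
      also have "\<dots> \<le> (1/3) ^ (n + k) + 3/2 * (1/3) ^ n * (1 - (1/3) ^ k)"
        by (intro add_mono x(2) Suc.IH)
      also have "\<dots> = 3/2 * (1/3) ^ n * (1 - (1/3) ^ Suc k)"
        by (simp add: power_add field_simps)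
      finally show ?case .
    qed
    have tail': "N (\<lambda>z. x m z - x n z) \<le> 3/2 * (1/3) ^ n" if "n \<le> m" for m n
    proof -
      have "N (\<lambda>z. x m z - x n z) \<le> 3/2 * (1/3) ^ n * (1 - (1/3) ^ (m - n))"
        using tail[of n "m - n"] that by simp
      also have "\<dots> \<le> 3/2 * (1/3) ^ n * 1" by (intro mult_left_mono) auto
      finally show ?thesis by simp
    qed
    have "\<exists>f\<in>X. (\<lambda>n. N (\<lambda>z. x n z - f z)) \<longlonglongrightarrow> 0"
    proof (rule complete[OF x(1)], intro allI impI)
      fix e :: real assume e: "0 < e"
      have "\<exists>M. (1/3 :: real) ^ M < e / 2" using e by (intro real_arch_pow_inv) auto
      then obtain M where M: "(1/3 :: real) ^ M < e / 2" ..
      have small: "N (\<lambda>z. x m z - x n z) < e" if "M \<le> n" "n \<le> m" for m n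
      proof -
        have "(1/3 :: real) ^ n \<le> (1/3) ^ M" using that by (intro power_decreasing) auto
        then show ?thesis using tail'[OF that(2)] M e by linarith
      qed
      have "N (\<lambda>z. x m z - x n z) < e" if "M \<le> m" "M \<le> n" for m n
        using small[of n m] small[of m n] norm_diff_commute[OF x(1) x(1), of m n] that by linarith
      then show "\<exists>M. \<forall>m\<ge>M. \<forall>n\<ge>M. N (\<lambda>z. x m z - x n z) < e" by blast
    qed
    then obtain f where f: "f \<in> X" "(\<lambda>n. N (\<lambda>z. x n z - f z)) \<longlonglongrightarrow> 0" by blast
    have close: "N (\<lambda>z. f z - x n z) \<le> 3/2 * (1/3) ^ n" for n
    proof (rule LIMSEQ_le_const[of "\<lambda>m. N (\<lambda>z. x m z - f z) + 3/2 * (1/3) ^ n"])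
      show "(\<lambda>m. N (\<lambda>z. x m z - f z) + 3/2 * (1/3) ^ n) \<longlonglongrightarrow> 3/2 * (1/3) ^ n"
        using tendsto_add[OF f(2) tendsto_const[of "3/2 * (1/3) ^ n"]] by simp
      have "N (\<lambda>z. f z - x n z) \<le> N (\<lambda>z. x m z - f z) + 3/2 * (1/3) ^ n" if "n \<le> m" for m
        using norm_triangle_diff[OF f(1) x(1)[of m] x(1)[of n]] tail'[OF that]
          norm_diff_commute[OF f(1) x(1)[of m]] by linarith
      then show "\<exists>K. \<forall>m\<ge>K. N (\<lambda>z. f z - x n z) \<le> N (\<lambda>z. x m z - f z) + 3/2 * (1/3) ^ n" by blast
    qed
    obtain B where B: "\<And>i. cmod (\<Lambda> i f) \<le> B" using bdd[OF f(1)] by blast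
    have large: "(4/3) ^ n / 6 \<le> B" for n
    proof -
      have "cmod (\<Lambda> (\<iota> n) (\<lambda>z. f z - x (Suc n) z)) \<le> c (\<iota> n) * (1/2 * (1/3) ^ n)"
      proof -
        have "cmod (\<Lambda> (\<iota> n) (\<lambda>z. f z - x (Suc n) z)) \<le> c (\<iota> n) * N (\<lambda>z. f z - x (Suc n) z)"
          by (rule cub[OF diff_mem[OF f(1) x(1)]])
        also have "\<dots> \<le> c (\<iota> n) * (1/2 * (1/3) ^ n)"
          using close[of "Suc n"] cpos[of n] by (intro mult_left_mono) auto
        finally show ?thesis .
      qed
      moreover have "cmod (\<Lambda> (\<iota> n) (x (Suc n))) \<le> cmod (\<Lambda> (\<iota> n) f) + cmod (\<Lambda> (\<iota> n) (\<lambda>z. f z - x (Suc n) z))"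
        using norm_triangle_ineq4[of "\<Lambda> (\<iota> n) f" "\<Lambda> (\<iota> n) f - \<Lambda> (\<iota> n) (x (Suc n))"]
        by (simp add: diff[OF f(1) x(1)])
      moreover have "(1/3) ^ n * (2 / 3 * c (\<iota> n)) \<le> (1/3) ^ n * cmod (\<Lambda> (\<iota> n) (y n))"
        using y(2)[of n] by (intro mult_left_mono) auto
      ultimately have "(1/3) ^ n * (2 / 3 * c (\<iota> n)) - c (\<iota> n) * (1/2 * (1/3) ^ n) \<le> B"
        using x(3)[of n] B[of "\<iota> n"] by linarith
      then have "(1/3) ^ n * c (\<iota> n) / 6 \<le> B" by (simp add: algebra_simps)
      moreover have "(1/3) ^ n * 4 ^ n \<le> (1/3) ^ n * c (\<iota> n)" using \<iota>[of n] by (intro mult_left_mono) auto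
      moreover have "(1/3 :: real) ^ n * 4 ^ n = (4/3) ^ n" by (simp flip: power_mult_distrib)
      ultimately show ?thesis by linarith
    qed
    obtain n where "6 * B < (4/3 :: real) ^ n" using real_arch_pow[of "4/3" "6 * B"] by auto
    with large[of n] show False by linarith
  qed
qed

end

lemma uniform_limit_deriv_tendsto:
  assumes unif: "\<And>K. \<lbrakk>compact K; K \<subseteq> unit_disk\<rbrakk> \<Longrightarrow> uniform_limit K F f sequentially"
    and hol: "\<And>n. F n holomorphic_on unit_disk" and z: "cmod z < 1"
  shows "(\<lambda>n. (deriv ^^ m) (F n) z) \<longlonglongrightarrow> (deriv ^^ m) f z"
proof -
  obtain r where r: "cmod z < r" "r < 1" using z dense by blast
  have "uniform_limit (cball 0 r) F f sequentially" using r by (intro unif) auto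
  then have "uniform_limit (ball 0 r) F f sequentially"
    by (rule uniform_limit_on_subset) auto
  moreover have "F n holomorphic_on ball 0 r" for n
    by (rule holomorphic_on_subset[OF hol]) (use r in auto)
  ultimately show ?thesis
    using r by (intro higher_deriv_complex_uniform_limit[where A = "ball 0 r"]) auto
qed

text \<open>
  The functionals \<open>f \<mapsto> (1 - \<bar>z\<bar>) f' z\<close> and \<open>f \<mapsto> f 0\<close> are continuous on \<open>X\<close>, because locally uniform convergence implies
  convergence of derivatives, and they are pointwise bounded because \<open>X\<close> consists of Bloch functions.
\<close>

theorem (in banach_subspace) bloch_embedding_bounded:
  assumes "X \<subseteq> bloch"
  obtains C where "0 \<le> C" "\<And>f. f \<in> X \<Longrightarrow> bloch_bounded (C * N f) f"
proof -
  have hol: "f holomorphic_on unit_disk" if "f \<in> X" for f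
    using subset_H_disk that by (auto simp: H_disk_def)
  have diffble: "f field_differentiable at z" if "f \<in> X" "cmod z < 1" for f z
    using hol[OF that(1)] that(2) by (intro holomorphic_on_imp_differentiable_at[of f unit_disk]) auto
  \<comment> \<open>indices outside the disk stand for evaluation at \<open>0\<close>\<close>
  define \<Lambda> where "\<Lambda> z f = (if cmod z < 1 then of_real (1 - cmod z) * deriv f z else f 0)" for z f
  have "\<exists>C. \<forall>z. \<forall>f\<in>X. cmod (\<Lambda> z f) \<le> C * N f"
  proof (rule uniform_boundedness)
    show "\<Lambda> z (\<lambda>w. f w + g w) = \<Lambda> z f + \<Lambda> z g" if "f \<in> X" "g \<in> X" for z f g
      using diffble[OF that(1)] diffble[OF that(2)] by (simp add: \<Lambda>_def algebra_simps)
    show "\<Lambda> z (\<lambda>w. c * f w) = c * \<Lambda> z f" if "f \<in> X" for z c f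
      using diffble[OF that] by (simp add: \<Lambda>_def algebra_simps)
    show "(\<lambda>n. \<Lambda> z (F n)) \<longlonglongrightarrow> 0" if F: "\<And>n. F n \<in> X" "(\<lambda>n. N (F n)) \<longlonglongrightarrow> 0" for z F
    proof -
      have unif: "uniform_limit K F (\<lambda>z. 0) sequentially" if "compact K" "K \<subseteq> unit_disk" for K
        using continuous_inclusion[of F "\<lambda>z. 0", OF F(1) zero_mem _ that] F(2) by simp
      have "(\<lambda>n. F n 0) \<longlonglongrightarrow> 0" "(\<lambda>n. deriv (F n) z) \<longlonglongrightarrow> 0" if "cmod z < 1"
        using uniform_limit_deriv_tendsto[OF unif hol[OF F(1)], of 0 0] that
          uniform_limit_deriv_tendsto[OF unif hol[OF F(1)], of z 1] by auto
      moreover have "(\<lambda>n. F n 0) \<longlonglongrightarrow> 0"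
        using uniform_limit_deriv_tendsto[OF unif hol[OF F(1)], of 0 0] by simp
      ultimately show ?thesis
        by (cases "cmod z < 1") (auto simp: \<Lambda>_def intro!: tendsto_mult_right_zero simp del: of_real_diff)
    qed
    show "\<exists>B. \<forall>z. cmod (\<Lambda> z f) \<le> B" if "f \<in> X" for f
    proof -
      have "f \<in> bloch" using assms that by auto
      then obtain B where B: "\<forall>z\<in>unit_disk. (1 - (cmod z)\<^sup>2) * cmod (deriv f z) \<le> B"
        by (auto simp: bloch_def bdd_above_def)
      have "cmod (\<Lambda> z f) \<le> max B (cmod (f 0))" for z
      proof (cases "cmod z < 1")
        case True
        have "(cmod z)\<^sup>2 \<le> cmod z" using True by (simp add: power2_eq_square mult_left_le)
        then have "(1 - cmod z) * cmod (deriv f z) \<le> (1 - (cmod z)\<^sup>2) * cmod (deriv f z)"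
          by (intro mult_right_mono) auto
        also have "\<dots> \<le> B" using B True by simp
        finally show ?thesis using True by (simp add: \<Lambda>_def norm_mult del: of_real_diff)
      qed (simp add: \<Lambda>_def)
      then show ?thesis by blast
    qed
  qed
  then obtain C where C: "\<And>z f. f \<in> X \<Longrightarrow> cmod (\<Lambda> z f) \<le> C * N f" by blast
  show ?thesis
  proof (rule that[of "\<bar>C\<bar>"])
    fix f assume f: "f \<in> X"
    have CN: "C * N f \<le> \<bar>C\<bar> * N f" using norm_nonneg[OF f] by (intro mult_right_mono) auto
    have "(1 - cmod z) * cmod (deriv f z) \<le> \<bar>C\<bar> * N f" if "cmod z < 1" for z
      using C[OF f, of z] that CN by (simp add: \<Lambda>_def norm_mult del: of_real_diff)
    moreover have "cmod (f 0) \<le> \<bar>C\<bar> * N f"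
      using C[OF f, of 1] CN by (simp add: \<Lambda>_def)
    ultimately show "bloch_bounded (\<bar>C\<bar> * N f) f"
      using hol[OF f] by (simp add: bloch_bounded_def)
  qed simp
qed

section \<open>Boundedness and compactness\<close>

lemma cesaro_integrand_combination:
  "cesaro_integrand \<alpha> (\<lambda>w. a * f w + b * g w) z = a * cesaro_integrand \<alpha> f z + b * cesaro_integrand \<alpha> g z"
  by (simp add: cesaro_integrand_def algebra_simps)

context unit_interval_measure
begin

lemma cesaro_eq_integral:
  assumes "f holomorphic_on unit_disk" "0 < \<alpha>" "cmod z < 1"
  shows "cesaro \<mu> \<alpha> f z = (\<integral>t. cesaro_integrand \<alpha> f (of_real t * z) \<partial>\<mu>)"
    and "integrable \<mu> (\<lambda>t. cesaro_integrand \<alpha> f (of_real t * z))"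
  using higher_deriv_cesaro[OF assms, of 0] by simp_all

lemma cesaro_combination:
  assumes f: "f holomorphic_on unit_disk" and g: "g holomorphic_on unit_disk" and \<alpha>: "0 < \<alpha>"
  shows "cesaro \<mu> \<alpha> (\<lambda>w. a * f w + b * g w) z = a * cesaro \<mu> \<alpha> f z + b * cesaro \<mu> \<alpha> g z"
proof (cases "cmod z < 1")
  case True
  have fg: "(\<lambda>w. a * f w + b * g w) holomorphic_on unit_disk"
    using f g by (intro holomorphic_intros)
  show ?thesis
    using cesaro_eq_integral[OF f \<alpha> True] cesaro_eq_integral[OF g \<alpha> True]
    by (simp add: cesaro_eq_integral(1)[OF fg \<alpha> True] cesaro_integrand_combination)
qed (simp add: cesaro_def)

text \<open>
  The value of the image at \<open>z\<close> depends only on \<open>h n\<close> on the disc of radius \<open>\<bar>z\<bar>\<close>, where \<open>\<bar>1 - t z\<bar>\<close> is bounded below.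
  Hence the images converge to \<open>0\<close> locally uniformly, and so do their derivatives.
\<close>

lemma higher_deriv_cesaro_tendsto_0:
  assumes unif: "\<And>K. \<lbrakk>compact K; K \<subseteq> unit_disk\<rbrakk> \<Longrightarrow> uniform_limit K h (\<lambda>z. 0) sequentially"
    and hol: "\<And>n. h n holomorphic_on unit_disk" and \<alpha>: "0 < \<alpha>" and z: "cmod z < 1"
  shows "(\<lambda>n. (deriv ^^ k) (cesaro \<mu> \<alpha> (h n)) z) \<longlonglongrightarrow> 0"
proof -
  have "uniform_limit K (\<lambda>n. cesaro \<mu> \<alpha> (h n)) (\<lambda>z. 0) sequentially"
    if K: "compact K" "K \<subseteq> unit_disk" for K
  proof -
    obtain r where r: "0 \<le> r" "r < 1" "K \<subseteq> cball 0 r"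
    proof (cases "K = {}")
      case False
      obtain x where x: "x \<in> K" "\<forall>y\<in>K. cmod y \<le> cmod x"
        using continuous_attains_sup[OF K(1) False continuous_on_norm_id] by auto
      have "cmod x < 1" "K \<subseteq> cball 0 (cmod x)" using x K(2) by auto
      then show ?thesis using that[of "cmod x"] by simp
    qed (use that[of 0] in auto)
    define A where "A = (1 - r) powr (- \<alpha>) * (measure \<mu> (space \<mu>) + 1)"
    have A: "0 < A" using r by (auto simp: A_def intro!: mult_pos_pos add_nonneg_pos)
    show ?thesis
      unfolding uniform_limit_iff
    proof (intro allI impI)
      fix e :: real assume e: "0 < e"
      have "uniform_limit (cball 0 r) h (\<lambda>z. 0) sequentially" using r by (intro unif) auto
      then have "\<forall>\<^sub>F n in sequentially. \<forall>x\<in>cball 0 r. dist (h n x) 0 < e / A"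
        using e A by (auto simp: uniform_limit_iff)
      then show "\<forall>\<^sub>F n in sequentially. \<forall>x\<in>K. dist (cesaro \<mu> \<alpha> (h n) x) 0 < e"
      proof eventually_elim
        case (elim n)
        show ?case
        proof
          fix x assume "x \<in> K"
          then have x: "cmod x \<le> r" "cmod x < 1" using r by auto
          have bound: "norm (cesaro_integrand \<alpha> (h n) (of_real t * x)) \<le> e / A * (1 - r) powr (- \<alpha>)"
            if t: "t \<in> space \<mu>" for t
          proof -
            have "cmod (of_real t * x) \<le> 1 * cmod x"
              unfolding norm_mult using t by (intro mult_right_mono) (auto simp: space_eq)
            then have tx: "cmod (of_real t * x) \<le> r" using x by simp
            then have h: "cmod (h n (of_real t * x)) \<le> e / A" using elim by (auto intro: less_imp_le)
            have "1 - r \<le> cmod (1 - of_real t * x)"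
              using norm_triangle_ineq2[of 1 "of_real t * x"] tx by simp
            then have "cmod (1 - of_real t * x) powr (- \<alpha>) \<le> (1 - r) powr (- \<alpha>)"
              using r \<alpha> by (intro powr_mono2') auto
            moreover have "cmod (of_real t * x) < 1" using tx r by linarith
            ultimately show ?thesis
              unfolding norm_cesaro_integrand[OF \<open>cmod (of_real t * x) < 1\<close>]
              using h e A by (intro mult_mono) auto
          qed
          have "norm (cesaro \<mu> \<alpha> (h n) x) \<le> (\<integral>t. e / A * (1 - r) powr (- \<alpha>) \<partial>\<mu>)"
            unfolding cesaro_eq_integral(1)[OF hol \<alpha> x(2)]
            by (rule Bochner_Integration.integral_norm_bound_integral[OF cesaro_eq_integral(2)[OF hol \<alpha> x(2)]]) (use bound in auto)
          also have "\<dots> = e / A * (1 - r) powr (- \<alpha>) * measure \<mu> (space \<mu>)" by simp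
          also have "\<dots> < e / A * (1 - r) powr (- \<alpha>) * (measure \<mu> (space \<mu>) + 1)"
            using e A r by (intro mult_strict_left_mono) auto
          also have "\<dots> = e / A * A" by (simp add: A_def)
          also have "\<dots> = e" using A by simp
          finally show "dist (cesaro \<mu> \<alpha> (h n) x) 0 < e" by simp
        qed
      qed
    qed
  qed
  moreover have "cesaro \<mu> \<alpha> (h n) holomorphic_on unit_disk" for n
    using cesaro_mem_H_disk[OF hol \<alpha>] by (simp add: H_disk_def)
  ultimately have "(\<lambda>n. (deriv ^^ k) (cesaro \<mu> \<alpha> (h n)) z) \<longlonglongrightarrow> (deriv ^^ k) (\<lambda>z. 0) z"
    using z by (rule uniform_limit_deriv_tendsto)
  also have "(deriv ^^ k) (\<lambda>z. 0) z = (0 :: complex)" by (simp add: higher_deriv_const)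
  finally show ?thesis .
qed

end

lemma besov_density_measurable:
  assumes "f holomorphic_on unit_disk"
  shows "(\<lambda>z. ennreal (besov_density p f z)) \<in> borel_measurable disk_area"
proof -
  have "continuous_on unit_disk ((deriv ^^ besov_order p) f)"
    using assms by (intro holomorphic_on_imp_continuous_on holomorphic_higher_deriv) auto
  then have "(deriv ^^ besov_order p) f \<in> borel_measurable (restrict_space borel unit_disk)"
    by (rule borel_measurable_continuous_on_restrict)
  then have [measurable]: "(deriv ^^ besov_order p) f \<in> borel_measurable disk_area"
    using measurable_cong_sets[OF sets_disk_area refl] by blast
  have [measurable]: "(\<lambda>z. cmod z) \<in> borel_measurable disk_area"
    by (intro borel_measurable_disk_area) measurable
  show ?thesis unfolding besov_density_def by measurable
qed

lemma bloch_bounded_mono: "\<lbrakk>bloch_bounded L f; L \<le> L'\<rbrakk> \<Longrightarrow> bloch_bounded L' f"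
  by (auto simp: bloch_bounded_def intro: order_trans)

lemma bloch_bounded_diff:
  assumes f: "bloch_bounded L f" and g: "bloch_bounded L' g"
  shows "bloch_bounded (L + L') (\<lambda>z. f z - g z)"
proof -
  have hol: "f holomorphic_on unit_disk" "g holomorphic_on unit_disk"
    using f g by (auto simp: bloch_bounded_def)
  have "(1 - cmod z) * cmod (deriv (\<lambda>z. f z - g z) z) \<le> L + L'" if z: "cmod z < 1" for z
  proof -
    have "f field_differentiable at z" "g field_differentiable at z"
      using hol z by (auto intro!: holomorphic_on_imp_differentiable_at[of _ unit_disk])
    then have "cmod (deriv (\<lambda>z. f z - g z) z) \<le> cmod (deriv f z) + cmod (deriv g z)"
      by (simp add: norm_triangle_ineq4)
    then have "(1 - cmod z) * cmod (deriv (\<lambda>z. f z - g z) z) \<le> (1 - cmod z) * (cmod (deriv f z) + cmod (deriv g z))"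
      using z by (intro mult_left_mono) auto
    moreover have "(1 - cmod z) * cmod (deriv f z) \<le> L" "(1 - cmod z) * cmod (deriv g z) \<le> L'"
      using f g z by (auto simp: bloch_bounded_def)
    ultimately show ?thesis by (simp add: distrib_left)
  qed
  moreover have "cmod (f 0 - g 0) \<le> L + L'"
    using norm_triangle_ineq4[of "f 0" "g 0"] f g by (auto simp: bloch_bounded_def)
  ultimately show ?thesis using hol by (auto simp: bloch_bounded_def intro!: holomorphic_intros)
qed

text \<open>
  The growth estimate makes Montel's theorem applicable, and the defining inequalities pass to the limit.
\<close>

lemma bloch_bounded_normal_family:
  assumes F: "\<And>n. bloch_bounded L (F n)"
  obtains g r where "bloch_bounded L g" "strict_mono (r :: nat \<Rightarrow> nat)"
    "\<And>K. \<lbrakk>compact K; K \<subseteq> unit_disk\<rbrakk> \<Longrightarrow> uniform_limit K (\<lambda>n. F (r n)) g sequentially"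
proof -
  have L: "0 \<le> L" using F bloch_bounded_nonneg by blast
  obtain g r where gr: "g holomorphic_on unit_disk" "strict_mono (r :: nat \<Rightarrow> nat)"
    "\<And>x. x \<in> unit_disk \<Longrightarrow> ((\<lambda>n. F (r n) x) \<longlongrightarrow> g x) sequentially"
    "\<And>K. \<lbrakk>compact K; K \<subseteq> unit_disk\<rbrakk> \<Longrightarrow> uniform_limit K (F \<circ> r) g sequentially"
  proof (rule Montel[of unit_disk "Collect (bloch_bounded L)" F])
    fix K assume K: "compact K" "K \<subseteq> unit_disk"
    show "\<exists>B. \<forall>h\<in>Collect (bloch_bounded L). \<forall>z\<in>K. cmod (h z) \<le> B"
    proof (cases "K = {}")
      case False
      obtain x where x: "x \<in> K" "\<forall>y\<in>K. cmod y \<le> cmod x"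
        using continuous_attains_sup[OF K(1) False continuous_on_norm_id] by auto
      have "cmod (h z) \<le> L * (1 - ln (1 - cmod x))" if h: "bloch_bounded L h" and z: "z \<in> K" for h z
      proof -
        have "cmod (h z) \<le> L * (1 - ln (1 - cmod z))" using bloch_growth[OF h] z K by auto
        also have "\<dots> \<le> L * (1 - ln (1 - cmod x))"
        proof -
          have "ln (1 - cmod x) \<le> ln (1 - cmod z)" using x z K by (subst ln_le_cancel_iff) auto
          then show ?thesis using L by (intro mult_left_mono) auto
        qed
        finally show ?thesis .
      qed
      then show ?thesis by blast
    qed auto
  qed (use F in \<open>auto simp: bloch_bounded_def\<close>)
  have unif: "uniform_limit K (\<lambda>n. F (r n)) g sequentially" if "compact K" "K \<subseteq> unit_disk" for K
    using gr(4)[OF that] by (simp add: o_def)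
  have hol: "F n holomorphic_on unit_disk" for n using F by (simp add: bloch_bounded_def)
  have "bloch_bounded L g"
    unfolding bloch_bounded_def
  proof (intro conjI allI impI gr)
    show "cmod (g 0) \<le> L"
      using tendsto_norm[OF gr(3)[of 0]] F by (intro LIMSEQ_le_const2) (auto simp: bloch_bounded_def)
    fix z assume z: "cmod z < 1"
    have "(\<lambda>n. (1 - cmod z) * cmod (deriv (F (r n)) z)) \<longlonglongrightarrow> (1 - cmod z) * cmod (deriv g z)"
      using uniform_limit_deriv_tendsto[OF unif hol z, of 1] by (intro tendsto_intros) simp
    then show "(1 - cmod z) * cmod (deriv g z) \<le> L"
      by (rule LIMSEQ_le_const2) (use F z in \<open>auto simp: bloch_bounded_def\<close>)
  qed
  then show ?thesis using that gr(2) unif by blast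
qed

lemma besov_norm_eq:
  "besov_norm p f = (if p = 1 then cmod (f 0) + cmod (deriv f 0) else cmod (f 0))
     + enn2real (besov_integral p f) powr (1 / p)"
  by (simp add: besov_norm_def)

context unit_interval_measure
begin

lemma norm_cesaro_0_le:
  assumes f: "bloch_bounded L f" and \<alpha>: "0 < \<alpha>"
  shows "cmod (cesaro \<mu> \<alpha> f 0) \<le> moment \<mu> 0 * L"
    and "cmod (deriv (cesaro \<mu> \<alpha> f) 0) \<le> moment \<mu> 1 * (2 * (2 + \<alpha>)\<^sup>2) * L"
proof -
  have hol: "f holomorphic_on unit_disk" using f by (simp add: bloch_bounded_def)
  have "cesaro \<mu> \<alpha> f 0 = of_real (moment \<mu> 0) * f 0"
    using cesaro_eq_integral(1)[OF hol \<alpha>, of 0] by (simp add: cesaro_integrand_def moment_def scaleR_conv_of_real)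
  then show "cmod (cesaro \<mu> \<alpha> f 0) \<le> moment \<mu> 0 * L"
    using f moment_nonneg[of 0] by (auto simp: norm_mult bloch_bounded_def intro!: mult_left_mono)
  have "deriv (cesaro \<mu> \<alpha> f) 0 = (\<integral>t. of_real t * deriv (cesaro_integrand \<alpha> f) 0 \<partial>\<mu>)"
    using higher_deriv_cesaro(1)[OF hol \<alpha>, of 0 1] by simp
  also have "\<dots> = of_real (moment \<mu> 1) * deriv (cesaro_integrand \<alpha> f) 0"
    by (simp add: moment_def)
  finally have "cmod (deriv (cesaro \<mu> \<alpha> f) 0) = moment \<mu> 1 * cmod (deriv (cesaro_integrand \<alpha> f) 0)"
    using moment_nonneg[of 1] by (simp add: norm_mult)
  also have "\<dots> \<le> moment \<mu> 1 * ((2 + \<alpha>)\<^sup>2 * L * 2)"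
    using norm_deriv_cesaro_integrand_le[OF f _ \<alpha>, of 0 1] moment_nonneg[of 1]
    by (intro mult_left_mono) (auto simp: bloch_kernel_def)
  finally show "cmod (deriv (cesaro \<mu> \<alpha> f) 0) \<le> moment \<mu> 1 * (2 * (2 + \<alpha>)\<^sup>2) * L"
    by (simp add: mult_ac)
qed

context
  fixes \<alpha> p :: real
  assumes \<alpha>: "0 < \<alpha>" and p: "1 \<le> p" "1 \<le> \<alpha> * p"
    and dyadic: "summable (\<lambda>k. dyadic_moment \<alpha> k powr p)"
begin

lemma cesaro_bloch_to_besov_bounded:
  obtains K where "\<And>f L. bloch_bounded L f \<Longrightarrow> cesaro \<mu> \<alpha> f \<in> besov p \<and> besov_norm p (cesaro \<mu> \<alpha> f) \<le> K * L"
proof -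
  obtain D where D: "D \<in> borel_measurable disk_area" "(\<integral>\<^sup>+z. D z \<partial>disk_area) < \<infinity>"
    "\<And>f L z. \<lbrakk>bloch_bounded L f; cmod z < 1\<rbrakk> \<Longrightarrow>
      ennreal (besov_density p (cesaro \<mu> \<alpha> f) z) \<le> ennreal (L powr p) * D z"
    by (rule cesaro_besov_density_dominated[OF \<alpha> p dyadic]) blast
  define I where "I = enn2real (\<integral>\<^sup>+z. D z \<partial>disk_area)"
  have I: "0 \<le> I" "(\<integral>\<^sup>+z. D z \<partial>disk_area) = ennreal I" using D(2) by (auto simp: I_def)
  define K where "K = moment \<mu> 0 + moment \<mu> 1 * (2 * (2 + \<alpha>)\<^sup>2) + I powr (1 / p)"
  show ?thesis
  proof (rule that[of K], intro conjI)
    fix f L assume f: "bloch_bounded L f"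
    have L: "0 \<le> L" using f by (rule bloch_bounded_nonneg)
    have hol: "f holomorphic_on unit_disk" using f by (simp add: bloch_bounded_def)
    have "besov_integral p (cesaro \<mu> \<alpha> f) \<le> (\<integral>\<^sup>+z. ennreal (L powr p) * D z \<partial>disk_area)"
      unfolding besov_integral_eq by (intro nn_integral_mono) (auto simp: space_disk_area intro!: D(3)[OF f])
    also have "\<dots> = ennreal (L powr p * I)"
      using D(1) I by (simp add: nn_integral_cmult ennreal_mult)
    finally have B: "besov_integral p (cesaro \<mu> \<alpha> f) \<le> ennreal (L powr p * I)" .
    then show "cesaro \<mu> \<alpha> f \<in> besov p"
      using cesaro_mem_H_disk[OF hol \<alpha>] by (auto simp: besov_def intro: le_less_trans)
    have "enn2real (besov_integral p (cesaro \<mu> \<alpha> f)) \<le> L powr p * I"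
      using enn2real_mono[OF B] I by simp
    then have "enn2real (besov_integral p (cesaro \<mu> \<alpha> f)) powr (1 / p) \<le> (L powr p * I) powr (1 / p)"
      using p by (intro powr_mono2) auto
    also have "\<dots> = I powr (1 / p) * L" using L I p by (simp add: powr_mult powr_powr)
    finally have "enn2real (besov_integral p (cesaro \<mu> \<alpha> f)) powr (1 / p) \<le> I powr (1 / p) * L" .
    moreover have "(if P then x + y else x) + w \<le> A + B + E"
      if "x \<le> A" "y \<le> B" "0 \<le> y" "w \<le> E" for P and x y w A B E :: real
      using that by simp
    ultimately show "besov_norm p (cesaro \<mu> \<alpha> f) \<le> K * L"
      using norm_cesaro_0_le[OF f \<alpha>] unfolding besov_norm_eq K_def distrib_right by simp
  qed
qed

text \<open>
  Dominated convergence, with the common majorant of the Besov densities.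
\<close>

lemma cesaro_besov_norm_tendsto_0:
  assumes h: "\<And>n. bloch_bounded L (h n)"
    and unif: "\<And>K. \<lbrakk>compact K; K \<subseteq> unit_disk\<rbrakk> \<Longrightarrow> uniform_limit K h (\<lambda>z. 0) sequentially"
  shows "(\<lambda>n. besov_norm p (cesaro \<mu> \<alpha> (h n))) \<longlonglongrightarrow> 0"
proof -
  obtain D where D: "D \<in> borel_measurable disk_area" "(\<integral>\<^sup>+z. D z \<partial>disk_area) < \<infinity>"
    "\<And>f L z. \<lbrakk>bloch_bounded L f; cmod z < 1\<rbrakk> \<Longrightarrow>
      ennreal (besov_density p (cesaro \<mu> \<alpha> f) z) \<le> ennreal (L powr p) * D z"
    by (rule cesaro_besov_density_dominated[OF \<alpha> p dyadic]) blast
  have hol: "h n holomorphic_on unit_disk" for n using h by (simp add: bloch_bounded_def)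
  have Thol: "cesaro \<mu> \<alpha> (h n) holomorphic_on unit_disk" for n
    using cesaro_mem_H_disk[OF hol \<alpha>] by (simp add: H_disk_def)
  have lim: "(\<lambda>n. (deriv ^^ k) (cesaro \<mu> \<alpha> (h n)) z) \<longlonglongrightarrow> 0" if "cmod z < 1" for k z
    by (rule higher_deriv_cesaro_tendsto_0[OF _ hol \<alpha> that]) (rule unif)
  have "(\<lambda>n. \<integral>\<^sup>+z. ennreal (besov_density p (cesaro \<mu> \<alpha> (h n)) z) \<partial>disk_area) \<longlonglongrightarrow> (\<integral>\<^sup>+z. 0 \<partial>disk_area)"
  proof (rule nn_integral_dominated_convergence[where w = "\<lambda>z. ennreal (L powr p) * D z"])
    show "(\<lambda>z. ennreal (besov_density p (cesaro \<mu> \<alpha> (h n)) z)) \<in> borel_measurable disk_area" for n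
      by (rule besov_density_measurable[OF Thol])
    show "(\<lambda>z. ennreal (L powr p) * D z) \<in> borel_measurable disk_area" using D(1) by measurable
    show "AE z in disk_area. ennreal (besov_density p (cesaro \<mu> \<alpha> (h n)) z) \<le> ennreal (L powr p) * D z" for n
      by (rule AE_I2) (auto simp: space_disk_area intro!: D(3)[OF h])
    show "(\<integral>\<^sup>+z. ennreal (L powr p) * D z \<partial>disk_area) < \<infinity>"
      using D(1,2) by (simp add: nn_integral_cmult ennreal_mult_less_top)
    show "AE z in disk_area. (\<lambda>n. ennreal (besov_density p (cesaro \<mu> \<alpha> (h n)) z)) \<longlonglongrightarrow> 0"
    proof (rule AE_I2)
      fix z assume "z \<in> space disk_area"
      then have z: "cmod z < 1" by (simp add: space_disk_area)
      have "(\<lambda>n. cmod ((deriv ^^ besov_order p) (cesaro \<mu> \<alpha> (h n)) z) powr p) \<longlonglongrightarrow> 0"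
        using p by (intro tendsto_zero_powrI[OF tendsto_norm_zero[OF lim[OF z]] tendsto_const]) auto
      then have "(\<lambda>n. besov_density p (cesaro \<mu> \<alpha> (h n)) z) \<longlonglongrightarrow> 0"
        unfolding besov_density_def by (rule tendsto_mult_left_zero)
      then show "(\<lambda>n. ennreal (besov_density p (cesaro \<mu> \<alpha> (h n)) z)) \<longlonglongrightarrow> 0"
        using tendsto_ennrealI by fastforce
    qed
  qed simp
  then have "(\<lambda>n. besov_integral p (cesaro \<mu> \<alpha> (h n))) \<longlonglongrightarrow> ennreal 0"
    by (simp add: besov_integral_eq)
  then have "(\<lambda>n. enn2real (besov_integral p (cesaro \<mu> \<alpha> (h n)))) \<longlonglongrightarrow> 0"
    by (rule tendsto_enn2real) simp
  then have I: "(\<lambda>n. enn2real (besov_integral p (cesaro \<mu> \<alpha> (h n))) powr (1 / p)) \<longlonglongrightarrow> 0"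
    using p by (intro tendsto_zero_powrI[OF _ tendsto_const]) auto
  have 0: "(\<lambda>n. cmod (cesaro \<mu> \<alpha> (h n) 0)) \<longlonglongrightarrow> 0" "(\<lambda>n. cmod (deriv (cesaro \<mu> \<alpha> (h n)) 0)) \<longlonglongrightarrow> 0"
    using tendsto_norm_zero[OF lim[of 0 0]] tendsto_norm_zero[OF lim[of 0 1]] by simp_all
  show ?thesis
    unfolding besov_norm_eq using tendsto_add[OF 0(1) I] tendsto_add[OF tendsto_add[OF 0] I]
    by (cases "p = 1") simp_all
qed

text \<open>
  For compactness, the limit \<open>g\<close> of a subsequence of a bounded sequence in \<open>X\<close> may lie outside \<open>X\<close>. It is
  a Bloch function, so its image belongs to \<open>B\<^sub>p\<close>, and the images of the differences tend to \<open>0\<close>.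
\<close>

theorem cesaro_bounded_and_compact:
  assumes X: "banach_subspace X N" and sub: "X \<subseteq> bloch"
  shows "bounded_op X N (besov p) (besov_norm p) (cesaro \<mu> \<alpha>)"
    and "compact_op X N (besov p) (besov_norm p) (cesaro \<mu> \<alpha>)"
proof -
  interpret banach_subspace X N by (rule X)
  obtain C where C: "0 \<le> C" "\<And>f. f \<in> X \<Longrightarrow> bloch_bounded (C * N f) f"
    by (rule bloch_embedding_bounded[OF sub]) blast
  obtain K where K: "\<And>f L. bloch_bounded L f \<Longrightarrow> cesaro \<mu> \<alpha> f \<in> besov p \<and> besov_norm p (cesaro \<mu> \<alpha> f) \<le> K * L"
    by (rule cesaro_bloch_to_besov_bounded) blast
  have hol: "f holomorphic_on unit_disk" if "f \<in> X" for f
    using subset_H_disk that by (auto simp: H_disk_def)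
  have lin: "linear_op X (besov p) (cesaro \<mu> \<alpha>)"
    unfolding linear_op_def
  proof (intro conjI ballI allI)
    fix f assume f: "f \<in> X"
    show "cesaro \<mu> \<alpha> f \<in> besov p" using K[OF C(2)[OF f]] by simp
    show "cesaro \<mu> \<alpha> (\<lambda>z. f z + g z) = (\<lambda>z. cesaro \<mu> \<alpha> f z + cesaro \<mu> \<alpha> g z)" if "g \<in> X" for g
      using cesaro_combination[OF hol[OF f] hol[OF that] \<alpha>, of 1 1] by auto
    show "cesaro \<mu> \<alpha> (\<lambda>z. c * f z) = (\<lambda>z. c * cesaro \<mu> \<alpha> f z)" for c
      using cesaro_combination[OF hol[OF f] hol[OF f] \<alpha>, of c 0] by auto
  qed
  show "bounded_op X N (besov p) (besov_norm p) (cesaro \<mu> \<alpha>)"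
    unfolding bounded_op_def
  proof (intro conjI lin exI[of _ "K * C"] ballI)
    fix f assume "f \<in> X"
    then show "besov_norm p (cesaro \<mu> \<alpha> f) \<le> K * C * N f" using K[OF C(2)] by (simp add: mult.assoc)
  qed
  show "compact_op X N (besov p) (besov_norm p) (cesaro \<mu> \<alpha>)"
    unfolding compact_op_def
  proof (intro conjI lin allI impI, elim conjE exE)
    fix F :: "nat \<Rightarrow> complex \<Rightarrow> complex" and B assume F: "\<forall>n. F n \<in> X" and B: "\<forall>n. N (F n) \<le> B"
    have "bloch_bounded (C * B) (F n)" for n
      using C(2)[of "F n"] F B C(1) by (auto intro: bloch_bounded_mono mult_left_mono)
    then obtain g r where g: "bloch_bounded (C * B) g" and r: "strict_mono (r :: nat \<Rightarrow> nat)"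
      and unif: "\<And>K. \<lbrakk>compact K; K \<subseteq> unit_disk\<rbrakk> \<Longrightarrow> uniform_limit K (\<lambda>n. F (r n)) g sequentially"
      and FB: "\<And>n. bloch_bounded (C * B) (F n)"
      using bloch_bounded_normal_family[of "C * B" F] by metis
    have ghol: "g holomorphic_on unit_disk" using g by (simp add: bloch_bounded_def)
    have "(\<lambda>n. besov_norm p (cesaro \<mu> \<alpha> (\<lambda>z. F (r n) z - g z))) \<longlonglongrightarrow> 0"
    proof (rule cesaro_besov_norm_tendsto_0)
      show "bloch_bounded (C * B + C * B) (\<lambda>z. F (r n) z - g z)" for n
        by (rule bloch_bounded_diff[OF FB g])
      show "uniform_limit K (\<lambda>n z. F (r n) z - g z) (\<lambda>z. 0) sequentially"
        if "compact K" "K \<subseteq> unit_disk" for K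
        using uniform_limit_minus[OF unif[OF that] uniform_limit_const[where c = g]] by simp
    qed
    moreover have "cesaro \<mu> \<alpha> (\<lambda>z. F (r n) z - g z) = (\<lambda>z. cesaro \<mu> \<alpha> (F (r n)) z - cesaro \<mu> \<alpha> g z)" for n
      using cesaro_combination[OF hol ghol \<alpha>, of "F (r n)" 1 "-1"] F by auto
    moreover have "cesaro \<mu> \<alpha> g \<in> besov p" using K[OF g] by simp
    ultimately show "\<exists>g\<in>besov p. \<exists>\<phi>. strict_mono (\<phi> :: nat \<Rightarrow> nat) \<and>
      (\<lambda>n. besov_norm p (\<lambda>z. cesaro \<mu> \<alpha> (F (\<phi> n)) z - g z)) \<longlonglongrightarrow> 0"
      using r by (intro bexI[of _ "cesaro \<mu> \<alpha> g"] exI[of _ r]) auto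
  qed
qed

end

end

section \<open>The moment condition in dyadic form\<close>

lemma summable_dyadic_blocks_iff:
  fixes a :: "nat \<Rightarrow> real"
  assumes a: "\<And>n. 0 \<le> a n"
  shows "summable a \<longleftrightarrow> summable (\<lambda>k. \<Sum>n\<in>{2 ^ k - 1..<2 ^ Suc k - 1}. a n)"
proof -
  define b where "b k = (\<Sum>n\<in>{2 ^ k - 1..<2 ^ Suc k - 1}. a n)" for k :: nat
  have b: "0 \<le> b k" for k unfolding b_def by (intro sum_nonneg a)
  have partial: "(\<Sum>k<K. b k) = (\<Sum>n<2 ^ K - 1. a n)" for K
  proof (induction K)
    case (Suc K)
    have "(\<Sum>k<Suc K. b k) = (\<Sum>n\<in>{0..<2 ^ K - 1}. a n) + (\<Sum>n\<in>{2 ^ K - 1..<2 ^ Suc K - 1}. a n)"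
      using Suc.IH by (simp add: b_def atLeast0LessThan)
    also have "\<dots> = (\<Sum>n\<in>{0..<2 ^ Suc K - 1}. a n)"
      by (rule sum.atLeastLessThan_concat) (auto intro: diff_le_mono)
    finally show ?case by (simp add: atLeast0LessThan)
  qed simp
  have "summable b" if "summable a"
  proof (rule summableI_nonneg_bounded[OF b])
    show "(\<Sum>k<K. b k) \<le> suminf a" for K
      unfolding partial using that a by (intro sum_le_suminf) auto
  qed
  moreover have "summable a" if "summable b"
  proof (rule summableI_nonneg_bounded[OF a])
    fix N :: nat
    have "N \<le> 2 ^ N - 1" using less_exp[of N] by linarith
    then have "(\<Sum>n<N. a n) \<le> (\<Sum>n<2 ^ N - 1. a n)"
      using a by (intro sum_mono2) auto
    also have "\<dots> = (\<Sum>k<N. b k)" by (simp add: partial)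
    also have "\<dots> \<le> suminf b" using that b by (intro sum_le_suminf) auto
    finally show "(\<Sum>n<N. a n) \<le> suminf b" .
  qed
  ultimately show ?thesis unfolding b_def by blast
qed

text \<open>
  Moments decrease, so on the block \<open>2 ^ k - 1 \<le> n < 2 ^ (k + 1) - 1\<close> they lie between the moments of order \<open>2 ^ (k + 1) - 1\<close> and
  \<open>2 ^ k - 1\<close>. The sum over the block is thus comparable to dyadic moments with index \<open>k\<close> from above and
  \<open>k + 1\<close> from below.
\<close>

lemma (in unit_interval_measure) summable_moment_iff_dyadic:
  assumes \<alpha>: "0 < \<alpha>" and p: "1 \<le> p" "1 \<le> p * \<alpha>"
  shows "summable (\<lambda>n. real (n + 1) powr (p * \<alpha> - 1) * moment \<mu> n powr p * ln (real n + 2) powr p)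
     \<longleftrightarrow> summable (\<lambda>k. dyadic_moment \<alpha> k powr p)"
proof -
  define a where "a n = real (n + 1) powr (p * \<alpha> - 1) * moment \<mu> n powr p * ln (real n + 2) powr p" for n
  define M where "M k = moment \<mu> (2 ^ k - 1)" for k
  have M: "0 \<le> M k" for k by (simp add: M_def moment_nonneg)
  define b where "b k = (\<Sum>n\<in>{2 ^ k - 1..<2 ^ Suc k - 1}. a n)" for k :: nat
  have a: "0 \<le> a n" for n by (simp add: a_def)
  let ?u = "\<lambda>k. 2 powr ((real k + 1) * (p * \<alpha> - 1)) * M k powr p * (real k + 1) powr p"
  let ?l = "\<lambda>k. 2 powr (real k * (p * \<alpha> - 1)) * M (Suc k) powr p * ((real k + 2) / 4) powr p"
  let ?blk = "\<lambda>k. {2 ^ k - 1..<2 ^ Suc k - 1 :: nat}"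
  have card: "card (?blk k) = 2 ^ k" for k
  proof -
    have "1 \<le> (2::nat) ^ k" by simp
    then show ?thesis by simp
  qed
  have range: "2 ^ k \<le> real (n + 1)" "real (n + 1) \<le> 2 ^ Suc k - 1" if "n \<in> (?blk k)" for n k
  proof -
    have "2 ^ k \<le> n + 1" "n + 2 \<le> 2 ^ Suc k" using that by auto
    then have "real (2 ^ k) \<le> real (n + 1)" "real (n + 2) \<le> real (2 ^ Suc k)" by (simp_all only: of_nat_le_iff)
    then show "2 ^ k \<le> real (n + 1)" "real (n + 1) \<le> 2 ^ Suc k - 1" by simp_all
  qed
  have dyad: "dyadic_moment \<alpha> k powr p = (real k + 1) powr p * 2 powr (\<alpha> * k * p) * M k powr p" for k
    using M[of k] by (simp add: dyadic_moment_def M_def powr_mult powr_powr)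
  have upper: "b k \<le> 2 powr (p * \<alpha>) * dyadic_moment \<alpha> k powr p" for k
  proof -
    have "b k \<le> (\<Sum>n\<in>(?blk k). (?u k))"
      unfolding b_def
    proof (rule sum_mono)
      fix n :: nat assume n: "n \<in> (?blk k)"
      have "real (n + 1) powr (p * \<alpha> - 1) \<le> (2 ^ Suc k) powr (p * \<alpha> - 1)"
        using range[OF n] p by (intro powr_mono2) auto
      also have "(2 ^ Suc k :: real) = 2 powr (real k + 1)" by (simp add: powr_add powr_realpow)
      also have "\<dots> powr (p * \<alpha> - 1) = 2 powr ((real k + 1) * (p * \<alpha> - 1))" by (simp add: powr_powr)
      finally have 1: "real (n + 1) powr (p * \<alpha> - 1) \<le> 2 powr ((real k + 1) * (p * \<alpha> - 1))" .
      have "moment \<mu> n \<le> M k" unfolding M_def by (rule moment_antimono) (use n in auto)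
      then have 2: "moment \<mu> n powr p \<le> M k powr p" using p moment_nonneg by (intro powr_mono2) auto
      have "ln (real n + 2) \<le> ln (2 ^ Suc k)" using range[OF n] by (subst ln_le_cancel_iff) auto
      also have "\<dots> = (real k + 1) * ln 2" by (subst ln_realpow) (auto simp: algebra_simps)
      also have "\<dots> \<le> (real k + 1) * 1" using ln_2_less_1 by (intro mult_left_mono) auto
      finally have 3: "ln (real n + 2) powr p \<le> (real k + 1) powr p" using p by (intro powr_mono2) auto
      show "a n \<le> (?u k)"
        unfolding a_def by (intro mult_mono 1 2 3) auto
    qed
    also have "\<dots> = 2 powr real k * ((?u k))"
      by (simp only: sum_constant card) (simp add: powr_realpow)
    also have "\<dots> \<le> 2 powr (real k + 1) * ((?u k))"
      by (intro mult_right_mono powr_mono) auto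
    also have "\<dots> = 2 powr (p * \<alpha>) * dyadic_moment \<alpha> k powr p"
    proof -
      have "2 powr (real k + 1) * 2 powr ((real k + 1) * (p * \<alpha> - 1)) = 2 powr (p * \<alpha>) * 2 powr (\<alpha> * k * p)"
        unfolding powr_add[symmetric] by (simp add: algebra_simps)
      then show ?thesis unfolding dyad by (simp add: mult_ac)
    qed
    finally show ?thesis .
  qed
  have lower: "(1/4) powr p * 2 powr (- (p * \<alpha>)) * dyadic_moment \<alpha> (Suc k) powr p \<le> b k" for k
  proof -
    have "(1/4) powr p * 2 powr (- (p * \<alpha>)) * dyadic_moment \<alpha> (Suc k) powr p
       = 2 powr real k * (?l k)"
    proof -
      have "2 powr real k * 2 powr (real k * (p * \<alpha> - 1)) = 2 powr (- (p * \<alpha>)) * 2 powr (\<alpha> * real (Suc k) * p)"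
        unfolding powr_add[symmetric] by (simp add: algebra_simps)
      moreover have "((real k + 2) / 4) powr p = (1/4) powr p * (real (Suc k) + 1) powr p"
        by (simp add: powr_mult[symmetric] add.commute)
      ultimately show ?thesis unfolding dyad by (simp add: mult_ac)
    qed
    also have "\<dots> = (\<Sum>n\<in>(?blk k). ?l k)"
      by (simp only: sum_constant card) (simp add: powr_realpow)
    also have "\<dots> \<le> b k"
      unfolding b_def
    proof (rule sum_mono)
      fix n :: nat assume n: "n \<in> (?blk k)"
      have "2 powr (real k * (p * \<alpha> - 1)) = (2 ^ k) powr (p * \<alpha> - 1)"
        by (simp add: powr_powr flip: powr_realpow)
      also have "\<dots> \<le> real (n + 1) powr (p * \<alpha> - 1)"
        using range[OF n] p by (intro powr_mono2) auto
      finally have 1: "2 powr (real k * (p * \<alpha> - 1)) \<le> real (n + 1) powr (p * \<alpha> - 1)" .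
      have "M (Suc k) \<le> moment \<mu> n" unfolding M_def by (rule moment_antimono) (use n in auto)
      then have 2: "M (Suc k) powr p \<le> moment \<mu> n powr p" using p M by (intro powr_mono2) auto
      \<comment> \<open>squared, this is \<open>(2 ^ k - 1)\<^sup>2 \<ge> 0\<close>\<close>
      have "2 powr ((real k + 2) / 2) \<le> 2 ^ k + 1"
      proof (rule power2_le_imp_le)
        have "(2 powr ((real k + 2) / 2))\<^sup>2 = 2 powr (real k + 2)"
          by (simp only: power2_eq_square field_sum_of_halves flip: powr_add)
        also have "\<dots> = 4 * 2 ^ k" by (simp add: powr_add powr_realpow)
        also have "\<dots> \<le> (2 ^ k + 1)\<^sup>2"
          using zero_le_power2[of "2 ^ k - 1 :: real"] by (simp add: power2_eq_square algebra_simps)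
        finally show "(2 powr ((real k + 2) / 2))\<^sup>2 \<le> (2 ^ k + 1)\<^sup>2" .
      qed auto
      then have le: "2 powr ((real k + 2) / 2) \<le> real n + 2" using range[OF n] by simp
      have "(real k + 2) / 4 = (real k + 2) / 2 * (1 / 2)" by simp
      also have "\<dots> \<le> (real k + 2) / 2 * ln 2" using ln2_ge_two_thirds by (intro mult_left_mono) auto
      also have "\<dots> = ln (2 powr ((real k + 2) / 2))" by (simp add: ln_powr)
      also have "\<dots> \<le> ln (real n + 2)" using le by (subst ln_le_cancel_iff) auto
      finally have 3: "((real k + 2) / 4) powr p \<le> ln (real n + 2) powr p" using p by (intro powr_mono2) auto
      show "?l k \<le> a n"
        unfolding a_def by (intro mult_mono 1 2 3) auto
    qed
    finally show ?thesis .
  qed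
  have "summable a \<longleftrightarrow> summable b"
    unfolding b_def by (rule summable_dyadic_blocks_iff[OF a])
  also have "\<dots> \<longleftrightarrow> summable (\<lambda>k. dyadic_moment \<alpha> k powr p)"
  proof
    assume "summable b"
    then have "summable (\<lambda>k. (1/4) powr p * 2 powr (- (p * \<alpha>)) * dyadic_moment \<alpha> (Suc k) powr p)"
      by (rule summable_comparison_test'[of _ 0]) (use lower in auto)
    then have "summable (\<lambda>k. dyadic_moment \<alpha> (Suc k) powr p)" by (subst (asm) summable_cmult_iff) auto
    then show "summable (\<lambda>k. dyadic_moment \<alpha> k powr p)" by (subst (asm) summable_Suc_iff)
  next
    assume "summable (\<lambda>k. dyadic_moment \<alpha> k powr p)"
    then have "summable (\<lambda>k. 2 powr (p * \<alpha>) * dyadic_moment \<alpha> k powr p)" by (rule summable_mult)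
    then show "summable b"
      by (rule summable_comparison_test'[of _ 0]) (use upper a in \<open>auto simp: b_def sum_nonneg\<close>)
  qed
  finally show ?thesis unfolding a_def .
qed

section \<open>The logarithm as a test function\<close>

definition log_test :: "complex \<Rightarrow> complex" where
  "log_test z = (if cmod z < 1 then - ln (1 - z) else 0)"

lemma log_test_sums:
  assumes "cmod z < 1"
  shows "(\<lambda>n. (1 / of_nat n) * z ^ n) sums log_test z"
proof -
  have "(\<lambda>n. - (- ((- (- z)) ^ n) / of_nat n)) sums - ln (1 + - z)"
    using assms by (intro sums_minus Ln_series') simp
  then show ?thesis using assms by (simp add: log_test_def)
qed

lemma log_test_holomorphic: "log_test holomorphic_on unit_disk"
  by (rule powser_holomorphic) (rule log_test_sums)

lemma deriv_log_test:
  assumes "cmod z < 1"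
  shows "deriv log_test z = 1 / (1 - z)"
proof -
  have "0 < Re (1 - z)" using assms complex_Re_le_cmod[of z] by simp
  then have "1 - z \<notin> \<real>\<^sub>\<le>\<^sub>0" by (auto simp: complex_nonpos_Reals_iff)
  then have "((\<lambda>z. - ln (1 - z)) has_field_derivative 1 / (1 - z)) (at z)"
    by (auto intro!: derivative_eq_intros simp: divide_inverse)
  then have "(log_test has_field_derivative 1 / (1 - z)) (at z)"
    by (rule has_field_derivative_transform_within_open[of _ _ _ unit_disk])
       (use assms in \<open>auto simp: log_test_def\<close>)
  then show ?thesis by (rule DERIV_imp_deriv)
qed

text \<open>
  For angles up to \<open>\<pi> / 2\<close>, the modulus is at least the distance \<open>sin \<theta>\<close> of \<open>cis (- \<theta>)\<close> from the real line; for larger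
  angles the real part of \<open>1 - r cis \<theta>\<close> is at least \<open>1\<close>.
\<close>

lemma norm_one_minus_cis_ge:
  assumes r: "0 \<le> r" "r < 1" and \<theta>: "0 \<le> \<theta>" "\<theta> \<le> pi"
  shows "(1 - r + \<theta>) / 8 \<le> cmod (1 - of_real r * cis \<theta>)"
proof -
  have 1: "1 - r \<le> cmod (1 - of_real r * cis \<theta>)"
    using norm_triangle_ineq2[of 1 "of_real r * cis \<theta>"] r by (simp add: norm_mult)
  have "\<theta> / 4 \<le> cmod (1 - of_real r * cis \<theta>)"
  proof (cases "\<theta> \<le> pi / 2")
    case True
    have "\<theta> / 4 \<le> sin \<theta>"
    proof (cases "\<theta> \<le> 1")
      case True
      then show ?thesis using sin_ge_half[of \<theta>] \<theta> by simp
    next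
      case False
      have "1 / 2 \<le> sin (1 :: real)" using sin_ge_half[of 1] by simp
      also have "\<dots> \<le> sin \<theta>" using False True by (intro sin_monotone_2pi_le) (use pi_gt3 in auto)
      finally show ?thesis using True pi_less_4 by simp
    qed
    also have "sin \<theta> \<le> cmod (cis (- \<theta>) - of_real r)"
      using abs_Im_le_cmod[of "cis (- \<theta>) - of_real r"] by simp
    also have "\<dots> = cmod (1 - of_real r * cis \<theta>)"
    proof -
      have "cis (- \<theta>) - of_real r = cis (- \<theta>) * (1 - of_real r * cis \<theta>)"
        by (simp add: right_diff_distrib mult.left_commute cis_mult)
      then show ?thesis by (simp add: norm_mult)
    qed
    finally show ?thesis .
  next
    case False
    have "cos \<theta> \<le> cos (pi / 2)" using False \<theta> by (intro cos_monotone_0_pi_le) auto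
    then have "r * cos \<theta> \<le> 0" using r by (simp add: mult_nonneg_nonpos)
    then have "1 \<le> Re (1 - of_real r * cis \<theta>)" by simp
    also have "\<dots> \<le> cmod (1 - of_real r * cis \<theta>)" by (rule complex_Re_le_cmod)
    finally show ?thesis using \<theta> pi_less_4 by simp
  qed
  with 1 \<theta> show ?thesis by simp
qed

lemma norm_one_minus_cis_powr_le:
  assumes r: "0 \<le> r" "r < 1" and \<theta>: "0 \<le> \<theta>" "\<theta> \<le> 2 * pi" and s: "1 < s"
  shows "cmod (1 - of_real r * cis \<theta>) powr (- s) \<le> 8 powr s * ((1 - r + \<theta>) powr (- s) + (1 - r + 2 * pi - \<theta>) powr (- s))"
proof -
  have est: "cmod (1 - of_real r * cis \<phi>) powr (- s) \<le> 8 powr s * (1 - r + \<phi>) powr (- s)"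
    if \<phi>: "0 \<le> \<phi>" "\<phi> \<le> pi" for \<phi>
  proof -
    have "cmod (1 - of_real r * cis \<phi>) powr (- s) \<le> ((1 - r + \<phi>) / 8) powr (- s)"
      using norm_one_minus_cis_ge[OF r \<phi>] s r \<phi> by (intro powr_mono2') auto
    also have "\<dots> = 8 powr s * (1 - r + \<phi>) powr (- s)"
      using r \<phi> by (simp add: powr_divide powr_minus field_simps)
    finally show ?thesis .
  qed
  show ?thesis
  proof (cases "\<theta> \<le> pi")
    case True
    have "8 powr s * (1 - r + \<theta>) powr (- s) \<le> 8 powr s * ((1 - r + \<theta>) powr (- s) + (1 - r + 2 * pi - \<theta>) powr (- s))"
      by (intro mult_left_mono) auto
    with est[of \<theta>] True \<theta> show ?thesis by linarith
  next
    case False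
    have "cis (2 * pi - \<theta>) = cnj (cis \<theta>)" by (simp add: cis_cnj complex_eq_iff)
    then have "1 - of_real r * cis (2 * pi - \<theta>) = cnj (1 - of_real r * cis \<theta>)" by simp
    then have "cmod (1 - of_real r * cis \<theta>) = cmod (1 - of_real r * cis (2 * pi - \<theta>))" by (simp only: complex_mod_cnj)
    then have "cmod (1 - of_real r * cis \<theta>) powr (- s) \<le> 8 powr s * (1 - r + (2 * pi - \<theta>)) powr (- s)"
      using est[of "2 * pi - \<theta>"] False \<theta> by simp
    also have "\<dots> \<le> 8 powr s * ((1 - r + \<theta>) powr (- s) + (1 - r + 2 * pi - \<theta>) powr (- s))"
      by (intro mult_left_mono) (auto simp: algebra_simps)
    finally show ?thesis .
  qed
qed

text \<open>
  The derivative is \<open>1 / (1 - z)\<close>, so up to constants the integral mean to the power \<open>s\<close> is \<open>\<integral> (1 - r + \<theta>) powr (- s) d\<theta>\<close>, which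
  is of order \<open>(1 - r) powr (1 - s)\<close> as \<open>s > 1\<close>.
\<close>

lemma log_test_mem_mean_lipschitz:
  assumes s: "1 < s"
  shows "log_test \<in> mean_lipschitz s"
proof -
  define K where "K = (1 / (2 * pi) * (8 powr s / (s - 1) * 2)) powr (1 / s)"
  have "(1 - r) powr (1 - 1 / s) * integral_mean s r (deriv log_test) \<le> K" if r: "0 \<le> r" "r < 1" for r
  proof -
    define g where "g \<theta> = cmod (1 - of_real r * cis \<theta>) powr (- s)" for \<theta>
    define G where "G \<theta> = 8 powr s * ((1 - r + \<theta>) powr (- s) + (1 - r + 2 * pi - \<theta>) powr (- s))" for \<theta>
    define P where "P \<theta> = 8 powr s / (s - 1) * ((1 - r + 2 * pi - \<theta>) powr (1 - s) - (1 - r + \<theta>) powr (1 - s))" for \<theta>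
    have nz: "1 - of_real r * cis \<theta> \<noteq> 0" for \<theta>
      using norm_triangle_ineq2[of 1 "of_real r * cis \<theta>"] r by (auto simp: norm_mult)
    have "(G has_integral (P (2 * pi) - P 0)) {0..2 * pi}"
    proof (rule fundamental_theorem_of_calculus)
      fix \<theta> assume \<theta>: "\<theta> \<in> {0..2 * pi}"
      define A B where "A = (1 - r + \<theta>) powr (- s)" and "B = (1 - r + 2 * pi - \<theta>) powr (- s)"
      have "((\<lambda>\<theta>. (1 - r + \<theta>) powr (1 - s)) has_real_derivative (1 - s) * A) (at \<theta>)"
        "((\<lambda>\<theta>. (1 - r + 2 * pi - \<theta>) powr (1 - s)) has_real_derivative (s - 1) * B) (at \<theta>)"
        unfolding A_def B_def using \<theta> r by (auto intro!: derivative_eq_intros simp: algebra_simps)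
      from DERIV_cmult[OF DERIV_diff[OF this(2,1)], of "8 powr s / (s - 1)"]
      have "(P has_real_derivative 8 powr s / (s - 1) * ((s - 1) * B - (1 - s) * A)) (at \<theta>)"
        unfolding P_def .
      also have "8 powr s / (s - 1) * ((s - 1) * B - (1 - s) * A) = 8 powr s / (s - 1) * ((s - 1) * (A + B))"
        by (simp add: algebra_simps)
      also have "\<dots> = G \<theta>" using s by (simp add: G_def A_def B_def)
      finally have "(P has_real_derivative G \<theta>) (at \<theta>)" .
      then show "(P has_vector_derivative G \<theta>) (at \<theta> within {0..2 * pi})"
        by (simp add: has_real_derivative_iff_has_vector_derivative has_vector_derivative_at_within)
    qed simp
    then have G: "G integrable_on {0..2 * pi}" "integral {0..2 * pi} G = P (2 * pi) - P 0"
      by (auto simp: has_integral_iff)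
    have "continuous_on {0..2 * pi} g"
      unfolding g_def using nz by (intro continuous_intros) auto
    then have g: "g integrable_on {0..2 * pi}" by (rule integrable_continuous_real)
    have "integral {0..2 * pi} g \<le> integral {0..2 * pi} G"
      using norm_one_minus_cis_powr_le[OF r _ _ s] by (intro integral_le g G) (auto simp: g_def G_def)
    also have "\<dots> = 8 powr s / (s - 1) * (2 * (1 - r) powr (1 - s) - 2 * (1 - r + 2 * pi) powr (1 - s))"
      unfolding G(2) P_def by (simp add: algebra_simps)
    also have "\<dots> \<le> 8 powr s / (s - 1) * (2 * (1 - r) powr (1 - s))"
      using s by (intro mult_left_mono) auto
    finally have int: "integral {0..2 * pi} g \<le> 8 powr s / (s - 1) * 2 * (1 - r) powr (1 - s)" by simp
    have ge0: "0 \<le> integral {0..2 * pi} g" by (rule integral_nonneg[OF g]) (simp add: g_def)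
    have "norm (deriv log_test (of_real r * cis \<theta>)) powr s = g \<theta>" for \<theta>
    proof -
      have "deriv log_test (of_real r * cis \<theta>) = 1 / (1 - of_real r * cis \<theta>)"
        using r by (intro deriv_log_test) (simp add: norm_mult)
      then show ?thesis
        unfolding g_def by (simp only: norm_divide norm_one powr_divide powr_one_eq_one powr_minus_divide)
    qed
    then have "integral_mean s r (deriv log_test) = (1 / (2 * pi) * integral {0..2 * pi} g) powr (1 / s)"
      by (simp add: integral_mean_def)
    also have "\<dots> \<le> (1 / (2 * pi) * (8 powr s / (s - 1) * 2 * (1 - r) powr (1 - s))) powr (1 / s)"
      using ge0 int s by (intro powr_mono2 mult_left_mono) auto
    also have "\<dots> = K * ((1 - r) powr (1 - s)) powr (1 / s)"
    proof -
      have "1 / (2 * pi) * (8 powr s / (s - 1) * 2 * (1 - r) powr (1 - s)) = (1 / (2 * pi) * (8 powr s / (s - 1) * 2)) * (1 - r) powr (1 - s)"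
        by simp
      then show ?thesis unfolding K_def using s by (simp only: powr_mult)
    qed
    also have "((1 - r) powr (1 - s)) powr (1 / s) = (1 - r) powr (1 / s - 1)"
      using s by (simp add: powr_powr field_simps)
    finally have "(1 - r) powr (1 - 1 / s) * integral_mean s r (deriv log_test)
       \<le> (1 - r) powr (1 - 1 / s) * (K * (1 - r) powr (1 / s - 1))"
      by (intro mult_left_mono) auto
    also have "\<dots> = K" using r by (simp add: mult.left_commute flip: powr_add)
    finally show ?thesis .
  qed
  then show ?thesis
    using log_test_holomorphic by (auto simp: mean_lipschitz_def H_disk_def log_test_def bdd_above_def intro!: exI[of _ K])
qed

lemma diffs_funpow:
  fixes c :: "nat \<Rightarrow> complex"
  shows "(diffs ^^ m) c n = fact (n + m) / fact n * c (n + m)"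
proof (induction m arbitrary: n)
  case (Suc m)
  have "(diffs ^^ Suc m) c n = of_nat (Suc n) * (fact (Suc n + m) / fact (Suc n) * c (Suc n + m))"
    by (simp add: diffs_def Suc.IH)
  also have "\<dots> = fact (n + Suc m) / fact n * c (n + Suc m)"
  proof -
    have "of_nat (Suc n) * (x / fact (Suc n)) = x / (fact n :: complex)" for x
      unfolding fact_Suc times_divide_eq_right by (simp del: of_nat_Suc)
    from this[of "fact (Suc n + m) * c (Suc n + m)"] show ?thesis
      by (simp only: times_divide_eq_left add_Suc add_Suc_right)
  qed
  finally show ?case .
qed simp

lemma taylor_coeff_powser:
  assumes "\<And>z. cmod z < 1 \<Longrightarrow> (\<lambda>n. c n * z ^ n) sums G z"
  shows "taylor_coeff G k = c k"
proof -
  have "(\<lambda>n. (diffs ^^ k) c n * 0 ^ n) sums (deriv ^^ k) G 0"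
    by (rule powser_higher_deriv_sums[OF assms]) auto
  then have "(deriv ^^ k) G 0 = (diffs ^^ k) c 0"
    by (metis powser_sums_zero_iff)
  then show ?thesis by (simp add: taylor_coeff_def diffs_funpow)
qed

lemma cesaro_coeff_pos: "0 < \<alpha> \<Longrightarrow> 0 < cesaro_coeff \<alpha> j"
  by (simp add: cesaro_coeff_pochhammer pochhammer_pos)

text \<open>
  The quotient of \<open>j powr (\<alpha> - 1)\<close> and the coefficient is the sequence \<open>Gamma_series'\<close>, which converges to \<open>Gamma \<alpha>\<close>.
\<close>

lemma cesaro_coeff_ge_powr:
  assumes \<alpha>: "0 < \<alpha>"
  obtains c where "0 < c" "\<And>j. 1 \<le> j \<Longrightarrow> c * real j powr (\<alpha> - 1) \<le> cesaro_coeff \<alpha> j"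
proof -
  have "\<alpha> \<notin> \<int>\<^sub>\<le>\<^sub>0" using \<alpha> by (auto elim!: nonpos_Ints_cases)
  then have "Bseq (Gamma_series' \<alpha>)"
    using Gamma_series'_LIMSEQ[of \<alpha>] by (intro convergent_imp_Bseq) (auto simp: convergent_def)
  then obtain B where B: "0 < B" "\<And>n. \<bar>Gamma_series' \<alpha> n\<bar> \<le> B" by (auto simp: Bseq_def)
  show ?thesis
  proof (rule that[of "1 / B"])
    fix j :: nat assume j: "1 \<le> j"
    have eq: "Gamma_series' \<alpha> j * cesaro_coeff \<alpha> j = real j powr (\<alpha> - 1)"
    proof -
      have "fact j = real j * fact (j - 1)" using j by (simp add: fact_reduce)
      moreover have "exp (\<alpha> * ln (real j)) = real j powr \<alpha>" using j by (simp add: powr_def)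
      moreover have "pochhammer \<alpha> j \<noteq> 0" using pochhammer_pos[OF \<alpha>, of j] by simp
      ultimately show ?thesis
        using j by (simp add: Gamma_series'_def cesaro_coeff_pochhammer[OF \<alpha>] powr_diff)
    qed
    have "Gamma_series' \<alpha> j * cesaro_coeff \<alpha> j \<le> B * cesaro_coeff \<alpha> j"
      using B(2)[of j] cesaro_coeff_pos[OF \<alpha>, of j] by (intro mult_right_mono) auto
    then show "1 / B * real j powr (\<alpha> - 1) \<le> cesaro_coeff \<alpha> j"
      unfolding eq using B(1) by (simp add: field_simps)
  qed (use B in auto)
qed

text \<open>
  The Taylor coefficients of \<open>log (1 / (1 - z)) (1 - z) powr (- \<alpha>)\<close>. The term \<open>k = 0\<close> vanishes because \<open>1 / 0 = 0\<close>.
\<close>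

definition log_coeff :: "real \<Rightarrow> nat \<Rightarrow> real" where
  "log_coeff \<alpha> n = (\<Sum>k\<le>n. cesaro_coeff \<alpha> (n - k) * (1 / real k))"

lemma integrand_coeff_log_test: "integrand_coeff \<alpha> log_test n = of_real (log_coeff \<alpha> n)"
  by (simp add: integrand_coeff_def log_coeff_def taylor_coeff_powser[OF log_test_sums])

lemma log_coeff_nonneg: "0 < \<alpha> \<Longrightarrow> 0 \<le> log_coeff \<alpha> n"
  unfolding log_coeff_def by (intro sum_nonneg mult_nonneg_nonneg less_imp_le[OF cesaro_coeff_pos]) auto

lemma harm_power_2_ge: "(real i + 2) / 4 \<le> harm (2 ^ i)"
proof -
  have "real i * (2 / 3) \<le> real i * ln 2" using ln2_ge_two_thirds by (intro mult_left_mono) auto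
  also have "\<dots> = ln (2 ^ i)" by (simp add: ln_realpow)
  also have "\<dots> \<le> ln (real (2 ^ i) + 1)" by (subst ln_le_cancel_iff) (auto intro: add_pos_pos)
  also have "\<dots> \<le> harm (2 ^ i)" by (rule ln_le_harm)
  finally have 1: "real i * (2 / 3) \<le> harm (2 ^ i)" .
  have "harm 1 \<le> (harm (2 ^ i) :: real)" by (intro harm_mono) simp
  then have "1 \<le> (harm (2 ^ i) :: real)" by (simp add: harm_expand)
  with 1 show ?thesis by simp
qed

text \<open>
  For \<open>k \<le> n / 2\<close> the binomial coefficient of index \<open>n - k\<close> is still of order \<open>n powr (\<alpha> - 1)\<close>, and the sum of \<open>1 / k\<close>
  over these \<open>k\<close> supplies the logarithm.
\<close>

lemma log_coeff_ge:
  assumes \<alpha>: "0 < \<alpha>"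
  obtains c where "0 < c"
    "\<And>j n. \<lbrakk>1 \<le> j; 2 ^ j \<le> n; n < 2 ^ Suc j\<rbrakk> \<Longrightarrow> c * (2 powr (j * (\<alpha> - 1)) * (real j + 1)) \<le> log_coeff \<alpha> n"
proof -
  obtain c where c: "0 < c" "\<And>j. 1 \<le> j \<Longrightarrow> c * real j powr (\<alpha> - 1) \<le> cesaro_coeff \<alpha> j"
    using cesaro_coeff_ge_powr[OF \<alpha>] by blast
  let ?w = "2 powr (- \<bar>\<alpha> - 1\<bar>)"
  show ?thesis
  proof (rule that[of "c * ?w / 4"])
    fix j n :: nat assume j: "1 \<le> j" and n: "2 ^ j \<le> n" "n < 2 ^ Suc j"
    obtain i where i: "j = Suc i" using j by (cases j) auto
    have lower: "c * ?w * 2 powr (j * (\<alpha> - 1)) \<le> cesaro_coeff \<alpha> (n - k)"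
      if k: "k \<in> {1..2 ^ i}" for k
    proof -
      have nk: "2 ^ i \<le> n - k" "n - k \<le> 2 ^ Suc j" using k n i by auto
      then have "real (2 ^ i) \<le> real (n - k)" "real (n - k) \<le> real (2 ^ Suc j)" by (simp_all only: of_nat_le_iff)
      then have nk': "2 powr (real j - 1) \<le> real (n - k)" "real (n - k) \<le> 2 powr (real j + 1)"
        by (simp_all add: i powr_realpow powr_add)
      have "?w * 2 powr (j * (\<alpha> - 1)) \<le> real (n - k) powr (\<alpha> - 1)"
      proof (cases "1 \<le> \<alpha>")
        case True
        have "?w * 2 powr (j * (\<alpha> - 1)) = (2 powr (real j - 1)) powr (\<alpha> - 1)"
          using True by (simp add: powr_powr algebra_simps flip: powr_add)
        also have "\<dots> \<le> real (n - k) powr (\<alpha> - 1)" using True nk' by (intro powr_mono2) auto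
        finally show ?thesis .
      next
        case False
        have "?w * 2 powr (j * (\<alpha> - 1)) = (2 powr (real j + 1)) powr (\<alpha> - 1)"
          using False by (simp add: powr_powr algebra_simps flip: powr_add)
        also have "\<dots> \<le> real (n - k) powr (\<alpha> - 1)"
        proof (rule powr_mono2')
          have "0 < 2 powr (real j - 1)" by simp
          then show "0 < real (n - k)" using nk'(1) by linarith
        qed (use False nk' in auto)
        finally show ?thesis .
      qed
      then have "c * (?w * 2 powr (j * (\<alpha> - 1))) \<le> c * real (n - k) powr (\<alpha> - 1)"
        using c(1) by (intro mult_left_mono) auto
      also have "\<dots> \<le> cesaro_coeff \<alpha> (n - k)"
      proof (rule c(2))
        have "1 \<le> (2::nat) ^ i" by simp
        then show "1 \<le> n - k" using nk(1) by linarith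
      qed
      finally show ?thesis by (simp only: mult.assoc)
    qed
    have "c * ?w / 4 * (2 powr (j * (\<alpha> - 1)) * (real j + 1))
       = c * ?w * 2 powr (j * (\<alpha> - 1)) * ((real i + 2) / 4)"
      by (simp add: i)
    also have "\<dots> \<le> c * ?w * 2 powr (j * (\<alpha> - 1)) * harm (2 ^ i)"
      using c(1) by (intro mult_left_mono harm_power_2_ge) auto
    also have "\<dots> = (\<Sum>k\<in>{1..2 ^ i}. c * ?w * 2 powr (j * (\<alpha> - 1)) * (1 / real k))"
      by (simp add: harm_def sum_distrib_left inverse_eq_divide)
    also have "\<dots> \<le> (\<Sum>k\<in>{1..2 ^ i}. cesaro_coeff \<alpha> (n - k) * (1 / real k))"
      by (intro sum_mono mult_right_mono lower) auto
    also have "\<dots> \<le> log_coeff \<alpha> n"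
      unfolding log_coeff_def
    proof (rule sum_mono2)
      show "{1..2 ^ i} \<subseteq> {..n}" using n by (auto simp: i)
    qed (use less_imp_le[OF cesaro_coeff_pos[OF \<alpha>]] in auto)
    finally show "c * ?w / 4 * (2 powr (j * (\<alpha> - 1)) * (real j + 1)) \<le> log_coeff \<alpha> n" .
  qed (use c(1) in auto)
qed

section \<open>Besov functions at dyadic radii\<close>

lemma norm_powser_ge_sum:
  fixes t :: "nat \<Rightarrow> real"
  assumes "(\<lambda>n. of_real (t n)) sums z" "\<And>n. 0 \<le> t n" "finite A"
  shows "(\<Sum>n\<in>A. t n) \<le> cmod z"
proof -
  have t: "t sums Re z" using sums_Re[OF assms(1)] by simp
  then have "(\<Sum>n\<in>A. t n) \<le> suminf t" using assms by (intro sum_le_suminf) (auto simp: sums_iff)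
  also have "\<dots> = Re z" using t by (simp add: sums_iff)
  also have "\<dots> \<le> cmod z" by (rule complex_Re_le_cmod)
  finally show ?thesis .
qed

lemma nn_integral_disk_area:
  assumes "f \<in> borel_measurable disk_area"
  shows "(\<integral>\<^sup>+z. f z \<partial>disk_area) = ennreal (1 / pi) * (\<integral>\<^sup>+z. f z * indicator unit_disk z \<partial>lborel)"
proof -
  have "f \<in> borel_measurable (restrict_space lborel unit_disk)"
    using assms by (simp add: disk_area_def)
  then show ?thesis
    unfolding disk_area_def by (simp add: nn_integral_scale_measure nn_integral_restrict_space)
qed

abbreviation radial_point :: "nat \<Rightarrow> complex" where
  "radial_point j \<equiv> of_real (1 - (1/2) ^ j)"

definition radial_disc :: "nat \<Rightarrow> complex set" where
  "radial_disc j = ball (radial_point j) ((1/2) ^ j / 4)"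

lemma radial_disc_subset: "ball (radial_point j) ((1/2) ^ j / 2) \<subseteq> unit_disk"
proof
  fix z assume "z \<in> ball (radial_point j) ((1/2) ^ j / 2)"
  then have "cmod (z - radial_point j) < (1/2) ^ j / 2" by (simp add: dist_norm norm_minus_commute)
  moreover have "cmod z \<le> cmod (radial_point j) + cmod (z - radial_point j)"
    using norm_triangle_ineq[of "radial_point j" "z - radial_point j"] by simp
  moreover have "cmod (radial_point j) = 1 - (1/2) ^ j"
    unfolding norm_of_real by (simp add: power_le_one)
  moreover have "0 < (1/2 :: real) ^ j" by simp
  ultimately have "cmod z < 1" by linarith
  then show "z \<in> unit_disk" by simp
qed

lemma radial_disc_norm:
  assumes "z \<in> radial_disc j"
  shows "(1/2) ^ j / 2 \<le> 1 - cmod z" "1 - cmod z \<le> 2 * (1/2) ^ j"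
proof -
  have "cmod (radial_point j - z) < (1/2) ^ j / 4"
    using assms by (simp add: radial_disc_def dist_norm)
  moreover have "\<bar>cmod (radial_point j) - cmod z\<bar> \<le> cmod (radial_point j - z)"
    by (rule norm_triangle_ineq3)
  moreover have "cmod (radial_point j) = 1 - (1/2) ^ j"
    unfolding norm_of_real by (simp add: power_le_one)
  moreover have "0 < (1/2 :: real) ^ j" by simp
  ultimately show "(1/2) ^ j / 2 \<le> 1 - cmod z" "1 - cmod z \<le> 2 * (1/2) ^ j" by linarith+
qed

lemma radial_disc_disjoint:
  assumes "i < j"
  shows "radial_disc i \<inter> radial_disc j = {}"
proof (rule ccontr)
  assume "radial_disc i \<inter> radial_disc j \<noteq> {}"
  then obtain z where z: "z \<in> radial_disc i" "z \<in> radial_disc j" by blast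
  have pow: "(1/2 :: real) ^ j \<le> (1/2) ^ Suc i" using assms by (intro power_decreasing) auto
  have pos: "0 < (1/2 :: real) ^ i" by simp
  have "dist (radial_point i) (radial_point j) < (1/2) ^ i / 4 + (1/2) ^ j / 4"
    using z by (intro dist_triangle_less_add[of _ z]) (auto simp: radial_disc_def dist_commute)
  moreover have "dist (radial_point i) (radial_point j) = (1/2) ^ i - (1/2) ^ j"
  proof -
    have "radial_point i - radial_point j = of_real ((1/2) ^ j - (1/2) ^ i)" by simp
    moreover have "(1/2 :: real) ^ j \<le> (1/2) ^ i" using assms by (intro power_decreasing) auto
    ultimately show ?thesis unfolding dist_norm by (simp only: norm_of_real)
  qed
  ultimately show False using pow pos by simp
qed

text \<open>
  Apply the area mean value inequality on the discs \<open>radial_disc j\<close>. They are disjoint, so the sum of the integrals over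
  them is at most the Besov integral, and on each of them the weight \<open>1 - \<bar>z\<bar>\<close> is comparable to \<open>2 powr (- j)\<close>.
\<close>

lemma besov_radial_summable:
  assumes p: "1 \<le> p" and g: "g \<in> besov p"
  defines "m \<equiv> besov_order p"
  shows "summable (\<lambda>j. 2 powr (- (real j * (m * p))) * cmod ((deriv ^^ m) g (radial_point j)) powr p)"
proof -
  define e where "e = m * p - 2"
  define h where "h = (deriv ^^ m) g"
  let ?I = "\<lambda>j z. indicator (radial_disc j) z * ennreal (besov_density p g z)"
  have ghol: "g holomorphic_on unit_disk" using g by (simp add: besov_def H_disk_def)
  have hol: "h holomorphic_on unit_disk"
    unfolding h_def using ghol by (intro holomorphic_higher_deriv) auto
  \<comment> \<open>the factor \<open>2 powr (- \<bar>e\<bar>)\<close> covers both signs of the exponent \<open>e\<close>\<close>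
  define V where "V j = 2 powr (- \<bar>e\<bar>) * 2 powr (- (real j * e)) * ((cmod (h (radial_point j)) / 2) powr p * ((1/2) ^ j / 4)\<^sup>2)" for j
  have V0: "0 \<le> V j" for j by (simp add: V_def)
  have dens: "besov_density p g z = cmod (h z) powr p * (1 - cmod z) powr e" for z
    by (simp add: besov_density_def h_def m_def e_def)
  have meas [measurable]: "(\<lambda>z. ennreal (besov_density p g z)) \<in> borel_measurable disk_area"
    by (rule besov_density_measurable[OF ghol])
  have disc_meas [measurable]: "radial_disc j \<in> sets disk_area" for j
  proof (rule emeasure_disk_area(1))
    have "radial_disc j \<subseteq> ball (radial_point j) ((1/2) ^ j / 2)"
      unfolding radial_disc_def by (intro subset_ball) simp
    then show "radial_disc j \<subseteq> unit_disk" using radial_disc_subset by (rule order_trans)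
  qed (simp add: radial_disc_def)
  have local: "ennreal (V j) \<le> (\<integral>\<^sup>+z. ?I j z \<partial>disk_area)" for j
  proof -
    define a where "a = radial_point j"
    define \<rho> where "\<rho> = (1/2 :: real) ^ j / 4"
    let ?J = "\<lambda>z. indicator (ball a \<rho>) z * ennreal (cmod (h z) powr p)"
    define w where "w = 2 powr (- \<bar>e\<bar>) * 2 powr (- (real j * e))"
    have disc: "radial_disc j = ball a \<rho>" by (simp add: radial_disc_def a_def \<rho>_def)
    have \<rho>: "0 < \<rho>" "\<rho> < (1/2) ^ j / 2" by (auto simp: \<rho>_def)
    have weight: "w \<le> (1 - cmod z) powr e" if z: "z \<in> radial_disc j" for z
    proof -
      note b = radial_disc_norm[OF z]
      have pj: "2 powr (- (real j * e)) = ((1/2) ^ j) powr e"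
        unfolding half_power_powr by (simp add: powr_powr)
      show ?thesis
      proof (cases "0 \<le> e")
        case True
        have "w = ((1/2) ^ j / 2) powr e"
        proof -
          have "((1/2 :: real) ^ j / 2) powr e = ((1/2) ^ j) powr e / 2 powr e" by (simp add: powr_divide)
          moreover have "2 powr (- \<bar>e\<bar>) = 1 / 2 powr e"
            by (simp only: abs_of_nonneg[OF True] powr_minus_divide)
          ultimately show ?thesis unfolding w_def pj by simp
        qed
        also have "\<dots> \<le> (1 - cmod z) powr e" using True b by (intro powr_mono2) auto
        finally show ?thesis .
      next
        case False
        have "w = (2 * (1/2) ^ j) powr e"
          using False unfolding w_def pj by (subst powr_mult) auto
        also have "\<dots> \<le> (1 - cmod z) powr e"
        proof (rule powr_mono2')
          show "0 < 1 - cmod z" using b(1) zero_less_power[of "1/2 :: real" j] by linarith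
        qed (use False b in auto)
        finally show ?thesis .
      qed
    qed
    have hol': "h holomorphic_on ball a ((1/2) ^ j / 2)"
      unfolding a_def by (rule holomorphic_on_subset[OF hol radial_disc_subset])
    have "ennreal (V j) = ennreal (1 / pi) * (ennreal w * (ennreal ((cmod (h a) / 2) powr p) * emeasure lborel (ball a \<rho>)))"
    proof -
      have "emeasure lborel (ball a \<rho>) = ennreal (pi * \<rho>\<^sup>2)"
        using \<rho> by (simp add: emeasure_ball unit_ball_vol_2)
      moreover have "V j = (1 / pi) * (w * ((cmod (h a) / 2) powr p * (pi * \<rho>\<^sup>2)))"
        by (simp add: V_def w_def a_def \<rho>_def)
      moreover have "ennreal x * (ennreal y * (ennreal u * ennreal v)) = ennreal (x * (y * (u * v)))"
        if "0 \<le> x" "0 \<le> y" "0 \<le> u" "0 \<le> v" for x y u v :: real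
        using that by (simp add: ennreal_mult)
      moreover have "0 \<le> w" by (simp add: w_def)
      ultimately show ?thesis by simp
    qed
    also have "\<dots> \<le> ennreal (1 / pi) * (ennreal w * (\<integral>\<^sup>+z. ?J z \<partial>lborel))"
      by (intro mult_left_mono powr_norm_center_le_integral_ball[OF hol' \<rho> p]) auto
    also have "\<dots> \<le> ennreal (1 / pi) * (\<integral>\<^sup>+z. ?I j z * indicator unit_disk z \<partial>lborel)"
    proof (intro mult_left_mono)
      have "ennreal w * (\<integral>\<^sup>+z. ?J z \<partial>lborel)
         = (\<integral>\<^sup>+z. ennreal w * ?J z \<partial>lborel)"
        using borel_measurable_holomorphic_powr[OF hol' \<rho>(2)] by (rule nn_integral_cmult[symmetric])
      also have "\<dots> \<le> (\<integral>\<^sup>+z. ?I j z * indicator unit_disk z \<partial>lborel)"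
      proof (rule nn_integral_mono)
        fix z
        show "ennreal w * ?J z
          \<le> ?I j z * indicator unit_disk z"
        proof (cases "z \<in> radial_disc j")
          case True
          then have zd: "z \<in> unit_disk" using radial_disc_norm(1)[OF True] zero_less_power[of "1/2 :: real" j] by (simp del: zero_less_power)
          have "w * cmod (h z) powr p \<le> besov_density p g z"
            unfolding dens using mult_left_mono[OF weight[OF True], of "cmod (h z) powr p"] by (simp add: mult.commute)
          then show ?thesis
            using True zd by (simp add: disc w_def flip: ennreal_mult) (auto intro!: ennreal_leI)
        qed (simp add: disc)
      qed
      finally show "ennreal w * (\<integral>\<^sup>+z. ?J z \<partial>lborel)
        \<le> (\<integral>\<^sup>+z. ?I j z * indicator unit_disk z \<partial>lborel)" .
    qed simp
    also have "\<dots> = (\<integral>\<^sup>+z. ?I j z \<partial>disk_area)"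
      by (intro nn_integral_disk_area[symmetric]) measurable
    finally show ?thesis .
  qed
  define I where "I = enn2real (besov_integral p g)"
  have I: "besov_integral p g = ennreal I" "0 \<le> I" using g by (auto simp: I_def besov_def)
  have "summable V"
  proof (rule summableI_nonneg_bounded[OF V0])
    fix K
    have one: "(\<Sum>j<K. indicator (radial_disc j) z) \<le> (1 :: ennreal)" for z
    proof (cases "\<exists>j<K. z \<in> radial_disc j")
      case True
      then obtain j where j: "j < K" "z \<in> radial_disc j" by blast
      have "z \<notin> radial_disc i" if "i \<noteq> j" for i
        using radial_disc_disjoint[of i j] radial_disc_disjoint[of j i] j that by (cases "i < j") auto
      then have "(\<Sum>j<K. indicator (radial_disc j) z) = (\<Sum>i<K. if i = j then 1 else (0 :: ennreal))"
        using j by (intro sum.cong) (auto simp: indicator_def)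
      then show ?thesis by simp
    qed (auto simp: indicator_def)
    have "ennreal (\<Sum>j<K. V j) = (\<Sum>j<K. ennreal (V j))" using V0 by simp
    also have "\<dots> \<le> (\<Sum>j<K. \<integral>\<^sup>+z. ?I j z \<partial>disk_area)"
      by (intro sum_mono local)
    also have "\<dots> = (\<integral>\<^sup>+z. (\<Sum>j<K. ?I j z) \<partial>disk_area)"
      by (intro nn_integral_sum[symmetric]) measurable
    also have "\<dots> \<le> (\<integral>\<^sup>+z. ennreal (besov_density p g z) \<partial>disk_area)"
    proof (rule nn_integral_mono)
      fix z
      have "(\<Sum>j<K. ?I j z) \<le> 1 * ennreal (besov_density p g z)"
        unfolding sum_distrib_right[symmetric] by (intro mult_right_mono one) auto
      then show "(\<Sum>j<K. ?I j z) \<le> ennreal (besov_density p g z)" by simp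
    qed
    also have "\<dots> = ennreal I" by (simp add: I(1)[symmetric] besov_integral_eq)
    finally show "(\<Sum>j<K. V j) \<le> I" using I(2) by simp
  qed
  have "V j = (2 powr (- \<bar>e\<bar>) * (1/2) powr p / 16) * (2 powr (- (real j * (m * p))) * cmod (h (radial_point j)) powr p)" for j
  proof -
    have "((1/2 :: real) ^ j / 4)\<^sup>2 = 2 powr (- (2 * real j)) / 16"
      by (simp add: power2_eq_square half_power_powr flip: powr_add)
    moreover have "2 powr (- (real j * e)) * 2 powr (- (2 * real j)) = 2 powr (- (real j * (m * p)))"
      unfolding powr_add[symmetric] by (simp add: e_def algebra_simps)
    moreover have "(cmod (h (radial_point j)) / 2) powr p = (1/2) powr p * cmod (h (radial_point j)) powr p"
      by (simp add: powr_divide)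
    ultimately show ?thesis by (simp add: V_def mult_ac) (metis mult.assoc mult.commute)
  qed
  then have V_eq: "V = (\<lambda>j. (2 powr (- \<bar>e\<bar>) * (1/2) powr p / 16) * (2 powr (- (real j * (m * p))) * cmod (h (radial_point j)) powr p))"
    by (rule ext)
  from \<open>summable V\<close> have "summable (\<lambda>j. (2 powr (- \<bar>e\<bar>) * (1/2) powr p / 16) * (2 powr (- (real j * (m * p))) * cmod (h (radial_point j)) powr p))"
    unfolding V_eq .
  then show ?thesis
    unfolding h_def by (subst (asm) summable_cmult_iff) auto
qed

text \<open>
  At the radius \<open>r = 1 - 2 powr (- j)\<close> all terms of the power series are nonnegative. About \<open>2 ^ j\<close> of them have
  index near \<open>2 ^ j\<close>, and for these \<open>r ^ n\<close> is bounded below, the moment is at least that of order \<open>2 ^ (j + 1) - 1\<close>, and the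
  coefficient \<open>log_coeff\<close> is at least of order \<open>(j + 1) 2 powr (j (\<alpha> - 1))\<close>.
\<close>

theorem (in unit_interval_measure) dyadic_summable_of_log_test:
  assumes \<alpha>: "0 < \<alpha>" and p: "1 \<le> p" and g: "cesaro \<mu> \<alpha> log_test \<in> besov p"
  shows "summable (\<lambda>k. dyadic_moment \<alpha> k powr p)"
proof -
  define m where "m = besov_order p"
  have m: "m \<le> 2" by (simp add: m_def besov_order_def)
  define h where "h = (deriv ^^ m) (cesaro \<mu> \<alpha> log_test)"
  obtain c where c: "0 < c"
    "\<And>j n. \<lbrakk>1 \<le> j; 2 ^ j \<le> n; n < 2 ^ Suc j\<rbrakk> \<Longrightarrow> c * (2 powr (j * (\<alpha> - 1)) * (real j + 1)) \<le> log_coeff \<alpha> n"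
    using log_coeff_ge[OF \<alpha>] by blast
    let ?c = "\<lambda>j::nat. c * (2 powr (j * (\<alpha> - 1)) * (real j + 1))"
    let ?M = "\<lambda>j. moment \<mu> (2 ^ Suc j - 1)"
  define b where "b n = moment \<mu> n * log_coeff \<alpha> n" for n
  have b: "0 \<le> b n" for n by (simp add: b_def moment_nonneg log_coeff_nonneg[OF \<alpha>])
  have sums: "(\<lambda>n. of_real (fact (n + m) / fact n * b (n + m) * r ^ n)) sums h (of_real r)"
    if r: "0 \<le> r" "r < 1" for r
  proof -
    have "(\<lambda>n. (diffs ^^ m) (\<lambda>n. of_real (b n)) n * of_real r ^ n) sums h (of_real r)"
      unfolding h_def
    proof (rule powser_higher_deriv_sums)
      show "(\<lambda>n. of_real (b n) * z ^ n) sums cesaro \<mu> \<alpha> log_test z" if "cmod z < 1" for z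
        using cesaro_sums[OF log_test_holomorphic \<alpha> that] by (simp add: integrand_coeff_log_test b_def)
    qed (use r in simp)
    then show ?thesis by (simp add: diffs_funpow)
  qed
  define C where "C = exp (-3) * c / (8 * 2 powr \<alpha>)"
  have C: "0 < C" using c(1) by (simp add: C_def)
  have key: "C * 2 ^ (j * m) * dyadic_moment \<alpha> (Suc j) \<le> cmod (h (radial_point j))" if j: "2 \<le> j" for j
  proof -
    define r where "r = 1 - (1/2 :: real) ^ j"
    \<comment> \<open>shifted by the \<open>m\<close> derivatives, these indices stay in the dyadic block\<close>
    define A where "A = {2 ^ j..<2 ^ Suc j - m}"
    have r: "0 \<le> r" "r < 1" by (auto simp: r_def power_le_one)
    have "r \<in> layer j" by (auto simp: layer_def space_eq r_def power_le_one)
    then have r1: "exp (-1) \<le> r ^ (2 ^ j - 1)" by (rule power_layer_ge)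
    have four: "4 \<le> (2::nat) ^ j" using power_increasing[OF j, of "2::nat"] by simp
    \<comment> \<open>for \<open>j \<ge> 2\<close> the indices in \<open>A\<close> are at most \<open>3 (2 ^ j - 1)\<close>\<close>
    have rn: "exp (-3) \<le> r ^ n" if "n \<in> A" for n
    proof -
      have "exp (-3 :: real) = exp (-1) ^ 3" by (simp flip: exp_of_nat_mult)
      also have "\<dots> \<le> (r ^ (2 ^ j - 1)) ^ 3" using r1 by (intro power_mono) auto
      also have "\<dots> = r ^ ((2 ^ j - 1) * 3)" by (simp add: power_mult)
      also have "\<dots> \<le> r ^ n"
      proof (intro power_decreasing)
        show "n \<le> (2 ^ j - 1) * 3" using that four
          unfolding A_def atLeastLessThan_iff power_Suc by linarith
      qed (use r in auto)
      finally show ?thesis .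
    qed
    have lower: "2 ^ (j * m) * (?M j * ?c j) * exp (-3)
       \<le> fact (n + m) / fact n * b (n + m) * r ^ n" if n: "n \<in> A" for n
    proof -
      have nm: "2 ^ j \<le> n + m" "n + m < 2 ^ Suc j" using n by (auto simp: A_def)
      have "fact n * (2 ^ j) ^ m \<le> (fact (n + m) :: real)"
      proof -
        have "fact n * (2 ^ j) ^ m \<le> (fact n * (n + 1) ^ m :: nat)"
          using n by (intro mult_left_mono power_mono) (auto simp: A_def)
        also have "\<dots> \<le> fact (n + m)"
        proof (induction m)
          case (Suc m)
          have "fact n * (n + 1) ^ Suc m = (n + 1) * (fact n * (n + 1) ^ m)" by (simp add: algebra_simps)
          also have "\<dots> \<le> (n + Suc m) * fact (n + m)" using Suc.IH by (intro mult_mono) auto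
          finally show ?case by simp
        qed simp
        finally have "real (fact n * (2 ^ j) ^ m) \<le> real (fact (n + m))" by (simp only: of_nat_le_iff)
        then show ?thesis by simp
      qed
      then have 1: "2 ^ (j * m) \<le> (fact (n + m) / fact n :: real)"
        by (simp add: power_mult pos_le_divide_eq mult.commute)
      have 2: "?M j * ?c j \<le> b (n + m)"
        unfolding b_def
      proof (intro mult_mono)
        show "?M j \<le> moment \<mu> (n + m)" using nm by (intro moment_antimono) auto
        show "?c j \<le> log_coeff \<alpha> (n + m)"
          using j nm by (intro c(2)) auto
      qed (use moment_nonneg c(1) in auto)
      show ?thesis using c(1) by (intro mult_mono 1 2 rn[OF n] mult_nonneg_nonneg b moment_nonneg) auto
    qed
    have card: "(2 powr j) / 2 \<le> real (card A)"
    proof -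
      have "2 ^ j \<le> 2 * card A" using m four by (simp add: A_def)
      then have "real (2 ^ j) \<le> real (2 * card A)" by (simp only: of_nat_le_iff)
      then show ?thesis by (simp add: powr_realpow)
    qed
    define Q where "Q = 2 ^ (j * m) * (?M j * ?c j) * exp (-3)"
    have Q: "0 \<le> Q" unfolding Q_def using c(1) moment_nonneg by (intro mult_nonneg_nonneg) auto
    have "C * 2 ^ (j * m) * dyadic_moment \<alpha> (Suc j) \<le> (2 powr j) / 2 * Q"
    proof -
      have e1: "2 powr (\<alpha> * real (Suc j)) = 2 powr \<alpha> * 2 powr (\<alpha> * j)"
        unfolding powr_add[symmetric] by (simp add: algebra_simps)
      have e2: "2 powr j * 2 powr (j * (\<alpha> - 1)) = 2 powr (\<alpha> * j)"
        unfolding powr_add[symmetric] by (simp add: algebra_simps)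
      define Y where "Y = exp (-3) * c * 2 ^ (j * m) * ?M j * 2 powr (\<alpha> * j)"
      have Y: "0 \<le> Y" unfolding Y_def using c(1) moment_nonneg by (intro mult_nonneg_nonneg) auto
      have "C * 2 ^ (j * m) * dyadic_moment \<alpha> (Suc j) = Y * ((real j + 2) / 8)"
        unfolding dyadic_moment_def C_def e1 Y_def by (simp add: field_simps)
      also have "\<dots> \<le> Y * ((real j + 1) / 2)" using Y by (intro mult_left_mono) auto
      also have "\<dots> = (2 powr j) / 2 * Q"
        unfolding Y_def Q_def e2[symmetric] by (simp add: mult_ac)
      finally show ?thesis .
    qed
    also have "\<dots> \<le> real (card A) * Q" using card Q by (intro mult_right_mono)
    also have "\<dots> = (\<Sum>n\<in>A. Q)" by simp
    also have "\<dots> \<le> (\<Sum>n\<in>A. fact (n + m) / fact n * b (n + m) * r ^ n)"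
      unfolding Q_def by (intro sum_mono lower)
    also have "\<dots> \<le> cmod (h (of_real r))"
      using b r by (intro norm_powser_ge_sum[OF sums[OF r]]) (auto simp: A_def)
    finally show ?thesis by (simp add: r_def)
  qed
  define S where "S j = 2 powr (- (real j * (m * p))) * cmod (h (radial_point j)) powr p" for j
  have "summable S"
    unfolding S_def h_def m_def by (rule besov_radial_summable[OF p g])
  then have "summable (\<lambda>j. C powr p * dyadic_moment \<alpha> (Suc j) powr p)"
  proof (rule summable_comparison_test'[of _ 2])
    fix j :: nat assume j: "2 \<le> j"
    have "C powr p * dyadic_moment \<alpha> (Suc j) powr p = 2 powr (- (real j * (m * p))) * (C * 2 ^ (j * m) * dyadic_moment \<alpha> (Suc j)) powr p"
    proof -
      have "(2 ^ (j * m)) powr p = 2 powr (real j * (m * p))"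
        by (simp add: powr_powr mult.assoc flip: powr_realpow)
      then show ?thesis using C dyadic_moment_nonneg by (simp add: powr_mult powr_minus)
    qed
    also have "\<dots> \<le> S j"
      unfolding S_def using C dyadic_moment_nonneg p by (intro mult_left_mono powr_mono2 key j) auto
    finally show "norm (C powr p * dyadic_moment \<alpha> (Suc j) powr p) \<le> S j" by simp
  qed
  then have "summable (\<lambda>j. dyadic_moment \<alpha> (Suc j) powr p)"
    using C by (subst (asm) summable_cmult_iff) auto
  then show ?thesis by (subst (asm) summable_Suc_iff)
qed

section \<open>The characterization\<close>

theorem theorem1p1:
  fixes \<alpha> s p :: real
    and \<mu> :: "real measure"
    and X :: "(complex \<Rightarrow> complex) set"
    and N :: "(complex \<Rightarrow> complex) \<Rightarrow> real"
  assumes "0 < \<alpha>" and "1 < s" and "max 1 (1 / \<alpha>) \<le> p"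
    and "finite_measure \<mu>" and "sets \<mu> = sets (restrict_space borel {0..<1})"
    and "banach_subspace X N"
    and "mean_lipschitz s \<subseteq> X" and "X \<subseteq> bloch"
  shows "(bounded_op X N (besov p) (besov_norm p) (cesaro \<mu> \<alpha>) \<longleftrightarrow>
          compact_op X N (besov p) (besov_norm p) (cesaro \<mu> \<alpha>)) \<and>
         (compact_op X N (besov p) (besov_norm p) (cesaro \<mu> \<alpha>) \<longleftrightarrow>
          summable (\<lambda>n. real (n + 1) powr (p * \<alpha> - 1) * moment \<mu> n powr p * ln (real n + 2) powr p))"
proof -
  interpret unit_interval_measure \<mu>
    using assms(4,5) by (simp add: unit_interval_measure_def unit_interval_measure_axioms_def)
  have p: "1 \<le> p" "1 \<le> \<alpha> * p"
    using assms(1,3) by (auto simp: field_simps)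
  have iff: "summable (\<lambda>n. real (n + 1) powr (p * \<alpha> - 1) * moment \<mu> n powr p * ln (real n + 2) powr p)
     \<longleftrightarrow> summable (\<lambda>k. dyadic_moment \<alpha> k powr p)"
    using summable_moment_iff_dyadic[of \<alpha> p] assms(1) p by (simp add: mult.commute)
  have test: "log_test \<in> X"
    using log_test_mem_mean_lipschitz[OF assms(2)] assms(7) by blast
  have nec: "summable (\<lambda>k. dyadic_moment \<alpha> k powr p)" if "linear_op X (besov p) (cesaro \<mu> \<alpha>)"
    using dyadic_summable_of_log_test[OF assms(1) p(1)] that test by (simp add: linear_op_def)
  have suff: "bounded_op X N (besov p) (besov_norm p) (cesaro \<mu> \<alpha>) \<and>
      compact_op X N (besov p) (besov_norm p) (cesaro \<mu> \<alpha>)"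
    if "summable (\<lambda>k. dyadic_moment \<alpha> k powr p)"
    using cesaro_bounded_and_compact[OF assms(1) p that assms(6,8)] by blast
  show ?thesis
    unfolding iff using nec suff by (auto simp: bounded_op_def compact_op_def)
qed

end
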